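(* \textsc{MD-SPP} is fixed-parameter tractable when parameterized by the number $|K|$ of commodities.
   Context: For a digraph $D=(V,E)$, $\mathcal{T}(D)$ is its transitive closure (edge $(i,j)$ iff $D$ has a directed $i$-$j$-path); for a directed path $P$, $\mathcal{T}(P)$ is the transitive closure of $P$. \textsc{MD-SPP}: input is a digraph $D$, an integer $T$, and a set $K$ of routed commodities $(s,t,P)$ with $s,t\in V$ and $P$ a directed $s$-$t$-path in $D$; the question is whether there is a subgraph $H$ of $\mathcal{T}(D)$ of maximum outdegree at most $T$ such that for every $(s,t,P)\in K$ there is a directed $s$-$t$-path in $H\cap\mathcal{T}(P)$. *)

theory Defs
  imports "Graph_Theory.Pair_Digraph" "Graph_Theory.Digraph_Component"
begin

section \<open>The problem\<close>

text \<open>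
  The closure has a loop at every vertex on a closed walk.  Loops are never needed by a subgraph,
  since paths do not use them.
\<close>

definition transitive_closure :: "'a pair_pre_digraph \<Rightarrow> 'a pair_pre_digraph" where
  "transitive_closure G = \<lparr> pverts = pverts G, parcs = (parcs G)\<^sup>+ \<rparr>"

text \<open>The start vertex is an argument because a path of length zero has no arcs.\<close>

definition path_digraph :: "'a \<Rightarrow> ('a \<times> 'a) awalk \<Rightarrow> 'a pair_pre_digraph" where
  "path_digraph s P = \<lparr> pverts = set (pawalk_verts s P), parcs = set P \<rparr>"

definition digraph_inter ::
  "'a pair_pre_digraph \<Rightarrow> 'a pair_pre_digraph \<Rightarrow> 'a pair_pre_digraph" where
  "digraph_inter G H = \<lparr> pverts = pverts G \<inter> pverts H, parcs = parcs G \<inter> parcs H \<rparr>"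

text \<open>Meant for finite digraphs; the empty digraph has maximum outdegree 0.\<close>

definition max_outdegree :: "('a, 'b) pre_digraph \<Rightarrow> nat" where
  "max_outdegree G = Max (insert 0 (out_degree G ` verts G))"

record md_spp =
  digraph_of :: "nat pair_pre_digraph"
  degree_bound :: int
  commodities :: "(nat \<times> nat \<times> (nat \<times> nat) awalk) set"

definition md_spp_instance :: "md_spp \<Rightarrow> bool" where
  "md_spp_instance I \<longleftrightarrow>
     pair_fin_digraph (digraph_of I) \<and>
     finite (commodities I) \<and>
     (\<forall>(s, t, P) \<in> commodities I.
        s \<in> pverts (digraph_of I) \<and> t \<in> pverts (digraph_of I) \<and>
        pre_digraph.apath (with_proj (digraph_of I)) s P t)"

definition md_spp_yes :: "md_spp \<Rightarrow> bool" where
  "md_spp_yes I \<longleftrightarrow>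
     (\<exists>H :: nat pair_pre_digraph.
        subgraph (with_proj H) (with_proj (transitive_closure (digraph_of I))) \<and>
        int (max_outdegree (with_proj H)) \<le> degree_bound I \<and>
        (\<forall>(s, t, P) \<in> commodities I.
           \<exists>Q. pre_digraph.apath
                 (with_proj (digraph_inter H (transitive_closure (path_digraph s P)))) s Q t))"


section \<open>Model of computation\<close>

text \<open>
  Programs are first-order functional programs over binary trees (pure Lisp with a single atom)
  under call-by-value, as in Jones, \<^emph>\<open>Computability and Complexity from a Programming
  Perspective\<close>.  Every evaluation step inspects or allocates at most one node and subtrees are
  shared, not copied; hence for a fixed program the number of steps is polynomially related to the
  running time of a Turing machine.
\<close>

datatype data = Leaf | Node data data

primrec data_size :: "data \<Rightarrow> nat" where
  "data_size Leaf = 1"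
| "data_size (Node a b) = Suc (data_size a + data_size b)"

text \<open>
  \<open>Arg i\<close> is the \<open>i\<close>-th argument of the function whose body is being evaluated;
  \<open>Call f\<close> calls the \<open>f\<close>-th function of the program, a program being
  the list of its function bodies.
\<close>

datatype expr =
    Arg nat
  | MkLeaf
  | MkNode expr expr
  | GetLeft expr
  | GetRight expr
  | IfNode expr expr expr
  | Call nat "expr list"

type_synonym program = "expr list"

primrec left :: "data \<Rightarrow> data" where
  "left Leaf = Leaf"
| "left (Node a b) = a"

primrec right :: "data \<Rightarrow> data" where
  "right Leaf = Leaf"
| "right (Node a b) = b"

text \<open>
  \<open>evaluates p args e v n\<close>: in program \<open>p\<close> with arguments \<open>args\<close>, evaluating \<open>e\<close> terminates
  with value \<open>v\<close> after \<open>n\<close> steps.  An access to a missing argument or function has no value.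
\<close>

inductive evaluates :: "program \<Rightarrow> data list \<Rightarrow> expr \<Rightarrow> data \<Rightarrow> nat \<Rightarrow> bool"
  and evaluates_list :: "program \<Rightarrow> data list \<Rightarrow> expr list \<Rightarrow> data list \<Rightarrow> nat \<Rightarrow> bool"
  for p :: program
where
  ev_Arg: "i < length args \<Longrightarrow> evaluates p args (Arg i) (args ! i) 1"
| ev_MkLeaf: "evaluates p args MkLeaf Leaf 1"
| ev_MkNode: "evaluates p args e1 v1 n1 \<Longrightarrow> evaluates p args e2 v2 n2 \<Longrightarrow>
    evaluates p args (MkNode e1 e2) (Node v1 v2) (Suc (n1 + n2))"
| ev_GetLeft: "evaluates p args e v n \<Longrightarrow> evaluates p args (GetLeft e) (left v) (Suc n)"
| ev_GetRight: "evaluates p args e v n \<Longrightarrow> evaluates p args (GetRight e) (right v) (Suc n)"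
| ev_IfTrue: "evaluates p args c u m \<Longrightarrow> u \<noteq> Leaf \<Longrightarrow> evaluates p args e1 v n \<Longrightarrow>
    evaluates p args (IfNode c e1 e2) v (Suc (m + n))"
| ev_IfFalse: "evaluates p args c Leaf m \<Longrightarrow> evaluates p args e2 v n \<Longrightarrow>
    evaluates p args (IfNode c e1 e2) v (Suc (m + n))"
| ev_Call: "evaluates_list p args es vs m \<Longrightarrow> f < length p \<Longrightarrow> evaluates p vs (p ! f) v n \<Longrightarrow>
    evaluates p args (Call f es) v (Suc (m + n))"
| ev_Nil: "evaluates_list p args [] [] 0"
| ev_Cons: "evaluates p args e v m \<Longrightarrow> evaluates_list p args es vs n \<Longrightarrow>
    evaluates_list p args (e # es) (v # vs) (m + n)"

lemma evaluates_deterministic: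
  "evaluates p args e v n \<Longrightarrow> evaluates p args e v' n' \<Longrightarrow> v' = v \<and> n' = n"
  "evaluates_list p args es vs m \<Longrightarrow> evaluates_list p args es vs' m' \<Longrightarrow> vs' = vs \<and> m' = m"
proof (induction arbitrary: v' n' and vs' m' rule: evaluates_evaluates_list.inducts)
  case ev_Arg
  from ev_Arg.prems show ?case by cases auto
next
  case ev_MkLeaf
  from ev_MkLeaf.prems show ?case by cases auto
next
  case ev_MkNode
  from ev_MkNode.prems show ?case by cases (use ev_MkNode.IH in blast)
next
  case ev_GetLeft
  from ev_GetLeft.prems show ?case by cases (use ev_GetLeft.IH in blast)
next
  case ev_GetRight
  from ev_GetRight.prems show ?case by cases (use ev_GetRight.IH in blast)
next
  case ev_IfTrue
  from ev_IfTrue.prems show ?case by cases (use ev_IfTrue in blast)+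
next
  case ev_IfFalse
  from ev_IfFalse.prems show ?case by cases (use ev_IfFalse in blast)+
next
  case ev_Call
  from ev_Call.prems show ?case by cases (use ev_Call.IH in blast)
next
  case ev_Nil
  from ev_Nil.prems show ?case by cases auto
next
  case ev_Cons
  from ev_Cons.prems show ?case by cases (use ev_Cons.IH in blast)
qed

definition runs :: "program \<Rightarrow> data \<Rightarrow> data \<Rightarrow> nat \<Rightarrow> bool" where
  "runs p x v n \<longleftrightarrow> evaluates p [x] (Call 0 [Arg 0]) v n"


section \<open>Encodings\<close>

primrec enc_list :: "data list \<Rightarrow> data" where
  "enc_list [] = Leaf"
| "enc_list (x # xs) = Node x (enc_list xs)"

definition enc_bool :: "bool \<Rightarrow> data" where
  "enc_bool b = (if b then Node Leaf Leaf else Leaf)"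

text \<open>Binary representation, least significant bit first, without leading zeros.\<close>

fun enc_nat :: "nat \<Rightarrow> data" where
  "enc_nat n = (if n = 0 then Leaf else Node (enc_bool (odd n)) (enc_nat (n div 2)))"

declare enc_nat.simps [simp del]

definition enc_int :: "int \<Rightarrow> data" where
  "enc_int z = Node (enc_bool (z < 0)) (enc_nat (nat \<bar>z\<bar>))"

definition enc_arc :: "nat \<times> nat \<Rightarrow> data" where
  "enc_arc = (\<lambda>(u, v). Node (enc_nat u) (enc_nat v))"

definition enc_commodity :: "nat \<times> nat \<times> (nat \<times> nat) awalk \<Rightarrow> data" where
  "enc_commodity =
     (\<lambda>(s, t, P). Node (enc_nat s) (Node (enc_nat t) (enc_list (map enc_arc P))))"

text \<open>
  The sets of vertices, arcs and commodities are listed in an arbitrary order without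
  repetition, so an instance has several encodings.
\<close>

definition md_spp_encoding :: "md_spp \<Rightarrow> data \<Rightarrow> bool" where
  "md_spp_encoding I x \<longleftrightarrow>
     (\<exists>vs as ks.
        distinct vs \<and> set vs = pverts (digraph_of I) \<and>
        distinct as \<and> set as = parcs (digraph_of I) \<and>
        distinct ks \<and> set ks = commodities I \<and>
        x = enc_list [enc_list (map enc_nat vs), enc_list (map enc_arc as),
                      enc_int (degree_bound I), enc_list (map enc_commodity ks)])"

lemma md_spp_encoding_exists:
  assumes "md_spp_instance I"
  shows "\<exists>x. md_spp_encoding I x"
proof -
  interpret pair_fin_digraph "digraph_of I"
    using assms by (simp add: md_spp_instance_def)
  have "finite (commodities I)"
    using assms by (simp add: md_spp_instance_def)
  then show ?thesis
    unfolding md_spp_encoding_def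
    using finite_distinct_list[OF pair_finite_verts] finite_distinct_list[OF pair_finite_arcs]
      finite_distinct_list[of "commodities I"]
    by blast
qed

lemma enc_list_inject: "enc_list xs = enc_list ys \<longleftrightarrow> xs = ys"
proof (induction xs arbitrary: ys)
  case Nil
  then show ?case by (cases ys) auto
next
  case (Cons x xs)
  then show ?case by (cases ys) auto
qed

lemma enc_bool_inject: "enc_bool a = enc_bool b \<longleftrightarrow> a = b"
  by (auto simp: enc_bool_def)

lemma enc_nat_inject: "enc_nat m = enc_nat n \<longleftrightarrow> m = n"
proof (induction m arbitrary: n rule: less_induct)
  case (less m)
  show ?case
  proof (cases "m = 0 \<or> n = 0")
    case True
    then show ?thesis
      by (auto simp: enc_nat.simps[of 0] enc_nat.simps[of m] enc_nat.simps[of n])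
  next
    case False
    then have "enc_nat m = enc_nat n \<longleftrightarrow> (odd m \<longleftrightarrow> odd n) \<and> m div 2 = n div 2"
      using less[of "m div 2" "n div 2"]
      by (simp add: enc_nat.simps[of m] enc_nat.simps[of n] enc_bool_inject)
    also have "\<dots> \<longleftrightarrow> m = n"
      by presburger
    finally show ?thesis .
  qed
qed

lemma enc_int_inject: "enc_int y = enc_int z \<longleftrightarrow> y = z"
  by (auto simp: enc_int_def enc_bool_inject enc_nat_inject)

lemma inj_enc_nat: "inj enc_nat"
  by (simp add: inj_def enc_nat_inject)

lemma inj_enc_arc: "inj enc_arc"
  by (auto simp: inj_def enc_arc_def enc_nat_inject)

lemma inj_enc_commodity: "inj enc_commodity"
  by (auto simp: inj_def enc_commodity_def enc_nat_inject enc_list_inject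
      inj_map_eq_map[OF inj_enc_arc])

lemma md_spp_encoding_unique:
  fixes I J :: md_spp
  assumes "md_spp_encoding I x" "md_spp_encoding J x"
  shows "I = J"
  using assms unfolding md_spp_encoding_def
  by (auto simp: enc_list_inject enc_int_inject inj_map_eq_map[OF inj_enc_nat]
      inj_map_eq_map[OF inj_enc_arc] inj_map_eq_map[OF inj_enc_commodity]
      intro!: md_spp.equality pair_pre_digraph.equality)


section \<open>Fixed-parameter tractability\<close>

text \<open>Numbers in unary; which total functions are computable does not depend on this choice.\<close>

definition computable :: "(nat \<Rightarrow> nat) \<Rightarrow> bool" where
  "computable f \<longleftrightarrow>
     (\<exists>p. \<forall>k. \<exists>n. runs p (enc_list (replicate k Leaf)) (enc_list (replicate (f k) Leaf)) n)"

text \<open>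
  A parameterized problem is given by its set of instances, the relation between instances
  and their encodings, the parameter and the set of yes-instances.  It is fixed-parameter
  tractable if one program decides every encoded instance within \<open>f k * \<bar>x\<bar> ^ c\<close> steps, where
  \<open>k\<close> is the parameter and \<open>f\<close> is computable.  The output \<^const>\<open>Leaf\<close> means no, any other
  output means yes.
\<close>

definition fixed_parameter_tractable ::
  "'i set \<Rightarrow> ('i \<Rightarrow> data \<Rightarrow> bool) \<Rightarrow> ('i \<Rightarrow> nat) \<Rightarrow> 'i set \<Rightarrow> bool" where
  "fixed_parameter_tractable Inst encodes param Yes \<longleftrightarrow>
     (\<exists>p f c. computable f \<and>
        (\<forall>I \<in> Inst. \<forall>x. encodes I x \<longrightarrow>
           (\<exists>v n. runs p x v n \<and> n \<le> f (param I) * data_size x ^ c \<and>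
                  (v \<noteq> Leaf \<longleftrightarrow> I \<in> Yes))))"

end

theory Submission
  imports Defs
begin

text \<open>
  A solution is determined by the set of vertices that each commodity visits. If two vertices are
  visited by the same commodities, then their exits can be exchanged and some visits become
  superfluous; hence a shortest solution visits at most \<open>2 ^ k + 2 * k\<close> vertices.

  The algorithm computes a small set \<open>Z\<close> of vertices that contains a solution if there is one. It
  starts with the sources and sinks and repeatedly adds, for each \<open>u \<in> Z\<close> and each set of paths,
  some number \<open>N\<close> of the vertices that come after \<open>u\<close> on exactly these paths, or all of them if there
  are fewer than \<open>N\<close>. Suppose that a solution leaves \<open>Z\<close> along an arc from \<open>u\<close> to \<open>v\<close>. Then \<open>N\<close>
  vertices on the same side of \<open>u\<close> as \<open>v\<close> are available, and by Ramsey's theorem some of them form a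
  chain that every path traverses forward or backward. If the outdegree \<open>2\<close> is allowed, then all
  commodities on this arc can be sent to the middle of the chain instead and be delivered from there,
  at most one per chain vertex and direction. If only outdegree \<open>1\<close> is allowed, then vertices other
  than the sources and sinks are never useful. Finally, all routings within \<open>Z\<close> are tried.

  No program is written down. Functions on trees that some program computes with time and output
  size polynomial in a given bound are closed under composition and under recursion along lists with
  bounded results, and the algorithm is a composition of such functions.
\<close>

section \<open>Polynomially bounded functional programs\<close>

text \<open>Two points complete the picture. Rerouting consumes new vertices, so a budget is needed.
  A rerouted commodity keeps its visits up to \<open>u\<close>, follows the chain and jumps to its
  sink, which brings it into \<open>Z\<close> completely, while the others gain only vertices of
  \<open>Z\<close>. So there are at most \<open>k\<close> rounds with \<open>2 * k + 1\<close> new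
  vertices each, and never more than \<open>2 ^ k + 2 * k + k * (2 * k + 1)\<close> vertices are
  visited. This number governs both constants of the construction. With at least as many rounds of
  growing, a path that leaves \<open>Z\<close> must skip a round: otherwise its \<open>r\<close>-th
  vertex would belong to \<open>Z\<close> after \<open>r\<close> rounds. At the arc that skips a
  round, the candidates from \<open>u\<close> are known to be plentiful. And a sample must contain
  that many vertices besides the Ramsey number, so that its chain can avoid all visited ones.
  Running times are polynomial in a bound that may exceed the input size. If the bound includes a
  function of the parameter, this becomes the required product of a function of \<open>k\<close> and
  a power of the size.\<close>

primrec shift_calls :: "nat \<Rightarrow> expr \<Rightarrow> expr" where
  "shift_calls m (Arg i) = Arg i"
| "shift_calls m MkLeaf = MkLeaf"
| "shift_calls m (MkNode a b) = MkNode (shift_calls m a) (shift_calls m b)"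
| "shift_calls m (GetLeft a) = GetLeft (shift_calls m a)"
| "shift_calls m (GetRight a) = GetRight (shift_calls m a)"
| "shift_calls m (IfNode a b c) = IfNode (shift_calls m a) (shift_calls m b) (shift_calls m c)"
| "shift_calls m (Call f es) = Call (m + f) (map (shift_calls m) es)"

lemma evaluates_append:
  "evaluates p args e v n \<Longrightarrow> evaluates (p @ q) args e v n"
  "evaluates_list p args es vs n \<Longrightarrow> evaluates_list (p @ q) args es vs n"
proof (induction rule: evaluates_evaluates_list.inducts)
  case (ev_Call args es vs m f v n)
  then show ?case
    by (intro evaluates_evaluates_list.ev_Call) (auto simp: nth_append)
qed (auto intro: evaluates_evaluates_list.intros simp del: One_nat_def)

text \<open>Calls are by index, so two programs are joined by appending the second with its call
  targets moved past the first. Together with \<open>evaluates_append\<close>, both run unchanged in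
  the joint program.\<close>

lemma evaluates_shift_calls:
  "evaluates q args e v n \<Longrightarrow>
     evaluates (p @ map (shift_calls (length p)) q) args (shift_calls (length p) e) v n"
  "evaluates_list q args es vs n \<Longrightarrow>
     evaluates_list (p @ map (shift_calls (length p)) q) args (map (shift_calls (length p)) es) vs n"
proof (induction rule: evaluates_evaluates_list.inducts)
  case (ev_Call args es vs m f v n)
  then show ?case
    unfolding shift_calls.simps
    by (intro evaluates_evaluates_list.ev_Call) (auto simp: nth_append)
qed (auto intro: evaluates_evaluates_list.intros simp del: One_nat_def)

text \<open>The base \<open>b x + 2\<close> is at least 2, so a larger exponent absorbs constant
  factors, and one exponent can serve several functions. The bound \<open>b\<close> need not be the
  input size; in the end it contains a function of the parameter.\<close>

definition computes_within ::
  "program \<Rightarrow> expr \<Rightarrow> data set \<Rightarrow> (data \<Rightarrow> nat) \<Rightarrow> (data \<Rightarrow> data) \<Rightarrow> nat \<Rightarrow> bool" where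
  "computes_within p e D b F c \<longleftrightarrow>
     (\<forall>x\<in>D. (\<exists>n \<le> (b x + 2) ^ c. evaluates p [x] e (F x) n) \<and> data_size (F x) \<le> (b x + 2) ^ c)"

text \<open>
  The output size needs a bound of its own, since subtrees are shared and the tree size may be
  exponential in the running time.
\<close>

definition poly_time :: "data set \<Rightarrow> (data \<Rightarrow> nat) \<Rightarrow> (data \<Rightarrow> data) \<Rightarrow> bool" where
  "poly_time D b F \<longleftrightarrow>
     (\<forall>x\<in>D. data_size x \<le> b x) \<and> (\<exists>p e c. computes_within p e D b F c)"

lemma poly_time_size_le: "poly_time D b F \<Longrightarrow> x \<in> D \<Longrightarrow> data_size x \<le> b x"
  unfolding poly_time_def by blast

lemma computes_within_append:
  "computes_within p e D b F c \<Longrightarrow> computes_within (p @ q) e D b F c"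
  unfolding computes_within_def by (meson evaluates_append(1))

lemma computes_within_shift_calls:
  "computes_within q e D b F c \<Longrightarrow>
     computes_within (p @ map (shift_calls (length p)) q) (shift_calls (length p) e) D b F c"
  unfolding computes_within_def by (meson evaluates_shift_calls(1))

lemma power_add_two_mono: "c \<le> d \<Longrightarrow> (n + 2 :: nat) ^ c \<le> (n + 2) ^ d"
  by (rule power_increasing) auto

lemma computes_within_mono:
  assumes "computes_within p e D b F c" "c \<le> d"
  shows "computes_within p e D b F d"
  unfolding computes_within_def
proof (intro ballI conjI)
  fix x assume "x \<in> D"
  have le: "(b x + 2) ^ c \<le> (b x + 2) ^ d"
    using assms(2) by (rule power_add_two_mono)
  with assms(1) \<open>x \<in> D\<close> show "\<exists>n \<le> (b x + 2) ^ d. evaluates p [x] e (F x) n"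
    unfolding computes_within_def by (meson le_trans)
  from le assms(1) \<open>x \<in> D\<close> show "data_size (F x) \<le> (b x + 2) ^ d"
    unfolding computes_within_def by (meson le_trans)
qed

lemma poly_time_common_program:
  assumes "poly_time D b F" "poly_time D' b' G"
  obtains p e e' c where "computes_within p e D b F c" "computes_within p e' D' b' G c"
proof -
  from assms obtain p e c q e' c' where
    *: "computes_within p e D b F c" "computes_within q e' D' b' G c'"
    unfolding poly_time_def by blast
  show ?thesis
    by (rule that[OF computes_within_mono[OF computes_within_append[OF *(1)]]
          computes_within_mono[OF computes_within_shift_calls[OF *(2)], of "max c c'"]]) simp_all
qed

lemma poly_time_common_program3:
  assumes "poly_time D b F" "poly_time D' b' G" "poly_time D'' b'' H"
  obtains p e e' e'' c where "computes_within p e D b F c" "computes_within p e' D' b' G c"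
    "computes_within p e'' D'' b'' H c"
proof -
  from assms(1,2) obtain p e e' c where
    *: "computes_within p e D b F c" "computes_within p e' D' b' G c"
    by (rule poly_time_common_program)
  from assms(3) obtain q e'' c' where **: "computes_within q e'' D'' b'' H c'"
    unfolding poly_time_def by blast
  show ?thesis
    by (rule that[OF computes_within_mono[OF computes_within_append[OF *(1)]]
          computes_within_mono[OF computes_within_append[OF *(2)]]
          computes_within_mono[OF computes_within_shift_calls[OF **], of "max c c'"]]) simp_all
qed

lemma data_size_ge_1: "1 \<le> data_size x"
  by (cases x) auto

lemma data_size_left: "data_size (left x) \<le> data_size x"
  by (cases x) auto

lemma data_size_right: "data_size (right x) \<le> data_size x"
  by (cases x) auto

lemma one_le_power_add_two: "1 \<le> (n + 2 :: nat) ^ c"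
  by simp

text \<open>Enough room to add up a few bounds with exponent \<open>c\<close> and a constant overhead.\<close>

lemma power_add_two_room: "32 * (n + 2 :: nat) ^ c \<le> (n + 2) ^ (c + 5)"
proof -
  have "(2::nat) ^ 5 \<le> (n + 2) ^ 5"
    by (rule power_mono) auto
  then show ?thesis
    by (simp add: power_add mult.commute)
qed

lemma poly_time_size:
  assumes "poly_time D b F"
  obtains c where "\<And>x. x \<in> D \<Longrightarrow> data_size (F x) \<le> (b x + 2) ^ c"
  using assms unfolding poly_time_def computes_within_def by blast

section \<open>Closure of polynomial time under the constructs of the language and
  composition\<close>

lemma poly_time_id:
  assumes "\<And>x. x \<in> D \<Longrightarrow> data_size x \<le> b x"
  shows "poly_time D b (\<lambda>x. x)"
proof -
  have "computes_within [] (Arg 0) D b (\<lambda>x. x) 1"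
    unfolding computes_within_def
    using assms ev_Arg[of 0 "[x]" for x] by (fastforce intro!: exI[of _ 1])
  with assms show ?thesis
    unfolding poly_time_def by blast
qed

lemma poly_time_Leaf:
  assumes "\<And>x. x \<in> D \<Longrightarrow> data_size x \<le> b x"
  shows "poly_time D b (\<lambda>x. Leaf)"
proof -
  have "computes_within [] MkLeaf D b (\<lambda>x. Leaf) 1"
    unfolding computes_within_def by (fastforce intro!: exI[of _ 1] ev_MkLeaf)
  with assms show ?thesis
    unfolding poly_time_def by blast
qed

lemma poly_time_Node:
  assumes "poly_time D b F" "poly_time D b G"
  shows "poly_time D b (\<lambda>x. Node (F x) (G x))"
proof -
  from assms obtain p e e' c where
    *: "computes_within p e D b F c" "computes_within p e' D b G c"
    by (rule poly_time_common_program)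
  have "computes_within p (MkNode e e') D b (\<lambda>x. Node (F x) (G x)) (c + 5)"
    unfolding computes_within_def
  proof (intro ballI conjI)
    fix x assume x: "x \<in> D"
    note room = power_add_two_room[of "b x" c] one_le_power_add_two[of "b x" c]
    from * x obtain n n' where
      "n \<le> (b x + 2) ^ c" "evaluates p [x] e (F x) n" "n' \<le> (b x + 2) ^ c" "evaluates p [x] e' (G x) n'"
      unfolding computes_within_def by meson
    then have "evaluates p [x] (MkNode e e') (Node (F x) (G x)) (Suc (n + n'))"
      "Suc (n + n') \<le> (b x + 2) ^ (c + 5)"
      using room by (blast intro: ev_MkNode, linarith)
    then show "\<exists>n\<le>(b x + 2) ^ (c + 5). evaluates p [x] (MkNode e e') (Node (F x) (G x)) n" by blast
    have "data_size (F x) \<le> (b x + 2) ^ c" "data_size (G x) \<le> (b x + 2) ^ c"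
      using * x unfolding computes_within_def by meson+
    then show "data_size (Node (F x) (G x)) \<le> (b x + 2) ^ (c + 5)"
      using room by (simp only: data_size.simps)
  qed
  with assms show ?thesis
    unfolding poly_time_def by blast
qed

lemma poly_time_unary:
  assumes F: "poly_time D b F"
    and op: "\<And>p args e v n. evaluates p args e v n \<Longrightarrow> evaluates p args (op e) (h v) (Suc n)"
    and size: "\<And>v. data_size (h v) \<le> data_size v"
  shows "poly_time D b (\<lambda>x. h (F x))"
proof -
  from F obtain p e c where *: "computes_within p e D b F c"
    unfolding poly_time_def by blast
  have "computes_within p (op e) D b (\<lambda>x. h (F x)) (c + 5)"
    unfolding computes_within_def
  proof (intro ballI conjI)
    fix x assume x: "x \<in> D"
    note room = power_add_two_room[of "b x" c] one_le_power_add_two[of "b x" c]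
    from * x obtain n where "n \<le> (b x + 2) ^ c" "evaluates p [x] e (F x) n"
      unfolding computes_within_def by meson
    then have "evaluates p [x] (op e) (h (F x)) (Suc n)" "Suc n \<le> (b x + 2) ^ (c + 5)"
      using room by (blast intro: op, linarith)
    then show "\<exists>n\<le>(b x + 2) ^ (c + 5). evaluates p [x] (op e) (h (F x)) n" by blast
    have "data_size (F x) \<le> (b x + 2) ^ c"
      using * x unfolding computes_within_def by meson
    then show "data_size (h (F x)) \<le> (b x + 2) ^ (c + 5)"
      using room size[of "F x"] by linarith
  qed
  with F show ?thesis
    unfolding poly_time_def by blast
qed

lemma poly_time_left: "poly_time D b F \<Longrightarrow> poly_time D b (\<lambda>x. left (F x))"
  by (rule poly_time_unary[OF _ ev_GetLeft data_size_left])

lemma poly_time_right: "poly_time D b F \<Longrightarrow> poly_time D b (\<lambda>x. right (F x))"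
  by (rule poly_time_unary[OF _ ev_GetRight data_size_right])

lemma poly_time_if:
  assumes "poly_time D b C" "poly_time D b F" "poly_time D b G"
  shows "poly_time D b (\<lambda>x. if C x = Leaf then G x else F x)"
proof -
  from assms obtain p e e' e'' c where
    *: "computes_within p e D b C c" "computes_within p e' D b F c" "computes_within p e'' D b G c"
    by (rule poly_time_common_program3)
  have "computes_within p (IfNode e e' e'') D b (\<lambda>x. if C x = Leaf then G x else F x) (c + 5)"
    unfolding computes_within_def
  proof (intro ballI conjI)
    fix x assume x: "x \<in> D"
    note room = power_add_two_room[of "b x" c] one_le_power_add_two[of "b x" c]
    from * x obtain n n' n'' where
      n: "n \<le> (b x + 2) ^ c" "n' \<le> (b x + 2) ^ c" "n'' \<le> (b x + 2) ^ c" and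
      ev: "evaluates p [x] e (C x) n" "evaluates p [x] e' (F x) n'" "evaluates p [x] e'' (G x) n''"
      unfolding computes_within_def by meson
    show "\<exists>n\<le>(b x + 2) ^ (c + 5).
        evaluates p [x] (IfNode e e' e'') (if C x = Leaf then G x else F x) n"
    proof (cases "C x = Leaf")
      case True
      then have "evaluates p [x] (IfNode e e' e'') (G x) (Suc (n + n''))"
        "Suc (n + n'') \<le> (b x + 2) ^ (c + 5)"
        using room n ev by (metis ev_IfFalse, linarith)
      with True show ?thesis by auto
    next
      case False
      then have "evaluates p [x] (IfNode e e' e'') (F x) (Suc (n + n'))"
        "Suc (n + n') \<le> (b x + 2) ^ (c + 5)"
        using room n ev by (metis ev_IfTrue, linarith)
      with False show ?thesis by auto
    qed
    have "data_size (F x) \<le> (b x + 2) ^ c" "data_size (G x) \<le> (b x + 2) ^ c"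
      using * x unfolding computes_within_def by meson+
    then show "data_size (if C x = Leaf then G x else F x) \<le> (b x + 2) ^ (c + 5)"
      using room by simp
  qed
  with assms show ?thesis
    unfolding poly_time_def by blast
qed

lemma power_power_bound:
  fixes s :: nat
  assumes "s \<le> (n + 2) ^ a"
  shows "(s + 2) ^ c \<le> (n + 2) ^ ((a + 2) * c)"
proof -
  have "s + 2 \<le> (n + 2) ^ (a + 2)"
  proof -
    have "s + 2 \<le> 4 * (n + 2) ^ a"
      using assms one_le_power_add_two[of n a] by linarith
    also have "\<dots> \<le> (n + 2) ^ 2 * (n + 2) ^ a"
    proof -
      have "(2::nat) ^ 2 \<le> (n + 2) ^ 2" by (rule power_mono) auto
      then show ?thesis by (intro mult_right_mono) simp_all
    qed
    also have "\<dots> = (n + 2) ^ (a + 2)" by (simp only: power_add mult.commute)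
    finally show ?thesis .
  qed
  then have "(s + 2) ^ c \<le> ((n + 2) ^ (a + 2)) ^ c" by (rule power_mono) simp
  then show ?thesis by (simp only: power_mult)
qed

lemma evaluates_list_single:
  "evaluates p args e v n \<Longrightarrow> evaluates_list p args [e] [v] n"
  using ev_Cons[of p args e v n "[]" "[]" 0] ev_Nil by simp

lemma evaluates_list_pair:
  "evaluates p args e v n \<Longrightarrow> evaluates p args e' v' n' \<Longrightarrow>
     evaluates_list p args [e, e'] [v, v'] (n + n')"
  using ev_Cons[of p args e v n "[e']" "[v']" n'] evaluates_list_single by simp

text \<open>Substituting the code of \<open>G\<close> for \<open>Arg 0\<close> in that of
  \<open>F\<close> would evaluate it once per occurrence. Instead the code of \<open>F\<close>
  becomes a new function that is called once on the value of \<open>G\<close>.\<close>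

lemma poly_time_comp:
  assumes "poly_time D' b' F" "poly_time D b G"
    and dom: "\<And>x. x \<in> D \<Longrightarrow> G x \<in> D'"
    and bound: "\<And>x. x \<in> D \<Longrightarrow> b' (G x) \<le> (b x + 2) ^ a"
  shows "poly_time D b (\<lambda>x. F (G x))"
proof -
  from assms(1,2) obtain p e e' c where
    *: "computes_within p e D' b' F c" "computes_within p e' D b G c"
    by (rule poly_time_common_program)
  define d where "d = c + (a + 2) * c + 5"
  have "computes_within (p @ [e]) (Call (length p) [e']) D b (\<lambda>x. F (G x)) d"
    unfolding computes_within_def
  proof (intro ballI conjI)
    fix x assume x: "x \<in> D"
    have le: "(b' (G x) + 2) ^ c \<le> (b x + 2) ^ ((a + 2) * c)"
      using bound[OF x] by (rule power_power_bound)
    have room: "32 * (b x + 2) ^ (c + (a + 2) * c) \<le> (b x + 2) ^ d"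
      unfolding d_def by (rule power_add_two_room)
    have up: "(b x + 2) ^ c \<le> (b x + 2) ^ (c + (a + 2) * c)"
      "(b x + 2) ^ ((a + 2) * c) \<le> (b x + 2) ^ (c + (a + 2) * c)"
      by (rule power_add_two_mono; simp)+
    from * x dom obtain n m where
      nm: "n \<le> (b x + 2) ^ c" "m \<le> (b' (G x) + 2) ^ c" and
      ev: "evaluates p [x] e' (G x) n" "evaluates p [G x] e (F (G x)) m"
      unfolding computes_within_def by meson
    have "evaluates (p @ [e]) [x] (Call (length p) [e']) (F (G x)) (Suc (n + m))"
      by (rule ev_Call[OF evaluates_list_single[OF evaluates_append(1)[OF ev(1)]]])
        (use evaluates_append(1)[OF ev(2)] in auto)
    moreover have "Suc (n + m) \<le> (b x + 2) ^ d"
      using nm le up room one_le_power_add_two[of "b x" "c + (a + 2) * c"] by linarith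
    ultimately show "\<exists>n\<le>(b x + 2) ^ d.
        evaluates (p @ [e]) [x] (Call (length p) [e']) (F (G x)) n"
      by blast
    have "data_size (F (G x)) \<le> (b' (G x) + 2) ^ c"
      using * dom[OF x] unfolding computes_within_def by meson
    then show "data_size (F (G x)) \<le> (b x + 2) ^ d"
      using le up room by linarith
  qed
  with assms show ?thesis
    unfolding poly_time_def by blast
qed

section \<open>Recursion along the right spine of a tree, that is, along an encoded list\<close>

primrec spine_rec :: "(data \<Rightarrow> data \<Rightarrow> data) \<Rightarrow> data \<Rightarrow> data \<Rightarrow> data" where
  "spine_rec G s Leaf = s"
| "spine_rec G s (Node a l) = G (Node a l) (spine_rec G s l)"

primrec spine_length :: "data \<Rightarrow> nat" where
  "spine_length Leaf = 0"
| "spine_length (Node a l) = Suc (spine_length l)"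

lemma spine_length_le_size: "spine_length l \<le> data_size l"
  by (induction l) auto

text \<open>A function with a context \<open>x\<close> and a further argument \<open>y\<close> is
  treated as a function of \<open>Node x y\<close>. Nothing is assumed about \<open>y\<close>; only
  its size enters the bound.\<close>

definition with_arg :: "data set \<Rightarrow> data set" where
  "with_arg D = {Node x y |x y. x \<in> D}"

definition with_arg_bound :: "(data \<Rightarrow> nat) \<Rightarrow> data \<Rightarrow> nat" where
  "with_arg_bound b z = b (left z) + data_size (right z) + 1"

abbreviation poly_time_arg :: "data set \<Rightarrow> (data \<Rightarrow> nat) \<Rightarrow> (data \<Rightarrow> data) \<Rightarrow> bool" where
  "poly_time_arg D b \<equiv> poly_time (with_arg D) (with_arg_bound b)"

text \<open>Iterating a polynomial step may blow up exponentially, for instance by repeated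
  doubling. The assumption \<open>bound\<close> excludes this by one polynomial for all intermediate
  results; then every step has an argument of polynomial size, and there are at most as many steps
  as \<open>L x\<close> has nodes.\<close>

lemma poly_time_spine_rec:
  assumes L: "poly_time D b L" and S: "poly_time D b S"
    and G: "poly_time_arg D b
              (\<lambda>z. G (left z) (left (right z)) (right (right z)))"
    and bound: "\<And>x l. x \<in> D \<Longrightarrow> data_size l \<le> data_size (L x) \<Longrightarrow>
                  data_size (spine_rec (G x) (S x) l) \<le> (b x + 2) ^ a"
  shows "poly_time D b (\<lambda>x. spine_rec (G x) (S x) (L x))"
proof -
  from L S G obtain p eL eS eG c where
    *: "computes_within p eL D b L c" "computes_within p eS D b S c"
      "computes_within p eG (with_arg D) (with_arg_bound b)
         (\<lambda>z. G (left z) (left (right z)) (right (right z))) c"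
    by (rule poly_time_common_program3)
  define f where "f = length p"
  \<comment> \<open>Function \<open>f\<close> takes the context as \<open>Arg 0\<close> and the
    current list as \<open>Arg 1\<close>. The step \<open>f + 1\<close> and the base case
    \<open>f + 2\<close> come from expressions with a single argument, so the step receives context,
    list and recursive result packed into one tree.\<close>
  define body where "body = IfNode (Arg 1)
     (Call (f + 1) [MkNode (Arg 0) (MkNode (Arg 1) (Call f [Arg 0, GetRight (Arg 1)]))])
     (Call (f + 2) [Arg 0])"
  define q where "q = p @ [body, eG, eS]"
  have q_nth: "q ! f = body" "q ! Suc f = eG" "q ! Suc (Suc f) = eS" "length q = f + 3"
    by (auto simp: q_def f_def nth_append)
  define e where "e = a + c + 5"
  have arg0: "evaluates q [x, l] (Arg 0) x 1" for x l
    using ev_Arg[of 0 "[x, l]" q] by simp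
  have arg1: "evaluates q [x, l] (Arg 1) l 1" for x l
    using ev_Arg[of 1 "[x, l]" q] by simp
  \<comment> \<open>Besides the recursive call and the step function, one level of the recursion
    takes 11 evaluation steps, which the constant 12 covers.\<close>
  have rec: "\<exists>n \<le> Suc (spine_length l) * (12 + (b x + 2) ^ ((e + 2) * c)).
      evaluates q [x, l] body (spine_rec (G x) (S x) l) n"
    if x: "x \<in> D" and l: "data_size l \<le> data_size (L x)" for x l
    using l
  proof (induction l)
    case Leaf
    from * x obtain n where n: "n \<le> (b x + 2) ^ c" "evaluates p [x] eS (S x) n"
      unfolding computes_within_def by meson
    have "evaluates q [x, Leaf] (Call (f + 2) [Arg 0]) (S x) (Suc (1 + n))"
      by (rule ev_Call[OF evaluates_list_single[OF arg0]])
        (use q_nth evaluates_append(1)[OF n(2), of "[body, eG, eS]"] in \<open>auto simp: q_def\<close>)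
    with arg1[of x Leaf] have "evaluates q [x, Leaf] body (S x) (Suc (1 + Suc (1 + n)))"
      unfolding body_def by (rule ev_IfFalse)
    moreover have "(b x + 2) ^ c \<le> (b x + 2) ^ ((e + 2) * c)"
      by (rule power_add_two_mono) (simp add: e_def)
    then have "Suc (1 + Suc (1 + n)) \<le> Suc (spine_length Leaf) * (12 + (b x + 2) ^ ((e + 2) * c))"
      using n(1) by (simp only: spine_length.simps mult_Suc mult_0)
    ultimately show ?case unfolding spine_rec.simps by blast
  next
    case (Node h l)
    define r where "r = spine_rec (G x) (S x) l"
    define z where "z = Node x (Node (Node h l) r)"
    have "data_size l \<le> data_size (L x)" using Node.prems by simp
    with Node.IH(2) obtain n where
      n: "n \<le> Suc (spine_length l) * (12 + (b x + 2) ^ ((e + 2) * c))"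
        "evaluates q [x, l] body r n"
      unfolding r_def by blast
    have "z \<in> with_arg D" using x by (auto simp: z_def with_arg_def)
    with *(3) obtain m where
      m: "m \<le> (with_arg_bound b z + 2) ^ c" "evaluates p [z] eG (G x (Node h l) r) m"
      unfolding computes_within_def z_def by fastforce
    have "with_arg_bound b z \<le> (b x + 2) ^ e"
    proof -
      have "data_size (Node h l) \<le> (b x + 2) ^ c"
        using *(1) x Node.prems unfolding computes_within_def by (meson le_trans)
      moreover have "data_size r \<le> (b x + 2) ^ a"
        unfolding r_def using bound[OF x] Node.prems by simp
      moreover have "(b x + 2) ^ c \<le> (b x + 2) ^ (a + c)" "(b x + 2) ^ a \<le> (b x + 2) ^ (a + c)"
        by (rule power_add_two_mono; simp)+
      moreover have "32 * (b x + 2) ^ (a + c) \<le> (b x + 2) ^ e"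
        unfolding e_def by (rule power_add_two_room)
      moreover have "16 * (b x + 2) \<le> (b x + 2) ^ e"
      proof -
        have "(2::nat) ^ 4 * (b x + 2) \<le> (b x + 2) ^ 4 * (b x + 2)"
          by (rule mult_right_mono[OF power_mono]) auto
        also have "\<dots> = (b x + 2) ^ 5" by (simp add: numeral_eq_Suc)
        also have "\<dots> \<le> (b x + 2) ^ e"
          by (rule power_add_two_mono) (simp add: e_def)
        finally show ?thesis by simp
      qed
      moreover have "with_arg_bound b z = b x + data_size (Node h l) + data_size r + 2"
        by (simp add: with_arg_bound_def z_def)
      moreover have "A \<le> X \<Longrightarrow> R \<le> Y \<Longrightarrow> X \<le> Z \<Longrightarrow> Y \<le> Z \<Longrightarrow> 32 * Z \<le> E \<Longrightarrow> 16 * (B + 2) \<le> E \<Longrightarrow>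
          W = B + A + R + 2 \<Longrightarrow> W \<le> E" for A B E R W X Y Z :: nat
        by simp
      ultimately show ?thesis by blast
    qed
    then have "(with_arg_bound b z + 2) ^ c \<le> (b x + 2) ^ ((e + 2) * c)"
      by (rule power_power_bound)
    with m(1) have m': "m \<le> (b x + 2) ^ ((e + 2) * c)" by simp
    have "evaluates q [x, Node h l] (GetRight (Arg 1)) l 2"
      using ev_GetRight[OF arg1[of x "Node h l"]] by (simp add: numeral_2_eq_2)
    from evaluates_list_pair[OF arg0 this]
    have "evaluates q [x, Node h l] (Call f [Arg 0, GetRight (Arg 1)]) r (Suc (1 + 2 + n))"
      by (rule ev_Call) (use q_nth n(2) in auto)
    from ev_MkNode[OF arg0 ev_MkNode[OF arg1 this]]
    have "evaluates q [x, Node h l]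
        (MkNode (Arg 0) (MkNode (Arg 1) (Call f [Arg 0, GetRight (Arg 1)]))) z (n + 8)"
      by (simp add: z_def numeral_eq_Suc)
    from evaluates_list_single[OF this]
    have "evaluates q [x, Node h l]
        (Call (f + 1) [MkNode (Arg 0) (MkNode (Arg 1) (Call f [Arg 0, GetRight (Arg 1)]))])
        (G x (Node h l) r) (Suc (n + 8 + m))"
      by (rule ev_Call)
        (use q_nth evaluates_append(1)[OF m(2), of "[body, eG, eS]"] in \<open>auto simp: q_def\<close>)
    from ev_IfTrue[OF arg1 _ this]
    have "evaluates q [x, Node h l] body (G x (Node h l) r) (Suc (1 + Suc (n + 8 + m)))"
      unfolding body_def by simp
    moreover have "Suc (1 + Suc (n + 8 + m))
        \<le> Suc (spine_length (Node h l)) * (12 + (b x + 2) ^ ((e + 2) * c))"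
      using n(1) m' by (simp add: algebra_simps)
    ultimately show ?case unfolding spine_rec.simps r_def by blast
  qed
  define d where "d = a + (c + ((e + 2) * c + 5)) + 5"
  have "computes_within q (Call f [Arg 0, eL]) D b (\<lambda>x. spine_rec (G x) (S x) (L x)) d"
    unfolding computes_within_def
  proof (intro ballI conjI)
    fix x assume x: "x \<in> D"
    from * x obtain n where
      n: "n \<le> (b x + 2) ^ c" "evaluates p [x] eL (L x) n"
      unfolding computes_within_def by meson
    from rec[OF x, of "L x"] obtain m where
      m: "m \<le> Suc (spine_length (L x)) * (12 + (b x + 2) ^ ((e + 2) * c))"
        "evaluates q [x, L x] body (spine_rec (G x) (S x) (L x)) m"
      by auto
    have "evaluates q [x] (Arg 0) x 1" using ev_Arg[of 0 "[x]" q] by simp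
    moreover have "evaluates q [x] eL (L x) n"
      unfolding q_def using n(2) by (rule evaluates_append)
    ultimately have "evaluates_list q [x] [Arg 0, eL] [x, L x] (1 + n)"
      by (rule evaluates_list_pair)
    then have "evaluates q [x] (Call f [Arg 0, eL]) (spine_rec (G x) (S x) (L x)) (Suc (1 + n + m))"
      by (rule ev_Call) (use q_nth m(2) in auto)
    moreover have "Suc (1 + n + m) \<le> (b x + 2) ^ d"
    proof -
      have "spine_length (L x) \<le> (b x + 2) ^ c"
        using *(1) x spine_length_le_size[of "L x"]
        unfolding computes_within_def by (meson le_trans)
      then have "Suc (spine_length (L x)) \<le> 2 * (b x + 2) ^ c"
        using one_le_power_add_two[of "b x" c] by linarith
      moreover have "12 + (b x + 2) ^ ((e + 2) * c) \<le> 16 * (b x + 2) ^ ((e + 2) * c)"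
        using one_le_power_add_two[of "b x" "(e + 2) * c"] by linarith
      ultimately have "m \<le> (2 * (b x + 2) ^ c) * (16 * (b x + 2) ^ ((e + 2) * c))"
        using m(1) by (meson le_trans mult_le_mono)
      also have "\<dots> = 32 * ((b x + 2) ^ (c + (e + 2) * c))" by (simp add: power_add)
      also have "\<dots> \<le> (b x + 2) ^ (c + (e + 2) * c + 5)" by (rule power_add_two_room)
      also have "\<dots> \<le> (b x + 2) ^ (a + (c + ((e + 2) * c + 5)))"
        by (rule power_add_two_mono) simp
      finally have "m \<le> (b x + 2) ^ (a + (c + ((e + 2) * c + 5)))" .
      moreover have "(b x + 2) ^ c \<le> (b x + 2) ^ (a + (c + ((e + 2) * c + 5)))"
        by (rule power_add_two_mono) simp
      moreover have "32 * (b x + 2) ^ (a + (c + ((e + 2) * c + 5))) \<le> (b x + 2) ^ d"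
        unfolding d_def by (rule power_add_two_room)
      ultimately show ?thesis
        using n(1) one_le_power_add_two[of "b x" "a + (c + ((e + 2) * c + 5))"] by linarith
    qed
    ultimately show "\<exists>n\<le>(b x + 2) ^ d.
        evaluates q [x] (Call f [Arg 0, eL]) (spine_rec (G x) (S x) (L x)) n" by blast
    have "data_size (spine_rec (G x) (S x) (L x)) \<le> (b x + 2) ^ a"
      using bound[OF x] by simp
    also have "\<dots> \<le> (b x + 2) ^ d" by (rule power_add_two_mono) (simp add: d_def)
    finally show "data_size (spine_rec (G x) (S x) (L x)) \<le> (b x + 2) ^ d" .
  qed
  with assms show ?thesis
    unfolding poly_time_def by blast
qed

lemma with_arg_iff: "z \<in> with_arg D \<longleftrightarrow> z \<noteq> Leaf \<and> left z \<in> D"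
  by (cases z) (auto simp: with_arg_def)

lemma with_arg_size_le:
  assumes "\<And>x. x \<in> D \<Longrightarrow> data_size x \<le> b x" "z \<in> with_arg D"
  shows "data_size z \<le> with_arg_bound b z"
proof -
  from assms(2) obtain x y where z: "z = Node x y" "x \<in> D"
    by (auto simp: with_arg_def)
  with assms(1)[of x] show ?thesis by (simp add: with_arg_bound_def)
qed

lemma poly_time_with_arg:
  assumes "poly_time D b F"
  shows "poly_time_arg D b (\<lambda>z. F (left z))"
proof (rule poly_time_comp[OF assms, where a = 1])
  show "poly_time_arg D b left"
    by (intro poly_time_left poly_time_id with_arg_size_le poly_time_size_le[OF assms])
qed (auto simp: with_arg_iff with_arg_bound_def)

lemma poly_time_arg_comp:
  assumes "poly_time_arg D b (\<lambda>z. F (left z) (right z))"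
    and "poly_time_arg D b H"
  shows "poly_time_arg D b (\<lambda>z. F (left z) (H z))"
proof -
  obtain c where c: "\<And>z. z \<in> with_arg D \<Longrightarrow> data_size (H z) \<le> (with_arg_bound b z + 2) ^ c"
    using assms(2) by (rule poly_time_size) blast
  have "poly_time_arg D b
      (\<lambda>z. (\<lambda>z. F (left z) (right z)) (Node (left z) (H z)))"
  proof (rule poly_time_comp[OF assms(1), where a = "c + 1 + 5"])
    show "poly_time_arg D b (\<lambda>z. Node (left z) (H z))"
      using poly_time_size_le[OF assms(1)] assms(2)
      by (intro poly_time_Node poly_time_left poly_time_id)
    fix z assume z: "z \<in> with_arg D"
    then show "Node (left z) (H z) \<in> with_arg D" by (auto simp: with_arg_iff)
    let ?n = "with_arg_bound b z"
    have "(?n + 2) ^ c \<le> (?n + 2) ^ (c + 1)" "(?n + 2) ^ 1 \<le> (?n + 2) ^ (c + 1)"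
      by (rule power_add_two_mono; simp)+
    moreover have "with_arg_bound b (Node (left z) (H z)) \<le> ?n + data_size (H z) + 1"
      by (simp add: with_arg_bound_def)
    ultimately show "with_arg_bound b (Node (left z) (H z)) \<le> (?n + 2) ^ (c + 1 + 5)"
      using c[OF z] power_add_two_room[of ?n "c + 1"] by simp
  qed
  then show ?thesis by simp
qed

lemma spine_rec_size_add:
  assumes "\<And>l r. l \<noteq> Leaf \<Longrightarrow> data_size l \<le> m \<Longrightarrow> data_size (G l r) \<le> data_size r + h"
    and "data_size l \<le> m"
  shows "data_size (spine_rec G s l) \<le> data_size s + spine_length l * h"
  using assms(2)
proof (induction l)
  case (Node a l)
  then have "data_size (spine_rec G s l) \<le> data_size s + spine_length l * h" by simp
  moreover have "data_size (G (Node a l) (spine_rec G s l)) \<le> data_size (spine_rec G s l) + h"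
    using Node.prems by (intro assms(1)) auto
  ultimately show ?case by simp
qed simp

text \<open>Additive growth is harmless: the total growth is at most the length of the list times
  the growth of one step. This suits maps and concatenations.\<close>

lemma poly_time_spine_rec_add:
  assumes L: "poly_time D b L" and S: "poly_time D b S"
    and G: "poly_time_arg D b
              (\<lambda>z. G (left z) (left (right z)) (right (right z)))"
    and growth: "\<And>x l r. x \<in> D \<Longrightarrow> l \<noteq> Leaf \<Longrightarrow> data_size l \<le> data_size (L x) \<Longrightarrow>
                  data_size (G x l r) \<le> data_size r + (b x + 2) ^ a"
  shows "poly_time D b (\<lambda>x. spine_rec (G x) (S x) (L x))"
proof -
  obtain c where c: "\<And>x. x \<in> D \<Longrightarrow> data_size (L x) \<le> (b x + 2) ^ c"
    using L by (rule poly_time_size) blast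
  obtain d where d: "\<And>x. x \<in> D \<Longrightarrow> data_size (S x) \<le> (b x + 2) ^ d"
    using S by (rule poly_time_size) blast
  show ?thesis
  proof (rule poly_time_spine_rec[OF L S G, where a = "a + c + d + 5"])
    fix x l assume x: "x \<in> D" and l: "data_size l \<le> data_size (L x)"
    have "data_size (spine_rec (G x) (S x) l) \<le> data_size (S x) + spine_length l * (b x + 2) ^ a"
      using growth[OF x] l by (rule spine_rec_size_add)
    also have "\<dots> \<le> (b x + 2) ^ d + (b x + 2) ^ c * (b x + 2) ^ a"
      using d[OF x] c[OF x] l spine_length_le_size[of l]
      by (intro add_mono mult_mono) auto
    also have "\<dots> = (b x + 2) ^ d + (b x + 2) ^ (a + c)" by (simp only: power_add mult.commute)
    also have "\<dots> \<le> (b x + 2) ^ (a + c + d + 5)"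
    proof -
      have "(b x + 2) ^ d \<le> (b x + 2) ^ (a + c + d)" "(b x + 2) ^ (a + c) \<le> (b x + 2) ^ (a + c + d)"
        by (rule power_add_two_mono; simp)+
      then show ?thesis using power_add_two_room[of "b x" "a + c + d"] by linarith
    qed
    finally show "data_size (spine_rec (G x) (S x) l) \<le> (b x + 2) ^ (a + c + d + 5)" .
  qed
qed

text \<open>The constants fit the state of \<open>d_search\<close>: a counter of at most 6 times the
  size of the initial cells, one node above it, and a flag of size at most 3.\<close>

lemma poly_time_spine_rec_bounded:
  assumes L: "poly_time D b L" and S: "poly_time D b S"
    and G: "poly_time_arg D b
              (\<lambda>z. G (left z) (left (right z)) (right (right z)))"
    and B: "poly_time D b B"
    and bound: "\<And>x l. x \<in> D \<Longrightarrow> data_size l \<le> data_size (L x) \<Longrightarrow>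
                  data_size (spine_rec (G x) (S x) l) \<le> 6 * data_size (B x) + 4"
  shows "poly_time D b (\<lambda>x. spine_rec (G x) (S x) (L x))"
proof -
  obtain c where c: "\<And>x. x \<in> D \<Longrightarrow> data_size (B x) \<le> (b x + 2) ^ c"
    using B by (rule poly_time_size) blast
  show ?thesis
  proof (rule poly_time_spine_rec[OF L S G, where a = "c + 5"])
    fix x l assume "x \<in> D" "data_size l \<le> data_size (L x)"
    with c[of x] bound[of x l] show "data_size (spine_rec (G x) (S x) l) \<le> (b x + 2) ^ (c + 5)"
      using power_add_two_room[of "b x" c] one_le_power_add_two[of "b x" c] by linarith
  qed
qed

abbreviation True_data :: data where
  "True_data \<equiv> Node Leaf Leaf"

lemma enc_bool_simps [simp]: "enc_bool True = True_data" "enc_bool False = Leaf"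
  by (simp_all add: enc_bool_def)

text \<open>Programs can only test for \<open>Leaf\<close>, so equality needs a simultaneous
  traversal of both trees. It recurses into both subtrees and is thus no instance of
  \<open>spine_rec\<close>; at most 20 steps are spent per node of the first tree.\<close>

lemma poly_time_eq:
  assumes "poly_time D b F" "poly_time D b G"
  shows "poly_time D b (\<lambda>x. enc_bool (F x = G x))"
proof -
  from assms obtain p e e' c where
    *: "computes_within p e D b F c" "computes_within p e' D b G c"
    by (rule poly_time_common_program)
  define f where "f = length p"
  define body where "body = IfNode (Arg 0)
     (IfNode (Arg 1)
       (IfNode (Call f [GetLeft (Arg 0), GetLeft (Arg 1)])
         (Call f [GetRight (Arg 0), GetRight (Arg 1)]) MkLeaf)
       MkLeaf)
     (IfNode (Arg 1) MkLeaf (MkNode MkLeaf MkLeaf))"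
  define q where "q = p @ [body]"
  have q_nth: "q ! f = body" "f < length q"
    by (auto simp: q_def f_def)
  have arg0: "evaluates q [x, l] (Arg 0) x 1" for x l
    using ev_Arg[of 0 "[x, l]" q] by simp
  have arg1: "evaluates q [x, l] (Arg 1) l 1" for x l
    using ev_Arg[of 1 "[x, l]" q] by simp
  have rec: "\<exists>n \<le> 20 * data_size x. evaluates q [x, y] body (enc_bool (x = y)) n" for x y
  proof (induction x arbitrary: y)
    case Leaf
    show ?case
    proof (cases "y = Leaf")
      case True
      have "evaluates q [Leaf, y] (IfNode (Arg 1) MkLeaf (MkNode MkLeaf MkLeaf)) True_data
          (Suc (1 + Suc (1 + 1)))"
        using True arg1[of Leaf Leaf] by (intro ev_IfFalse ev_MkNode ev_MkLeaf) auto
      from ev_IfFalse[OF arg0 this] True show ?thesis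
        unfolding body_def by (intro exI[of _ 7]) (auto simp: numeral_eq_Suc)
    next
      case False
      have "evaluates q [Leaf, y] (IfNode (Arg 1) MkLeaf (MkNode MkLeaf MkLeaf)) Leaf (Suc (1 + 1))"
        using False arg1 by (intro ev_IfTrue ev_MkLeaf) auto
      from ev_IfFalse[OF arg0 this] False show ?thesis
        unfolding body_def by (intro exI[of _ 5]) (auto simp: numeral_eq_Suc)
    qed
  next
    case (Node x1 x2)
    show ?case
    proof (cases y)
      case Leaf
      have "evaluates q [Node x1 x2, y] (IfNode (Arg 1)
         (IfNode (Call f [GetLeft (Arg 0), GetLeft (Arg 1)])
           (Call f [GetRight (Arg 0), GetRight (Arg 1)]) MkLeaf) MkLeaf) Leaf (Suc (1 + 1))"
        using Leaf arg1[of "Node x1 x2" Leaf] by (intro ev_IfFalse ev_MkLeaf) auto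
      from ev_IfTrue[OF arg0 _ this] Leaf show ?thesis
        unfolding body_def by (intro exI[of _ 5]) (auto simp: numeral_eq_Suc)
    next
      case (Node y1 y2)
      let ?args = "[Node x1 x2, y]"
      obtain n1 where n1: "n1 \<le> 20 * data_size x1" "evaluates q [x1, y1] body (enc_bool (x1 = y1)) n1"
        using Node.IH(1) by blast
      obtain n2 where n2: "n2 \<le> 20 * data_size x2" "evaluates q [x2, y2] body (enc_bool (x2 = y2)) n2"
        using Node.IH(2) by blast
      have gets: "evaluates q ?args (GetLeft (Arg 0)) x1 2" "evaluates q ?args (GetLeft (Arg 1)) y1 2"
        "evaluates q ?args (GetRight (Arg 0)) x2 2" "evaluates q ?args (GetRight (Arg 1)) y2 2"
        using ev_GetLeft[OF arg0[of "Node x1 x2" y]] ev_GetLeft[OF arg1[of "Node x1 x2" y]]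
          ev_GetRight[OF arg0[of "Node x1 x2" y]] ev_GetRight[OF arg1[of "Node x1 x2" y]] Node
        by (simp_all add: numeral_2_eq_2)
      have c1: "evaluates q ?args (Call f [GetLeft (Arg 0), GetLeft (Arg 1)]) (enc_bool (x1 = y1))
          (Suc (2 + 2 + n1))"
        by (rule ev_Call[OF evaluates_list_pair[OF gets(1,2)]]) (use q_nth n1 in auto)
      have c2: "evaluates q ?args (Call f [GetRight (Arg 0), GetRight (Arg 1)]) (enc_bool (x2 = y2))
          (Suc (2 + 2 + n2))"
        by (rule ev_Call[OF evaluates_list_pair[OF gets(3,4)]]) (use q_nth n2 in auto)
      let ?inner = "IfNode (Call f [GetLeft (Arg 0), GetLeft (Arg 1)])
           (Call f [GetRight (Arg 0), GetRight (Arg 1)]) MkLeaf"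
      have "\<exists>n \<le> n1 + n2 + 12. evaluates q ?args ?inner (enc_bool (x1 = y1 \<and> x2 = y2)) n"
      proof (cases "x1 = y1")
        case True
        with ev_IfTrue[OF c1 _ c2, of MkLeaf] show ?thesis
          by (intro exI[of _ "11 + (n1 + n2)"]) auto
      next
        case False
        with c1 have "evaluates q ?args (Call f [GetLeft (Arg 0), GetLeft (Arg 1)]) Leaf
          (Suc (2 + 2 + n1))" by simp
        from ev_IfFalse[OF this ev_MkLeaf] False show ?thesis
          by (intro exI[of _ "7 + n1"]) auto
      qed
      then obtain n where n: "n \<le> n1 + n2 + 12"
        "evaluates q ?args ?inner (enc_bool (x1 = y1 \<and> x2 = y2)) n" by blast
      from ev_IfTrue[OF arg0 _ ev_IfTrue[OF arg1 _ n(2)]] Node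
      have "evaluates q ?args body (enc_bool (Node x1 x2 = y)) (4 + n)"
        unfolding body_def by (simp add: numeral_eq_Suc)
      then show ?thesis
        using n(1) n1(1) n2(1) by (intro exI[of _ "4 + n"]) auto
    qed
  qed
  have "computes_within q (Call f [e, e']) D b (\<lambda>x. enc_bool (F x = G x)) (c + 5)"
    unfolding computes_within_def
  proof (intro ballI conjI)
    fix x assume x: "x \<in> D"
    note room = power_add_two_room[of "b x" c] one_le_power_add_two[of "b x" c]
    from * x obtain n n' where
      n: "n \<le> (b x + 2) ^ c" "evaluates p [x] e (F x) n" "n' \<le> (b x + 2) ^ c" "evaluates p [x] e' (G x) n'"
      unfolding computes_within_def by meson
    obtain m where m: "m \<le> 20 * data_size (F x)" "evaluates q [F x, G x] body (enc_bool (F x = G x)) m"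
      using rec by blast
    have "data_size (F x) \<le> (b x + 2) ^ c"
      using * x unfolding computes_within_def by meson
    moreover have "evaluates_list q [x] [e, e'] [F x, G x] (n + n')"
      unfolding q_def using n by (intro evaluates_list_pair evaluates_append)
    then have "evaluates q [x] (Call f [e, e']) (enc_bool (F x = G x)) (Suc (n + n' + m))"
      by (rule ev_Call) (use q_nth m in auto)
    ultimately show "\<exists>n\<le>(b x + 2) ^ (c + 5).
        evaluates q [x] (Call f [e, e']) (enc_bool (F x = G x)) n"
      using n m room by (intro exI[of _ "Suc (n + n' + m)"] conjI) linarith+
    show "data_size (enc_bool (F x = G x)) \<le> (b x + 2) ^ (c + 5)"
    proof -
      have "data_size (enc_bool (F x = G x)) \<le> 3" by (simp add: enc_bool_def)
      then show ?thesis using room by linarith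
    qed
  qed
  with assms show ?thesis
    unfolding poly_time_def by blast
qed

section \<open>List functions on encoded data\<close>

definition d_and :: "data \<Rightarrow> data \<Rightarrow> data" where
  "d_and a c = (if a = Leaf then Leaf else c)"

definition d_or :: "data \<Rightarrow> data \<Rightarrow> data" where
  "d_or a c = (if a = Leaf then c else True_data)"

definition d_not :: "data \<Rightarrow> data" where
  "d_not a = (if a = Leaf then True_data else Leaf)"

definition d_ex :: "(data \<Rightarrow> data) \<Rightarrow> data \<Rightarrow> data" where
  "d_ex q = spine_rec (\<lambda>l r. if q (left l) = Leaf then r else True_data) Leaf"

definition d_all :: "(data \<Rightarrow> data) \<Rightarrow> data \<Rightarrow> data" where
  "d_all q l = d_not (d_ex (\<lambda>a. d_not (q a)) l)"

definition d_filter :: "(data \<Rightarrow> data) \<Rightarrow> data \<Rightarrow> data" where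
  "d_filter q = spine_rec (\<lambda>l r. if q (left l) = Leaf then r else Node (left l) r) Leaf"

text \<open>The predicate sees the whole remaining list, because \<open>d_grow\<close> decides about
  a vertex by what follows it.\<close>

definition d_filter_tails :: "(data \<Rightarrow> data) \<Rightarrow> data \<Rightarrow> data" where
  "d_filter_tails q = spine_rec (\<lambda>l r. if q l = Leaf then r else Node (left l) r) Leaf"

definition d_map :: "(data \<Rightarrow> data) \<Rightarrow> data \<Rightarrow> data" where
  "d_map f = spine_rec (\<lambda>l r. Node (f (left l)) r) Leaf"

definition d_append :: "data \<Rightarrow> data \<Rightarrow> data" where
  "d_append k l = spine_rec (\<lambda>l r. Node (left l) r) l k"

definition d_concat_map :: "(data \<Rightarrow> data) \<Rightarrow> data \<Rightarrow> data" where
  "d_concat_map f = spine_rec (\<lambda>l r. d_append (f (left l)) r) Leaf"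

definition d_mem :: "data \<Rightarrow> data \<Rightarrow> data" where
  "d_mem a l = d_ex (\<lambda>c. enc_bool (c = a)) l"

definition d_after :: "data \<Rightarrow> data \<Rightarrow> data" where
  "d_after u = spine_rec (\<lambda>l r. if left l = u then right l else r) Leaf"

definition d_drop :: "data \<Rightarrow> data \<Rightarrow> data" where
  "d_drop k l = spine_rec (\<lambda>_ r. right r) l k"

lemma enc_bool_eq_Leaf [simp]: "enc_bool P = Leaf \<longleftrightarrow> \<not> P"
  by (cases P) auto

lemma d_and_eq_Leaf [simp]: "d_and a c = Leaf \<longleftrightarrow> a = Leaf \<or> c = Leaf"
  by (auto simp: d_and_def)

lemma d_or_eq_Leaf [simp]: "d_or a c = Leaf \<longleftrightarrow> a = Leaf \<and> c = Leaf"
  by (auto simp: d_or_def)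

lemma d_not_eq_Leaf [simp]: "d_not a = Leaf \<longleftrightarrow> a \<noteq> Leaf"
  by (auto simp: d_not_def)

lemma d_ex_enc_list [simp]: "d_ex q (enc_list xs) = Leaf \<longleftrightarrow> (\<forall>a\<in>set xs. q a = Leaf)"
  by (induction xs) (auto simp: d_ex_def)

lemma d_all_enc_list [simp]: "d_all q (enc_list xs) = Leaf \<longleftrightarrow> (\<exists>a\<in>set xs. q a = Leaf)"
  by (auto simp: d_all_def)

lemma d_mem_enc_list [simp]: "d_mem a (enc_list xs) = Leaf \<longleftrightarrow> a \<notin> set xs"
  by (auto simp: d_mem_def)

lemma d_filter_enc_list [simp]: "d_filter q (enc_list xs) = enc_list (filter (\<lambda>a. q a \<noteq> Leaf) xs)"
  by (induction xs) (auto simp: d_filter_def)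

lemma d_map_enc_list [simp]: "d_map f (enc_list xs) = enc_list (map f xs)"
  by (induction xs) (auto simp: d_map_def)

lemma d_append_enc_list [simp]: "d_append (enc_list xs) (enc_list ys) = enc_list (xs @ ys)"
  by (induction xs) (auto simp: d_append_def)

lemma d_concat_map_enc_list:
  assumes "\<And>a. a \<in> set xs \<Longrightarrow> f a = enc_list (g a)"
  shows "d_concat_map f (enc_list xs) = enc_list (concat (map g xs))"
  using assms by (induction xs) (auto simp: d_concat_map_def)

lemma d_drop_enc_list [simp]: "d_drop (enc_list xs) (enc_list ys) = enc_list (drop (length xs) ys)"
proof (induction xs)
  case (Cons x xs)
  have "right (enc_list zs) = enc_list (tl zs)" for zs by (cases zs) auto
  with Cons show ?case by (simp add: d_drop_def drop_Suc tl_drop)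
qed (simp add: d_drop_def)

lemma enc_list_eq_Leaf [simp]: "enc_list xs = Leaf \<longleftrightarrow> xs = []"
  by (cases xs) auto

subsection \<open>Running times\<close>

lemma poly_time_True_data:
  assumes "\<And>x. x \<in> D \<Longrightarrow> data_size x \<le> b x"
  shows "poly_time D b (\<lambda>x. True_data)"
  using assms by (intro poly_time_Node poly_time_Leaf)

lemma poly_time_and:
  assumes "poly_time D b F" "poly_time D b G"
  shows "poly_time D b (\<lambda>x. d_and (F x) (G x))"
  unfolding d_and_def
  by (intro poly_time_if assms poly_time_Leaf poly_time_size_le[OF assms(1)])

lemma poly_time_or:
  assumes "poly_time D b F" "poly_time D b G"
  shows "poly_time D b (\<lambda>x. d_or (F x) (G x))"
  unfolding d_or_def
  by (intro poly_time_if assms poly_time_True_data poly_time_size_le[OF assms(1)])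

lemma poly_time_not:
  assumes "poly_time D b F"
  shows "poly_time D b (\<lambda>x. d_not (F x))"
  unfolding d_not_def
  by (intro poly_time_if assms poly_time_True_data poly_time_Leaf poly_time_size_le[OF assms])

text \<open>The head of the current list, the current list and the recursive result in a step function.\<close>

lemma poly_time_step_args:
  assumes "\<And>x. x \<in> D \<Longrightarrow> data_size x \<le> b x"
  shows "poly_time_arg D b (\<lambda>z. left (left (right z)))"
    "poly_time_arg D b (\<lambda>z. left (right z))"
    "poly_time_arg D b (\<lambda>z. right (right z))"
    "poly_time_arg D b (\<lambda>z. right z)"
    "poly_time_arg D b (\<lambda>z. Leaf)"
    "poly_time_arg D b (\<lambda>z. True_data)"
  using with_arg_size_le[OF assms]
  by (intro poly_time_left poly_time_right poly_time_id poly_time_Leaf poly_time_True_data; simp)+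

lemma poly_time_ex:
  assumes q: "poly_time_arg D b (\<lambda>z. q (left z) (right z))"
    and L: "poly_time D b L"
  shows "poly_time D b (\<lambda>x. d_ex (q x) (L x))"
  unfolding d_ex_def
proof (rule poly_time_spine_rec_bounded[OF L _ _ L])
  note size = poly_time_size_le[OF L]
  show "poly_time D b (\<lambda>x. Leaf)" using size by (rule poly_time_Leaf)
  show "poly_time_arg D b
    (\<lambda>z. if q (left z) (left (left (right z))) = Leaf then right (right z) else True_data)"
    by (intro poly_time_if poly_time_arg_comp[OF q] poly_time_step_args[OF size])
  show "data_size (spine_rec (\<lambda>l r. if q x (left l) = Leaf then r else True_data) Leaf l)
    \<le> 6 * data_size (L x) + 4" for x l
    by (induction l) auto
qed

lemma poly_time_all:
  assumes "poly_time_arg D b (\<lambda>z. q (left z) (right z))"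
    and "poly_time D b L"
  shows "poly_time D b (\<lambda>x. d_all (q x) (L x))"
  unfolding d_all_def by (intro poly_time_not poly_time_ex assms)

lemma poly_time_mem:
  assumes A: "poly_time D b A" and L: "poly_time D b L"
  shows "poly_time D b (\<lambda>x. d_mem (A x) (L x))"
  unfolding d_mem_def
  by (intro poly_time_ex poly_time_eq poly_time_with_arg[OF A] L
      poly_time_step_args(4)[OF poly_time_size_le[OF L]])

lemma data_size_filter_tails: "data_size (d_filter_tails q l) \<le> data_size l"
  by (induction l) (auto simp: d_filter_tails_def)

lemma poly_time_filter_tails:
  assumes q: "poly_time_arg D b (\<lambda>z. q (left z) (right z))"
    and L: "poly_time D b L"
  shows "poly_time D b (\<lambda>x. d_filter_tails (q x) (L x))"
  unfolding d_filter_tails_def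
proof (rule poly_time_spine_rec_bounded[OF L _ _ L])
  note size = poly_time_size_le[OF L]
  show "poly_time D b (\<lambda>x. Leaf)" using size by (rule poly_time_Leaf)
  show "poly_time_arg D b
    (\<lambda>z. if q (left z) (left (right z)) = Leaf then right (right z)
         else Node (left (left (right z))) (right (right z)))"
    by (intro poly_time_if poly_time_Node poly_time_arg_comp[OF q] poly_time_step_args[OF size])
  fix x l assume "data_size l \<le> data_size (L x)"
  then show "data_size (spine_rec (\<lambda>l r. if q x l = Leaf then r else Node (left l) r) Leaf l)
      \<le> 6 * data_size (L x) + 4"
    using data_size_filter_tails[of "q x" l] unfolding d_filter_tails_def by linarith
qed

lemma d_filter_eq_tails: "d_filter q = d_filter_tails (\<lambda>l. q (left l))"
  by (simp add: d_filter_def d_filter_tails_def)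

lemma poly_time_filter:
  assumes q: "poly_time_arg D b (\<lambda>z. q (left z) (right z))"
    and L: "poly_time D b L"
  shows "poly_time D b (\<lambda>x. d_filter (q x) (L x))"
  unfolding d_filter_eq_tails
  by (intro poly_time_filter_tails L poly_time_arg_comp[OF q] poly_time_left
      poly_time_step_args(4)[OF poly_time_size_le[OF L]])

lemma poly_time_after:
  assumes U: "poly_time D b U" and L: "poly_time D b L"
  shows "poly_time D b (\<lambda>x. d_after (U x) (L x))"
  unfolding d_after_def
proof (rule poly_time_spine_rec_bounded[OF L _ _ L])
  note size = poly_time_size_le[OF L]
  have if_eq: "(if P then u else v) = (if enc_bool P = Leaf then v else u)" for P and u v :: data
    by simp
  show "poly_time D b (\<lambda>x. Leaf)" using size by (rule poly_time_Leaf)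
  show "poly_time_arg D b
    (\<lambda>z. if left (left (right z)) = U (left z) then right (left (right z)) else right (right z))"
    by (subst if_eq)
      (intro poly_time_if poly_time_eq poly_time_right poly_time_with_arg[OF U]
        poly_time_step_args[OF size])
  fix x l assume "data_size l \<le> data_size (L x)"
  moreover have "data_size (spine_rec (\<lambda>l r. if left l = U x then right l else r) Leaf l) \<le> data_size l"
    by (induction l) auto
  ultimately show "data_size (spine_rec (\<lambda>l r. if left l = U x then right l else r) Leaf l)
      \<le> 6 * data_size (L x) + 4" by linarith
qed

lemma poly_time_drop:
  assumes K: "poly_time D b K" and L: "poly_time D b L"
  shows "poly_time D b (\<lambda>x. d_drop (K x) (L x))"
  unfolding d_drop_def
proof (rule poly_time_spine_rec_bounded[OF K L _ L])
  show "poly_time_arg D b (\<lambda>z. right (right (right z)))"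
    by (intro poly_time_right[OF poly_time_step_args(3)[OF poly_time_size_le[OF L]]])
  fix x l
  have "data_size (spine_rec (\<lambda>_. right) (L x) l) \<le> data_size (L x)"
    by (induction l) (auto intro: le_trans[OF data_size_right])
  then show "data_size (spine_rec (\<lambda>_. right) (L x) l) \<le> 6 * data_size (L x) + 4" by linarith
qed

lemma data_size_append: "data_size (d_append k l) \<le> data_size k + data_size l"
  by (induction k) (auto simp: d_append_def)

lemma poly_time_append:
  assumes K: "poly_time D b K" and L: "poly_time D b L"
  shows "poly_time D b (\<lambda>x. d_append (K x) (L x))"
  unfolding d_append_def
proof (rule poly_time_spine_rec_bounded[OF K L _ poly_time_Node[OF K L]])
  show "poly_time_arg D b
    (\<lambda>z. Node (left (left (right z))) (right (right z)))"
    by (intro poly_time_Node poly_time_step_args[OF poly_time_size_le[OF L]])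
  fix x l assume "data_size l \<le> data_size (K x)"
  then show "data_size (spine_rec (\<lambda>l. Node (left l)) (L x) l) \<le> 6 * data_size (Node (K x) (L x)) + 4"
    using data_size_append[of l "L x"] by (simp add: d_append_def)
qed

lemma poly_time_arg_size:
  assumes f: "poly_time_arg D b (\<lambda>z. f (left z) (right z))"
    and L: "poly_time D b L"
  obtains c where "\<And>x l. x \<in> D \<Longrightarrow> data_size l \<le> data_size (L x) \<Longrightarrow>
    data_size (f x (left l)) \<le> (b x + 2) ^ c"
proof -
  obtain c where c: "\<And>x. x \<in> D \<Longrightarrow> data_size (L x) \<le> (b x + 2) ^ c"
    using L by (rule poly_time_size) blast
  obtain d where d: "\<And>z. z \<in> with_arg D \<Longrightarrow>
      data_size (f (left z) (right z)) \<le> (with_arg_bound b z + 2) ^ d"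
    using f by (rule poly_time_size) blast
  show ?thesis
  proof (rule that)
    fix x l assume x: "x \<in> D" and l: "data_size l \<le> data_size (L x)"
    have "(b x + 2) ^ c \<le> (b x + 2) ^ (c + 1)" "(b x + 2) ^ 1 \<le> (b x + 2) ^ (c + 1)"
      by (rule power_add_two_mono; simp)+
    then have "with_arg_bound b (Node x (left l)) \<le> (b x + 2) ^ (c + 1 + 5)"
      using l c[OF x] data_size_left[of l] power_add_two_room[of "b x" "c + 1"]
      by (simp add: with_arg_bound_def)
    then have "(with_arg_bound b (Node x (left l)) + 2) ^ d \<le> (b x + 2) ^ ((c + 1 + 5 + 2) * d)"
      by (rule power_power_bound)
    with d[of "Node x (left l)"] x show "data_size (f x (left l)) \<le> (b x + 2) ^ ((c + 1 + 5 + 2) * d)"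
      by (auto simp: with_arg_def)
  qed
qed

lemma poly_time_map:
  assumes f: "poly_time_arg D b (\<lambda>z. f (left z) (right z))"
    and L: "poly_time D b L"
  shows "poly_time D b (\<lambda>x. d_map (f x) (L x))"
proof -
  note size = poly_time_size_le[OF L]
  obtain c where c: "\<And>x l. x \<in> D \<Longrightarrow> data_size l \<le> data_size (L x) \<Longrightarrow>
    data_size (f x (left l)) \<le> (b x + 2) ^ c"
    using f L by (rule poly_time_arg_size) blast
  show ?thesis
    unfolding d_map_def
  proof (rule poly_time_spine_rec_add[OF L, where a = "c + 5"])
    show "poly_time D b (\<lambda>x. Leaf)" using size by (rule poly_time_Leaf)
    show "poly_time_arg D b
      (\<lambda>z. Node (f (left z) (left (left (right z)))) (right (right z)))"
      by (intro poly_time_Node poly_time_arg_comp[OF f] poly_time_step_args[OF size])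
    fix x l r assume "x \<in> D" "data_size l \<le> data_size (L x)"
    from c[OF this] show "data_size (Node (f x (left l)) r) \<le> data_size r + (b x + 2) ^ (c + 5)"
      using power_add_two_room[of "b x" c] one_le_power_add_two[of "b x" c]
      by (simp only: data_size.simps)
  qed
qed

lemma poly_time_concat_map:
  assumes f: "poly_time_arg D b (\<lambda>z. f (left z) (right z))"
    and L: "poly_time D b L"
  shows "poly_time D b (\<lambda>x. d_concat_map (f x) (L x))"
proof -
  note size = poly_time_size_le[OF L]
  obtain c where c: "\<And>x l. x \<in> D \<Longrightarrow> data_size l \<le> data_size (L x) \<Longrightarrow>
    data_size (f x (left l)) \<le> (b x + 2) ^ c"
    using f L by (rule poly_time_arg_size) blast
  show ?thesis
    unfolding d_concat_map_def
  proof (rule poly_time_spine_rec_add[OF L, where a = c])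
    show "poly_time D b (\<lambda>x. Leaf)" using size by (rule poly_time_Leaf)
    show "poly_time_arg D b
      (\<lambda>z. d_append (f (left z) (left (left (right z)))) (right (right z)))"
      by (intro poly_time_append poly_time_arg_comp[OF f] poly_time_step_args[OF size])
    fix x l r assume "x \<in> D" "data_size l \<le> data_size (L x)"
    from c[OF this] show "data_size (d_append (f x (left l)) r) \<le> data_size r + (b x + 2) ^ c"
      using data_size_append[of "f x (left l)" r] by linarith
  qed
qed

section \<open>Routings as subsets of the paths\<close>

text \<open>The first index of \<open>v\<close>; a vertex that does not occur in \<open>p\<close>
  gets the default \<open>length p\<close>.\<close>

definition position :: "'a list \<Rightarrow> 'a \<Rightarrow> nat" where
  "position p v = length (takeWhile (\<lambda>w. w \<noteq> v) p)"

lemma position_less_length: "v \<in> set p \<Longrightarrow> position p v < length p"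
  unfolding position_def by (induction p) auto

lemma nth_position: "v \<in> set p \<Longrightarrow> p ! position p v = v"
  unfolding position_def by (induction p) auto

lemma position_inject: "u \<in> set p \<Longrightarrow> v \<in> set p \<Longrightarrow> position p u = position p v \<longleftrightarrow> u = v"
  using nth_position by metis

lemma position_nth: "distinct p \<Longrightarrow> i < length p \<Longrightarrow> position p (p ! i) = i"
  by (meson nth_eq_iff_index_eq nth_mem nth_position position_less_length)

lemma position_hd_le: "position p (hd p) \<le> n"
  by (cases p) (auto simp: position_def)

lemma position_le_last: "distinct p \<Longrightarrow> v \<in> set p \<Longrightarrow> position p v \<le> position p (last p)"
  using position_less_length[of v p] position_nth[of p "length p - 1"]
  by (cases "p = []") (auto simp: last_conv_nth)

abbreviation increasing :: "'a list \<Rightarrow> 'a list \<Rightarrow> bool" where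
  "increasing p \<equiv> sorted_wrt (\<lambda>a b. position p a < position p b)"

abbreviation decreasing :: "'a list \<Rightarrow> 'a list \<Rightarrow> bool" where
  "decreasing p \<equiv> sorted_wrt (\<lambda>a b. position p b < position p a)"

definition next_in :: "'a list \<Rightarrow> 'a set \<Rightarrow> 'a \<Rightarrow> 'a \<Rightarrow> bool" where
  "next_in p X u v \<longleftrightarrow> u \<in> X \<and> v \<in> X \<and> position p u < position p v \<and>
     (\<forall>w\<in>X. \<not> (position p u < position p w \<and> position p w < position p v))"

text \<open>
  A routing stores for the \<open>i\<close>-th path only the set \<open>X i\<close> of vertices that its shortcut visits;
  the order of the visits is the order of the path.
\<close>

definition out_set :: "nat \<Rightarrow> (nat \<Rightarrow> 'a list) \<Rightarrow> (nat \<Rightarrow> 'a set) \<Rightarrow> 'a \<Rightarrow> 'a set" where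
  "out_set k p X u = {v. \<exists>i<k. next_in (p i) (X i) u v}"

text \<open>The degree condition ranges over all \<open>u\<close>, so a negative \<open>T\<close>
  admits no routing even if \<open>k = 0\<close>, in agreement with \<open>max_outdegree\<close>,
  which is never negative.\<close>

definition routing :: "nat \<Rightarrow> (nat \<Rightarrow> 'a list) \<Rightarrow> int \<Rightarrow> (nat \<Rightarrow> 'a set) \<Rightarrow> bool" where
  "routing k p T X \<longleftrightarrow>
     (\<forall>i<k. X i \<subseteq> set (p i) \<and> hd (p i) \<in> X i \<and> last (p i) \<in> X i) \<and>
     (\<forall>u. int (card (out_set k p X u)) \<le> T)"

definition paths :: "nat \<Rightarrow> (nat \<Rightarrow> 'a list) \<Rightarrow> bool" where
  "paths k p \<longleftrightarrow> (\<forall>i<k. distinct (p i) \<and> p i \<noteq> [])"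

definition visited :: "nat \<Rightarrow> (nat \<Rightarrow> 'a set) \<Rightarrow> 'a set" where
  "visited k X = (\<Union>i<k. X i)"

definition sources_and_sinks :: "nat \<Rightarrow> (nat \<Rightarrow> 'a list) \<Rightarrow> 'a set" where
  "sources_and_sinks k p = (\<Union>i<k. {hd (p i), last (p i)})"

lemma routing_finite: "routing k p T X \<Longrightarrow> i < k \<Longrightarrow> finite (X i)"
  unfolding routing_def by (meson finite_set finite_subset)

lemma finite_visited: "routing k p T X \<Longrightarrow> finite (visited k X)"
  unfolding visited_def using routing_finite by fast

lemma out_set_subset: "out_set k p X u \<subseteq> visited k X"
  by (auto simp: out_set_def visited_def next_in_def)

lemma card_out_set_mono:
  assumes "routing k p T X" "A \<subseteq> out_set k p X u"
  shows "int (card A) \<le> T"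
proof -
  have "card A \<le> card (out_set k p X u)"
    using finite_subset[OF out_set_subset finite_visited[OF assms(1)]] assms(2) by (rule card_mono)
  moreover have "int (card (out_set k p X u)) \<le> T"
    using assms(1) unfolding routing_def by blast
  ultimately show ?thesis by linarith
qed

section \<open>Shortest routings and the vertices that they visit\<close>

definition total_length :: "nat \<Rightarrow> (nat \<Rightarrow> 'a set) \<Rightarrow> nat" where
  "total_length k X = (\<Sum>i<k. card (X i))"

definition shortest_routing :: "nat \<Rightarrow> (nat \<Rightarrow> 'a list) \<Rightarrow> int \<Rightarrow> (nat \<Rightarrow> 'a set) \<Rightarrow> bool" where
  "shortest_routing k p T X \<longleftrightarrow>
     routing k p T X \<and> (\<forall>Y. routing k p T Y \<longrightarrow> total_length k X \<le> total_length k Y)"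

lemma shortest_routing_exists:
  assumes "routing k p T X"
  obtains Y where "shortest_routing k p T Y"
  using ex_has_least_nat[of "routing k p T" X "total_length k"] assms
  unfolding shortest_routing_def by blast

lemma not_shortest_routing:
  assumes "routing k p T X" "routing k p T Y" "\<And>i. i < k \<Longrightarrow> Y i \<subseteq> X i" "j < k" "Y j \<noteq> X j"
  shows "\<not> shortest_routing k p T X"
proof -
  have "total_length k Y < total_length k X"
    unfolding total_length_def
  proof (rule sum_strict_mono_ex1)
    show "\<forall>i\<in>{..<k}. card (Y i) \<le> card (X i)"
      using assms(3) routing_finite[OF assms(1)] by (auto intro!: card_mono)
    show "\<exists>i\<in>{..<k}. card (Y i) < card (X i)"
      using assms(3-5) routing_finite[OF assms(1)] by (metis lessThan_iff psubsetI psubset_card_mono)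
  qed simp
  with assms(2) show ?thesis unfolding shortest_routing_def by auto
qed

text \<open>
  Suppose that \<open>v\<close> and \<open>w\<close> are visited by the same paths. The paths that visit \<open>v\<close> first can leave
  \<open>v\<close> as they used to leave \<open>w\<close>, and vice versa, without any increase of an outdegree.
\<close>

definition swap_exits :: "(nat \<Rightarrow> 'a list) \<Rightarrow> (nat \<Rightarrow> 'a set) \<Rightarrow> 'a \<Rightarrow> 'a \<Rightarrow> nat \<Rightarrow> 'a set" where
  "swap_exits p X v w i =
     (if v \<in> X i then X i - {y. min (position (p i) v) (position (p i) w) < position (p i) y \<and>
                              position (p i) y \<le> max (position (p i) v) (position (p i) w)}
      else X i)"

lemma swap_exits_commute:
  assumes "\<And>i. i < k \<Longrightarrow> v \<in> X i \<longleftrightarrow> w \<in> X i" "i < k"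
  shows "swap_exits p X v w i = swap_exits p X w v i"
  using assms by (auto simp: swap_exits_def min.commute max.commute)

text \<open>On a path with \<open>v\<close> before \<open>w\<close>, exactly the visits after
  \<open>v\<close> up to and including \<open>w\<close> are dropped, so the old successor of
  \<open>w\<close> becomes that of \<open>v\<close>. On a path with \<open>w\<close> before
  \<open>v\<close>, the vertex \<open>v\<close> itself is dropped and contributes nothing.\<close>

lemma out_set_swap_exits:
  assumes "paths k p" "routing k p T X" "\<And>i. i < k \<Longrightarrow> v \<in> X i \<longleftrightarrow> w \<in> X i"
  shows "out_set k p (swap_exits p X v w) v \<subseteq> out_set k p X w"
proof
  fix y assume "y \<in> out_set k p (swap_exits p X v w) v"
  then obtain i where i: "i < k" and nx: "next_in (p i) (swap_exits p X v w i) v y"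
    by (auto simp: out_set_def)
  then have v: "v \<in> X i" "w \<in> X i"
    using assms(3) by (auto simp: next_in_def swap_exits_def split: if_splits)
  have lt: "\<not> position (p i) w < position (p i) v"
    using nx v by (auto simp: next_in_def swap_exits_def)
  have "next_in (p i) (X i) w y"
    using nx v lt unfolding next_in_def swap_exits_def by (auto simp: min_def max_def)
  then show "y \<in> out_set k p X w" using i by (auto simp: out_set_def)
qed

text \<open>Exchanging the exits of two vertices visited by the same commodities drops at least one
  visit, since on each of their common paths the later of the two disappears. A shortest routing
  leaves no room for that.\<close>

lemma shortest_routing_visits_inj:
  assumes p: "paths k p" and X: "shortest_routing k p T X"
  shows "inj_on (\<lambda>v. {i. i < k \<and> v \<in> X i}) (visited k X - sources_and_sinks k p)"
proof (rule inj_onI, rule ccontr)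
  fix v w
  assume v: "v \<in> visited k X - sources_and_sinks k p" and w: "w \<in> visited k X - sources_and_sinks k p"
    and "{i. i < k \<and> v \<in> X i} = {i. i < k \<and> w \<in> X i}" and ne: "v \<noteq> w"
  then have same: "v \<in> X i \<longleftrightarrow> w \<in> X i" if "i < k" for i
    using that by blast
  have R: "routing k p T X" using X by (simp add: shortest_routing_def)
  define Y where "Y = swap_exits p X v w"
  have Y_sub: "Y i \<subseteq> X i" for i by (auto simp: Y_def swap_exits_def)
  have "routing k p T Y"
    unfolding routing_def
  proof (intro conjI allI impI)
    fix i assume i: "i < k"
    with R have Xi: "X i \<subseteq> set (p i)" "hd (p i) \<in> X i" "last (p i) \<in> X i" and pi: "distinct (p i)" "p i \<noteq> []"
      using p by (auto simp: routing_def paths_def)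
    show "Y i \<subseteq> set (p i)" using Xi Y_sub by blast
    show "hd (p i) \<in> Y i"
      using Xi position_hd_le[of "p i"] by (auto simp: Y_def swap_exits_def not_less)
    have before_last: "position (p i) z < position (p i) (last (p i))"
      if "z \<in> X i" "z \<noteq> last (p i)" for z
    proof -
      have "z \<in> set (p i)" using Xi that by blast
      with that show ?thesis
        using position_le_last[OF pi(1), of z] position_inject[of z "p i" "last (p i)"] pi(2)
        by (simp add: le_neq_implies_less)
    qed
    \<comment> \<open>This is where sinks must be excluded: the dropped interval ends at the later
      of \<open>v\<close> and \<open>w\<close>, hence before the last vertex. The first vertex is
      safe because the interval is open on the left.\<close>
    have "v \<noteq> last (p i)" "w \<noteq> last (p i)"
      using v w i by (auto simp: sources_and_sinks_def)
    then have "max (position (p i) v) (position (p i) w) < position (p i) (last (p i))" if "v \<in> X i"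
      using that same[OF i] before_last by simp
    then show "last (p i) \<in> Y i"
      using Xi(3) by (auto simp: Y_def swap_exits_def)
  next
    fix u
    show "int (card (out_set k p Y u)) \<le> T"
    proof (cases "u = v \<or> u = w")
      case True
      have "out_set k p Y v \<subseteq> out_set k p X w"
        unfolding Y_def using p R same by (rule out_set_swap_exits)
      moreover have "out_set k p Y w = out_set k p (swap_exits p X w v) w"
        unfolding Y_def out_set_def using swap_exits_commute[of k v X w] same by auto
      then have "out_set k p Y w \<subseteq> out_set k p X v"
        using out_set_swap_exits[OF p R] same by simp
      ultimately show ?thesis
        using True card_out_set_mono[OF R] by blast
    next
      case False
      have "out_set k p Y u \<subseteq> out_set k p X u"
      proof
        fix y assume "y \<in> out_set k p Y u"
        then obtain i where i: "i < k" and nx: "next_in (p i) (Y i) u y"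
          by (auto simp: out_set_def)
        have "next_in (p i) (X i) u y"
        proof (cases "v \<in> X i")
          case True
          have sub: "X i \<subseteq> set (p i)" using R i by (auto simp: routing_def)
          define a where "a = min (position (p i) v) (position (p i) w)"
          define c where "c = max (position (p i) v) (position (p i) w)"
          have u: "u \<in> X i" using nx Y_sub by (auto simp: next_in_def)
          with True sub same[OF i] have "u \<in> set (p i)" "v \<in> set (p i)" "w \<in> set (p i)"
            by auto
          then have "position (p i) u \<noteq> position (p i) v" "position (p i) u \<noteq> position (p i) w"
            using False position_inject by metis+
          then have "position (p i) u \<noteq> a" "position (p i) u \<noteq> c"
            by (auto simp: a_def c_def min_def max_def)
          have mem_Y: "z \<in> Y i \<longleftrightarrow> z \<in> X i \<and> \<not> (a < position (p i) z \<and> position (p i) z \<le> c)" for z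
            using True by (auto simp: Y_def swap_exits_def a_def c_def)
          \<comment> \<open>The earlier of \<open>v\<close> and \<open>w\<close> survives right in
            front of the gap, so no arc from another vertex can jump over the gap.\<close>
          have "v \<in> Y i \<and> position (p i) v = a \<or> w \<in> Y i \<and> position (p i) w = a"
            using True same[OF i] mem_Y by (auto simp: a_def min_def)
          then obtain z where z: "z \<in> Y i" "position (p i) z = a" by blast
          show ?thesis
            unfolding next_in_def
          proof (intro conjI ballI notI)
            show "u \<in> X i" "y \<in> X i" "position (p i) u < position (p i) y"
              using nx Y_sub by (auto simp: next_in_def)
            fix x assume x: "x \<in> X i" "position (p i) u < position (p i) x \<and> position (p i) x < position (p i) y"
            have "x \<notin> Y i" using nx x by (auto simp: next_in_def)
            then have "a < position (p i) x" "position (p i) x \<le> c"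
              using x mem_Y by auto
            moreover have "\<not> (position (p i) u < a \<and> a < position (p i) y)"
              using nx z by (auto simp: next_in_def)
            moreover have "u \<in> Y i" using nx by (auto simp: next_in_def)
            ultimately show False
              using x \<open>position (p i) u \<noteq> a\<close> \<open>position (p i) u \<noteq> c\<close> mem_Y[of u] by auto
          qed
        next
          case False
          with nx show ?thesis by (simp add: Y_def swap_exits_def)
        qed
        then show "y \<in> out_set k p X u" using i by (auto simp: out_set_def)
      qed
      then show ?thesis by (rule card_out_set_mono[OF R])
    qed
  qed
  moreover from v obtain j where j: "j < k" "v \<in> X j" by (auto simp: visited_def)
  have "Y j \<noteq> X j"
  proof -
    have "w \<in> X j" "v \<in> set (p j)" "w \<in> set (p j)"
      using j same R by (auto simp: routing_def)
    then have "position (p j) v \<noteq> position (p j) w" using ne position_inject by metis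
    then have "v \<notin> Y j \<or> w \<notin> Y j"
      using j by (auto simp: Y_def swap_exits_def)
    with j \<open>w \<in> X j\<close> show ?thesis by blast
  qed
  ultimately show False
    using not_shortest_routing[OF R _ Y_sub j(1)] X by blast
qed

lemma finite_sources_and_sinks: "finite (sources_and_sinks k p)"
  by (auto simp: sources_and_sinks_def)

lemma card_sources_and_sinks: "card (sources_and_sinks k p) \<le> 2 * k"
proof -
  have "card (sources_and_sinks k p) \<le> (\<Sum>i<k. card {hd (p i), last (p i)})"
    unfolding sources_and_sinks_def by (rule card_UN_le) simp
  also have "\<dots> \<le> (\<Sum>i<k. 2)"
    by (intro sum_mono) (auto simp: card_insert_if)
  finally show ?thesis by simp
qed

lemma shortest_routing_card_visited:
  assumes "paths k p" "shortest_routing k p T X"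
  shows "card (visited k X) \<le> 2 ^ k + 2 * k"
proof -
  have fin: "finite (visited k X)"
    using assms(2) finite_visited unfolding shortest_routing_def by blast
  have "card (visited k X - sources_and_sinks k p) \<le> card (Pow {..<k})"
    by (rule card_inj_on_le[OF shortest_routing_visits_inj[OF assms]]) auto
  then have "card (visited k X - sources_and_sinks k p) \<le> 2 ^ k"
    by (simp add: card_Pow)
  moreover have "card (visited k X) \<le> card (visited k X - sources_and_sinks k p) + card (sources_and_sinks k p)"
  proof -
    have "card (visited k X) \<le> card ((visited k X - sources_and_sinks k p) \<union> sources_and_sinks k p)"
      using fin finite_sources_and_sinks[of k p] by (intro card_mono) auto
    also have "\<dots> \<le> card (visited k X - sources_and_sinks k p) + card (sources_and_sinks k p)"
      by (rule card_Un_le)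
    finally show ?thesis .
  qed
  ultimately show ?thesis using card_sources_and_sinks[of k p] by linarith
qed

text \<open>If \<open>u\<close> has an arc to \<open>v\<close>, it has no other, and bypassing
  \<open>v\<close> lets \<open>u\<close> inherit the at most one arc of \<open>v\<close>. So a
  vertex that is neither source nor sink can be deleted from all commodities without raising an
  outdegree.\<close>

lemma shortest_routing_degree_1:
  assumes p: "paths k p" and X: "shortest_routing k p T X" and T: "T \<le> 1"
  shows "visited k X \<subseteq> sources_and_sinks k p"
proof (rule ccontr)
  assume "\<not> visited k X \<subseteq> sources_and_sinks k p"
  then obtain v j where v: "v \<notin> sources_and_sinks k p" and j: "j < k" "v \<in> X j"
    by (auto simp: visited_def)
  have R: "routing k p T X" using X by (simp add: shortest_routing_def)
  define Y where "Y i = X i - {v}" for i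
  have fin: "finite (out_set k p X u)" for u
    using finite_subset[OF out_set_subset finite_visited[OF R]] .
  have unique: "a = b" if "a \<in> out_set k p X u" "b \<in> out_set k p X u" for a b u
  proof -
    have "card (out_set k p X u) \<le> Suc 0"
      using R T unfolding routing_def by (smt (verit) of_nat_1 of_nat_le_iff One_nat_def)
    then show ?thesis using that fin card_le_Suc0_iff_eq by blast
  qed
  have step: "next_in (p i) (X i) u y \<or> (next_in (p i) (X i) u v \<and> next_in (p i) (X i) v y)"
    if "i < k" "next_in (p i) (Y i) u y" for i u y
  proof (cases "v \<in> X i \<and> position (p i) u < position (p i) v \<and> position (p i) v < position (p i) y")
    case True
    with that(2) show ?thesis
      unfolding next_in_def Y_def by (auto dest: less_trans)
  next
    case False
    with that(2) show ?thesis
      unfolding next_in_def Y_def by auto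
  qed
  have "routing k p T Y"
    unfolding routing_def
  proof (intro conjI allI impI)
    fix i assume i: "i < k"
    then have "v \<noteq> hd (p i)" "v \<noteq> last (p i)"
      using v by (auto simp: sources_and_sinks_def)
    with R i show "Y i \<subseteq> set (p i)" "hd (p i) \<in> Y i" "last (p i) \<in> Y i"
      by (auto simp: Y_def routing_def)
  next
    fix u
    show "int (card (out_set k p Y u)) \<le> T"
    proof (cases "v \<in> out_set k p X u")
      case True
      have "out_set k p Y u \<subseteq> out_set k p X v"
      proof
        fix y assume "y \<in> out_set k p Y u"
        then obtain i where i: "i < k" "next_in (p i) (Y i) u y" by (auto simp: out_set_def)
        then have "y \<noteq> v" by (auto simp: next_in_def Y_def)
        then have "\<not> next_in (p i) (X i) u y"
          using unique[OF _ True, of y] i by (auto simp: out_set_def)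
        with step[OF i] show "y \<in> out_set k p X v" using i by (auto simp: out_set_def)
      qed
      then show ?thesis by (rule card_out_set_mono[OF R])
    next
      case False
      then have "out_set k p Y u \<subseteq> out_set k p X u"
        using step by (fastforce simp: out_set_def)
      then show ?thesis by (rule card_out_set_mono[OF R])
    qed
  qed
  then have "\<not> shortest_routing k p T X"
    by (rule not_shortest_routing[OF R _ _ j(1)]) (use j in \<open>auto simp: Y_def\<close>)
  with X show False by blast
qed

section \<open>Rerouting along monotone chains\<close>

text \<open>Multicolour Ramsey theorem for pairs taken in list order, with a separate target length
  \<open>f \<kappa>\<close> per colour so that the induction can lower a single one. The head sorts
  the other elements into at most \<open>q\<close> classes by colour; if all had fewer than
  \<open>q ^ n\<close> elements, the list would be too short, where \<open>2 \<le> q\<close> pays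
  for the removed head.\<close>

lemma monochromatic_sublist:
  fixes col :: "'a \<Rightarrow> 'a \<Rightarrow> 'c"
  assumes K: "finite K" "card K \<le> q" "2 \<le> q" "\<And>a b. col a b \<in> K"
    and "distinct xs" "q ^ (\<Sum>\<kappa>\<in>K. f \<kappa>) \<le> length xs"
  shows "\<exists>\<kappa>\<in>K. \<exists>ys. distinct ys \<and> set ys \<subseteq> set xs \<and> length ys = f \<kappa> \<and> sorted_wrt (\<lambda>a b. col a b = \<kappa>) ys"
  using assms(5,6)
proof (induction "\<Sum>\<kappa>\<in>K. f \<kappa>" arbitrary: f xs)
  case 0
  from K(4)[of undefined undefined] have "f (col undefined undefined) = 0"
    using 0(1) K(1) by simp
  with K(4)[of undefined undefined] show ?case
    by (intro bexI[of _ "col undefined undefined"] exI[of _ "[]"]) auto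
next
  case (Suc n)
  show ?case
  proof (cases "\<exists>\<kappa>\<in>K. f \<kappa> = 0")
    case True
    then obtain \<kappa> where "\<kappa> \<in> K" "f \<kappa> = 0" by blast
    then show ?thesis by (intro bexI[of _ \<kappa>] exI[of _ "[]"]) auto
  next
    case False
    from Suc.prems(2) K(3) have "xs \<noteq> []" by auto
    then obtain x zs where xs: "xs = x # zs" by (cases xs) auto
    have "\<exists>\<kappa>\<in>K. q ^ n \<le> length (filter (\<lambda>z. col x z = \<kappa>) zs)"
    proof (rule ccontr)
      assume "\<not> ?thesis"
      then have less: "length (filter (\<lambda>z. col x z = \<kappa>) zs) \<le> q ^ n - 1" if "\<kappa> \<in> K" for \<kappa>
        using that by fastforce
      have "distinct zs" using Suc.prems(1) xs by simp
      then have "length zs = card (set zs)" by (simp add: distinct_card)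
      also have "set zs = (\<Union>\<kappa>\<in>K. {z \<in> set zs. col x z = \<kappa>})" using K(4) by auto
      also have "card \<dots> \<le> (\<Sum>\<kappa>\<in>K. card {z \<in> set zs. col x z = \<kappa>})"
        using K(1) by (rule card_UN_le)
      also have "\<dots> \<le> (\<Sum>\<kappa>\<in>K. q ^ n - 1)"
        using less distinct_card[OF distinct_filter[OF \<open>distinct zs\<close>]]
        by (intro sum_mono) (metis set_filter)
      also have "\<dots> \<le> q * (q ^ n - 1)" using K(2) by simp
      also have "\<dots> = q ^ Suc n - q" by (simp add: right_diff_distrib')
      finally have "length zs \<le> q ^ Suc n - q" .
      moreover have "q ^ Suc n \<le> Suc (length zs)"
        using Suc.prems(2) Suc.hyps(2) xs by simp
      moreover have "q ^ 1 \<le> q ^ Suc n" using K(3) by (intro power_increasing) auto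
      ultimately show False using K(3) unfolding power_one_right by linarith
    qed
    then obtain \<kappa> where \<kappa>: "\<kappa> \<in> K" "q ^ n \<le> length (filter (\<lambda>z. col x z = \<kappa>) zs)" by blast
    \<comment> \<open>Inside the large class every element has colour \<open>\<kappa>\<close> with
      \<open>x\<close>. A sublist of colour \<open>\<kappa>\<close> found there is extended by
      \<open>x\<close>, so one element less is demanded of it.\<close>
    define f' where "f' = f(\<kappa> := f \<kappa> - 1)"
    have f\<kappa>: "f \<kappa> = Suc (f' \<kappa>)" using False \<kappa>(1) by (auto simp: f'_def)
    have "sum f' (K - {\<kappa>}) = sum f (K - {\<kappa>})" by (rule sum.cong) (auto simp: f'_def)
    then have n: "n = sum f' K"
      using Suc.hyps(2) sum.remove[OF K(1) \<kappa>(1), of f] sum.remove[OF K(1) \<kappa>(1), of f'] f\<kappa>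
      by simp
    from Suc.hyps(1)[OF n, of "filter (\<lambda>z. col x z = \<kappa>) zs"] \<kappa>(2) Suc.prems(1) xs n
    obtain \<kappa>' ys where ys: "\<kappa>' \<in> K" "distinct ys" "set ys \<subseteq> set (filter (\<lambda>z. col x z = \<kappa>) zs)"
      "length ys = f' \<kappa>'" "sorted_wrt (\<lambda>a b. col a b = \<kappa>') ys"
      by auto
    show ?thesis
    proof (cases "\<kappa>' = \<kappa>")
      case True
      have "distinct (x # ys)" "set (x # ys) \<subseteq> set xs" "length (x # ys) = f \<kappa>"
        "sorted_wrt (\<lambda>a b. col a b = \<kappa>) (x # ys)"
        using ys True Suc.prems(1) xs f\<kappa> by auto
      with \<kappa>(1) show ?thesis by blast
    next
      case False
      then have "f' \<kappa>' = f \<kappa>'" by (simp add: f'_def)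
      with ys xs show ?thesis by (intro bexI[of _ \<kappa>'] exI[of _ ys]) auto
    qed
  qed
qed

text \<open>\<open>Y\<close> is a rerouted path: the old visits up to \<open>u\<close>, then
  \<open>d 0\<close> to \<open>d n\<close>, then the sink. Since the \<open>d j\<close> increase
  beyond \<open>u\<close> and avoid \<open>X\<close>, this is also the order on \<open>P\<close>,
  which determines the new arcs and leaves the earlier ones untouched.\<close>

lemma next_in_splice:
  assumes P: "distinct P" "X \<subseteq> set P" "last P \<in> X" and u: "u \<in> X"
    and d: "\<And>j. j \<le> n \<Longrightarrow> d j \<in> set P \<and> d j \<notin> X \<and> position P u < position P (d j)"
    and mono: "\<And>j j'. j < j' \<Longrightarrow> j' \<le> n \<Longrightarrow> position P (d j) < position P (d j')"
    and Y: "Y = {x \<in> X. position P x \<le> position P u} \<union> d ` {..n} \<union> {last P}"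
  shows "next_in P Y u y \<Longrightarrow> y = d 0"
    and "j \<le> n \<Longrightarrow> next_in P Y (d j) y \<Longrightarrow> j < n \<and> y = d (Suc j) \<or> j = n \<and> y = last P"
    and "w \<noteq> u \<Longrightarrow> w \<notin> d ` {..n} \<Longrightarrow> next_in P Y w y \<Longrightarrow> next_in P X w y"
proof -
  have d_last: "position P (d j) < position P (last P)" if "j \<le> n" for j
    using d[OF that] P position_le_last[OF P(1), of "d j"] position_inject[of "d j" P "last P"]
    by (metis le_neq_implies_less subsetD)
  show "y = d 0" if nx: "next_in P Y u y"
  proof -
    have *: "\<not> position P (d 0) < position P y"
      using nx d[of 0] Y by (auto simp: next_in_def)
    have "y \<notin> {x \<in> X. position P x \<le> position P u}" using nx by (auto simp: next_in_def)
    moreover have "y \<noteq> last P" using * d_last[of 0] by auto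
    ultimately obtain j where j: "j \<le> n" "y = d j" using nx Y by (auto simp: next_in_def)
    with * mono[of 0 j] show ?thesis by (cases "j = 0") auto
  qed
  show "j < n \<and> y = d (Suc j) \<or> j = n \<and> y = last P" if j: "j \<le> n" and nx: "next_in P Y (d j) y"
  proof -
    have *: "\<not> position P (d (Suc j)) < position P y" if "j < n"
      using nx that mono[of j "Suc j"] Y by (auto simp: next_in_def)
    have "y \<notin> {x \<in> X. position P x \<le> position P u}"
      using nx d[OF j] by (auto simp: next_in_def)
    then consider i where "i \<le> n" "y = d i" | "y = last P"
      using nx Y by (auto simp: next_in_def)
    then show ?thesis
    proof cases
      case 1
      have "j < i"
        using 1 nx mono[of i j] j by (cases i j rule: linorder_cases) (auto simp: next_in_def)
      moreover have "\<not> Suc j < i"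
        using * mono[of "Suc j" i] 1 by auto
      ultimately show ?thesis using 1 by (auto simp: not_less less_Suc_eq_le dest: Suc_leI)
    next
      case 2
      then show ?thesis using * d_last[of "Suc j"] j by (auto simp: less_le Suc_leI)
    qed
  qed
  show "next_in P X w y" if w: "w \<noteq> u" "w \<notin> d ` {..n}" and nx: "next_in P Y w y"
  proof -
    have "Y \<subseteq> set P" using Y P u d by auto
    then have "position P y \<le> position P (last P)"
      using nx position_le_last[OF P(1)] by (auto simp: next_in_def)
    then have "w \<noteq> last P" using nx by (auto simp: next_in_def)
    then have wX: "w \<in> X" "position P w \<le> position P u"
      using nx w Y by (auto simp: next_in_def)
    then have "position P w < position P u"
      using w position_inject[of w P u] P u by (metis le_neq_implies_less subsetD)
    moreover have "u \<in> Y" using u Y by auto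
    ultimately have yu: "position P y \<le> position P u"
      using nx by (auto simp: next_in_def not_less)
    then have "y \<notin> d ` {..n}" using d by fastforce
    then have "y \<in> X" using nx Y P(3) by (auto simp: next_in_def)
    then show ?thesis
      using nx wX yu Y by (auto simp: next_in_def)
  qed
qed

text \<open>
  The commodities that use the arc from \<open>u\<close> to \<open>v\<close> go to the middle of the chain instead. From there
  those with increasing positions move forward and the others move backward; the \<open>i\<close>-th commodity
  leaves the chain after \<open>Suc i\<close> steps for its sink, so chain vertices have outdegree at most two.
\<close>

lemma reroute_along_chain:
  fixes p :: "nat \<Rightarrow> 'a list"
  assumes p: "paths k p" and R: "routing k p T X" and T: "2 \<le> T"
    and i0: "i0 < k" "next_in (p i0) (X i0) u v"
    and cs: "distinct cs" "length cs = 2 * k + 1" "set cs \<inter> visited k X = {}"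
    and after: "\<And>i c. i < k \<Longrightarrow> next_in (p i) (X i) u v \<Longrightarrow> c \<in> set cs \<Longrightarrow>
                  c \<in> set (p i) \<and> position (p i) u < position (p i) c"
    and mono: "\<And>i. i < k \<Longrightarrow> next_in (p i) (X i) u v \<Longrightarrow>
                  increasing (p i) cs \<or>
                  decreasing (p i) cs"
  obtains Y where "routing k p T Y" "\<And>i. i < k \<Longrightarrow> Y i \<subseteq> X i \<union> set cs"
    "Y i0 \<subseteq> {x \<in> X i0. position (p i0) x \<le> position (p i0) u} \<union> set cs \<union> {last (p i0)}"
proof -
  define inc where "inc i \<longleftrightarrow> increasing (p i) cs" for i
  \<comment> \<open>The middle of the chain has index \<open>k\<close>. Commodity \<open>i\<close>
    walks \<open>Suc i\<close> steps away from it, and \<open>Suc i \<le> k\<close> keeps the index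
    within the \<open>2 * k + 1\<close> vertices on either side.\<close>
  define d where "d i j = (if inc i then cs ! (k + j) else cs ! (k - j))" for i j
  define Y where "Y i = (if next_in (p i) (X i) u v
    then {x \<in> X i. position (p i) x \<le> position (p i) u} \<union> d i ` {..Suc i} \<union> {last (p i)} else X i)" for i
  have d_mem: "d i j \<in> set cs" if "i < k" "j \<le> Suc i" for i j
    using that cs(2) by (auto simp: d_def intro!: nth_mem)
  have Xi: "X i \<subseteq> set (p i)" "hd (p i) \<in> X i" "last (p i) \<in> X i" "distinct (p i)" "X i \<subseteq> visited k X"
    if "i < k" for i
    using R p that by (auto simp: routing_def paths_def visited_def)
  have d_mono: "position (p i) (d i j) < position (p i) (d i j')"
    if "i < k" "next_in (p i) (X i) u v" "j < j'" "j' \<le> Suc i" for i j j'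
    using mono[OF that(1,2)] that cs(2)
    by (auto simp: d_def inc_def sorted_wrt_iff_nth_less)
  have d_props: "d i j \<in> set (p i) \<and> d i j \<notin> X i \<and> position (p i) u < position (p i) (d i j)"
    if "i < k" "next_in (p i) (X i) u v" "j \<le> Suc i" for i j
    using after[OF that(1,2)] d_mem[OF that(1,3)] Xi(5)[OF that(1)] cs(3) by blast
  have u: "u \<in> X i" if "next_in (p i) (X i) u v" for i
    using that by (simp add: next_in_def)
  note splice = next_in_splice[OF Xi(4,1,3) u d_props d_mono]
  have Y_eq: "Y i = {x \<in> X i. position (p i) x \<le> position (p i) u} \<union> d i ` {..Suc i} \<union> {last (p i)}"
    if "next_in (p i) (X i) u v" for i
    using that by (simp add: Y_def)
  have Y_sub: "Y i \<subseteq> X i \<union> set cs" if "i < k" for i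
    using d_mem[OF that] Xi(3)[OF that] by (auto simp: Y_def)
  have "routing k p T Y"
    unfolding routing_def
  proof (intro conjI allI impI)
    fix i assume i: "i < k"
    show "Y i \<subseteq> set (p i)"
      using Xi[OF i] d_props[OF i] by (auto simp: Y_def split: if_splits)
    show "hd (p i) \<in> Y i"
      using Xi(2)[OF i] position_hd_le[of "p i"] by (auto simp: Y_def)
    show "last (p i) \<in> Y i"
      using Xi(3)[OF i] by (auto simp: Y_def)
  next
    fix w
    have fin: "finite (out_set k p X w)"
      using finite_subset[OF out_set_subset finite_visited[OF R]] .
    show "int (card (out_set k p Y w)) \<le> T"
    proof (cases "w = u")
      case True
      \<comment> \<open>Every commodity that used the arc to \<open>v\<close> is rerouted, so the
        middle of the chain replaces \<open>v\<close> and the outdegree of \<open>u\<close> does not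
        grow.\<close>
      have "out_set k p Y u \<subseteq> insert (cs ! k) (out_set k p X u - {v})"
      proof
        fix y assume "y \<in> out_set k p Y u"
        then obtain i where i: "i < k" "next_in (p i) (Y i) u y" by (auto simp: out_set_def)
        show "y \<in> insert (cs ! k) (out_set k p X u - {v})"
        proof (cases "next_in (p i) (X i) u v")
          case True
          then have "y = d i 0"
            using splice(1)[OF i(1) i(1) i(1) True i(1) True _ i(1) True _ _ Y_eq[OF True] i(2)] by blast
          then show ?thesis by (simp add: d_def)
        next
          case False
          with i show ?thesis by (auto simp: Y_def out_set_def)
        qed
      qed
      then have "card (out_set k p Y u) \<le> card (insert (cs ! k) (out_set k p X u - {v}))"
        using fin True by (intro card_mono) auto
      also have "\<dots> \<le> Suc (card (out_set k p X u - {v}))" by (rule card_insert_le_m1) auto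
      also have "\<dots> = card (out_set k p X u)"
        using i0 fin True by (intro card_Suc_Diff1) (auto simp: out_set_def)
      finally show ?thesis using R True by (auto simp: routing_def intro: order_trans[OF of_nat_mono])
    next
      case wu: False
      show ?thesis
      proof (cases "w \<in> set cs")
        case True
        then obtain m where m: "m < 2 * k + 1" "w = cs ! m" using cs(2) by (metis in_set_conv_nth)
        have out: "\<exists>i j. i < k \<and> w = d i j \<and> j \<le> Suc i \<and>
            (j < Suc i \<and> y = d i (Suc j) \<or> j = Suc i \<and> y = last (p i))"
          if y: "y \<in> out_set k p Y w" for y
        proof -
          from y obtain i where i: "i < k" "next_in (p i) (Y i) w y" by (auto simp: out_set_def)
          then have "w \<in> Y i" by (simp add: next_in_def)
          moreover have "w \<notin> X i" using True cs(3) Xi(5)[OF i(1)] by blast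
          ultimately have g: "next_in (p i) (X i) u v" and "w \<in> d i ` {..Suc i}"
            using Xi(3)[OF i(1)] by (auto simp: Y_def split: if_splits)
          then obtain j where j: "j \<le> Suc i" "w = d i j" by auto
          have "j < Suc i \<and> y = d i (Suc j) \<or> j = Suc i \<and> y = last (p i)"
            using splice(2)[OF i(1) i(1) i(1) g i(1) g _ i(1) g _ _ Y_eq[OF g] j(1)] i(2) j(2) by blast
          with i(1) j show ?thesis by blast
        qed
        have idx: "a = m" if "cs ! a = w" "a < 2 * k + 1" for a
          using that m cs(1,2) nth_eq_iff_index_eq by metis
        \<comment> \<open>From the middle, arcs lead only to its two neighbours, since walks have at
          least one step. At distance \<open>j > 0\<close> on one side, only commodity
          \<open>j - 1\<close> can end its walk, and all others continue to the same
          neighbour.\<close>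
        have "out_set k p Y w \<subseteq>
            (if m = k then {cs ! (k + 1), cs ! (k - 1)}
             else if k < m then {cs ! (m + 1), last (p (m - k - 1))}
             else {cs ! (m - 1), last (p (k - m - 1))})"
        proof
          fix y assume "y \<in> out_set k p Y w"
          from out[OF this] obtain i j where ij: "i < k" "w = d i j" "j \<le> Suc i"
            "j < Suc i \<and> y = d i (Suc j) \<or> j = Suc i \<and> y = last (p i)" by blast
          have "m = (if inc i then k + j else k - j)"
            using idx[of "if inc i then k + j else k - j"] ij by (auto simp: d_def)
          moreover have "k - j = k \<longleftrightarrow> j = 0" using ij(1) by auto
          ultimately show "y \<in> (if m = k then {cs ! (k + 1), cs ! (k - 1)}
             else if k < m then {cs ! (m + 1), last (p (m - k - 1))}
             else {cs ! (m - 1), last (p (k - m - 1))})"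
            using ij by (auto simp: d_def split: if_splits)
        qed
        then have "card (out_set k p Y w) \<le> card (if m = k then {cs ! (k + 1), cs ! (k - 1)}
             else if k < m then {cs ! (m + 1), last (p (m - k - 1))}
             else {cs ! (m - 1), last (p (k - m - 1))})"
          by (intro card_mono) auto
        also have "\<dots> \<le> 2" by (auto simp: card_insert_if)
        finally show ?thesis using T by linarith
      next
        case False
        have "out_set k p Y w \<subseteq> out_set k p X w"
        proof
          fix y assume "y \<in> out_set k p Y w"
          then obtain i where i: "i < k" "next_in (p i) (Y i) w y" by (auto simp: out_set_def)
          have "next_in (p i) (X i) w y"
          proof (cases "next_in (p i) (X i) u v")
            case True
            have "w \<notin> d i ` {..Suc i}" using d_mem[OF i(1)] False by auto
            then show ?thesis
              using splice(3)[OF i(1) i(1) i(1) True i(1) True _ i(1) True _ _ Y_eq[OF True] wu] i(2) by blast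
          next
            case False
            with i show ?thesis by (simp add: Y_def)
          qed
          with i(1) show "y \<in> out_set k p X w" by (auto simp: out_set_def)
        qed
        then show ?thesis by (rule card_out_set_mono[OF R])
      qed
    qed
  qed
  moreover have "Y i0 \<subseteq> {x \<in> X i0. position (p i0) x \<le> position (p i0) u} \<union> set cs \<union> {last (p i0)}"
    using d_mem[OF i0(1)] i0(2) by (auto simp: Y_def)
  ultimately show ?thesis using that Y_sub by blast
qed

section \<open>Samples, monotone chains and layers of candidate vertices\<close>

definition common_after :: "nat \<Rightarrow> (nat \<Rightarrow> 'a list) \<Rightarrow> 'a \<Rightarrow> 'a \<Rightarrow> nat set" where
  "common_after k p u v =
     {i. i < k \<and> u \<in> set (p i) \<and> v \<in> set (p i) \<and> position (p i) u < position (p i) v}"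

text \<open>A shortest routing accounts for \<open>2 ^ k + 2 * k\<close>; the rest is a chain of
  \<open>2 * k + 1\<close> vertices for each of up to \<open>k\<close> reroutings.\<close>

definition visit_bound :: "nat \<Rightarrow> nat" where
  "visit_bound k = 2 ^ k + 2 * k + k * (2 * k + 1)"

text \<open>After removal of the visited vertices, the Ramsey bound must remain: the colours are the
  \<open>2 ^ k\<close> sets of paths, each with target length \<open>2 * k + 1\<close>. The base is
  increased by 1 so that it is at least 2 also for \<open>k = 0\<close>.\<close>

definition sample_size :: "nat \<Rightarrow> nat" where
  "sample_size k = visit_bound k + (2 ^ k + 1) ^ (2 ^ k * (2 * k + 1))"

text \<open>A pair is coloured by the set of paths on which its first vertex precedes the second.
  The vertices of \<open>C\<close> look the same from \<open>u\<close> as \<open>v\<close> does, so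
  a path on which \<open>v\<close> follows \<open>u\<close> contains all of them at distinct
  positions; one colour then means one direction.\<close>

lemma monotone_chain_exists:
  assumes p: "paths k p" and R: "routing k p T X" and vis: "card (visited k X) \<le> visit_bound k"
    and C: "finite C" "sample_size k \<le> card C"
    and same: "\<And>w. w \<in> C \<Longrightarrow> common_after k p u w = common_after k p u v"
  obtains cs where "distinct cs" "length cs = 2 * k + 1" "set cs \<subseteq> C - visited k X"
    "\<And>i. i < k \<Longrightarrow> i \<in> common_after k p u v \<Longrightarrow>
       increasing (p i) cs \<or>
       decreasing (p i) cs"
proof -
  obtain xs where xs: "set xs = C - visited k X" "distinct xs"
    using finite_distinct_list[of "C - visited k X"] C(1) by auto
  have "card C - card (visited k X) \<le> length xs"
    using diff_card_le_card_Diff[OF finite_visited[OF R], of C] xs distinct_card[of xs] by simp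
  then have len: "(2 ^ k + 1) ^ (2 ^ k * (2 * k + 1)) \<le> length xs"
    using C(2) vis unfolding sample_size_def by linarith
  define col where "col a b = {i. i < k \<and> position (p i) a < position (p i) b}" for a b
  have "\<exists>\<kappa>\<in>Pow {..<k}. \<exists>ys. distinct ys \<and> set ys \<subseteq> set xs \<and> length ys = 2 * k + 1 \<and>
      sorted_wrt (\<lambda>a b. col a b = \<kappa>) ys"
    by (rule monochromatic_sublist[where q = "2 ^ k + 1"])
      (use len xs(2) in \<open>auto simp: card_Pow col_def\<close>)
  then obtain \<kappa> ys where ys: "distinct ys" "set ys \<subseteq> set xs" "length ys = 2 * k + 1"
    "sorted_wrt (\<lambda>a b. col a b = \<kappa>) ys" by blast
  show ?thesis
  proof (rule that[OF ys(1,3)])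
    show "set ys \<subseteq> C - visited k X" using ys(2) xs(1) by simp
    fix i assume i: "i < k" "i \<in> common_after k p u v"
    have in_p: "ys ! m \<in> set (p i)" if "m < length ys" for m
    proof -
      have "ys ! m \<in> C" using that ys(2) xs(1) nth_mem by blast
      then show ?thesis using same i by (auto simp: common_after_def)
    qed
    have ne: "position (p i) (ys ! m) \<noteq> position (p i) (ys ! n)" if "m < n" "n < length ys" for m n
      using position_inject[OF in_p[of m] in_p[of n]] that ys(1) by (simp add: nth_eq_iff_index_eq)
    have eq: "i \<in> \<kappa> \<longleftrightarrow> position (p i) (ys ! m) < position (p i) (ys ! n)" if "m < n" "n < length ys" for m n
      using ys(4) that i(1) by (auto simp: sorted_wrt_iff_nth_less col_def)
    show "increasing (p i) ys \<or>
       decreasing (p i) ys"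
    proof (cases "i \<in> \<kappa>")
      case True
      then show ?thesis using eq by (simp add: sorted_wrt_iff_nth_less)
    next
      case False
      then have "position (p i) (ys ! n) < position (p i) (ys ! m)" if "m < n" "n < length ys" for m n
        using ne[OF that] eq[OF that] by simp
      then show ?thesis by (simp add: sorted_wrt_iff_nth_less)
    qed
  qed
qed

text \<open>Each visited vertex is compared with its rank among the visits. Let \<open>v\<close> be
  the first that is missing from the layer of its rank. Its predecessor \<open>u\<close> has rank
  one less and lies in the corresponding layer, so the arc from \<open>u\<close> to \<open>v\<close>
  skips a layer. Ranks stay below \<open>R\<close>, hence all visits up to \<open>u\<close> belong
  to \<open>Z R\<close>.\<close>

lemma first_exit_from_layers:
  assumes P: "distinct P" "X \<subseteq> set P" "hd P \<in> X"
    and Z: "hd P \<in> Z 0" "\<And>j. Z j \<subseteq> Z (Suc j)" and card: "card X \<le> R" and not: "\<not> X \<subseteq> Z R"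
  obtains j u v where "j < R" "u \<in> Z j" "v \<notin> Z (Suc j)" "next_in P X u v"
    "{x \<in> X. position P x \<le> position P u} \<subseteq> Z R"
proof -
  have fin: "finite X" using P(2) finite_subset by blast
  have lift: "Z i \<subseteq> Z j" if "i \<le> j" for i j
    using Z(2) that by (rule lift_Suc_mono_le)
  define r where "r x = card {w \<in> X. position P w < position P x}" for x
  have r_less: "r x < card X" if "x \<in> X" for x
    unfolding r_def using that fin by (intro psubset_card_mono) auto
  define B where "B = {x \<in> X. x \<notin> Z (r x)}"
  have "B \<noteq> {}"
  proof -
    from not obtain x where x: "x \<in> X" "x \<notin> Z R" by blast
    then have "Z (r x) \<subseteq> Z R" using lift[of "r x" R] r_less[of x] card by simp
    with x show ?thesis by (auto simp: B_def)
  qed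
  moreover have "finite B" using fin by (simp add: B_def)
  ultimately have "Min (position P ` B) \<in> position P ` B" by (intro Min_in) auto
  then obtain v where v: "v \<in> B" "position P v = Min (position P ` B)" by auto
  have v_min: "position P v \<le> position P x" if "x \<in> B" for x
    using that \<open>finite B\<close> v(2) by simp
  have vX: "v \<in> X" "v \<notin> Z (r v)" using v(1) by (auto simp: B_def)
  let ?A = "{w \<in> X. position P w < position P v}"
  have "v \<noteq> hd P" using vX Z(1) lift[of 0 "r v"] by auto
  then have "hd P \<in> ?A"
    using P position_hd_le[of P "position P v"] position_inject[of "hd P" P v] vX
    by (auto simp: order_less_le subset_iff)
  then have "Max (position P ` ?A) \<in> position P ` ?A" using fin by (intro Max_in) auto
  then obtain u where uA: "u \<in> ?A" "position P u = Max (position P ` ?A)" by auto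
  have "position P x \<le> position P u" if "x \<in> ?A" for x
    unfolding uA(2) using that fin by (intro Max_ge) auto
  with uA(1) have u: "u \<in> X" "position P u < position P v"
    "\<And>x. x \<in> X \<Longrightarrow> position P x < position P v \<Longrightarrow> position P x \<le> position P u" by auto
  have "x = u" if "x \<in> X" "position P x = position P u" for x
    using that u(1) P(2) position_inject[of x P u] by auto
  then have A: "?A = insert u {w \<in> X. position P w < position P u}"
    using u by (auto simp: le_less)
  then have "r v = Suc (r u)"
    unfolding r_def A using fin by simp
  moreover have good: "x \<in> Z (r x)" if "x \<in> X" "position P x < position P v" for x
    using v_min[of x] that by (auto simp: B_def)
  ultimately show ?thesis
  proof (intro that[of "r u" u v])
    show "r u < R" using r_less[of u] u card by simp
    show "u \<in> Z (r u)" using good u by blast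
    show "v \<notin> Z (Suc (r u))" using vX \<open>r v = Suc (r u)\<close> by simp
    show "next_in P X u v" using u vX by (auto simp: next_in_def not_less)
    show "{x \<in> X. position P x \<le> position P u} \<subseteq> Z R"
    proof
      fix x assume "x \<in> {x \<in> X. position P x \<le> position P u}"
      then have "x \<in> X" "position P x < position P v" using u(2) by auto
      then have "x \<in> Z (r x)" "r x \<le> R" using good r_less[of x] card by auto
      then show "x \<in> Z R" using lift[of "r x" R] by blast
    qed
  qed
qed

text \<open>As long as some commodity is not inside \<open>Z m\<close>, its path has an arc that
  skips a layer, because it visits at most \<open>visit_bound k\<close> vertices. The assumption on
  samples applies to such an arc, and rerouting along a chain in the sample moves that commodity
  into \<open>Z m\<close>.\<close>

lemma routing_within_layers:
  fixes p :: "nat \<Rightarrow> 'a list"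
  assumes p: "paths k p" and X: "routing k p T X"
    and Z0: "sources_and_sinks k p \<subseteq> Z 0" and Z: "\<And>j. Z j \<subseteq> Z (Suc j)"
    and sample: "\<And>j u v. u \<in> Z j \<Longrightarrow> v \<in> (\<Union>i<k. set (p i)) \<Longrightarrow> v \<notin> Z (Suc j) \<Longrightarrow>
      \<exists>C. finite C \<and> C \<subseteq> Z (Suc j) \<and> sample_size k \<le> card C \<and>
          (\<forall>w\<in>C. common_after k p u w = common_after k p u v)"
    and m: "visit_bound k \<le> m"
  shows "\<exists>Y. routing k p T Y \<and> visited k Y \<subseteq> Z m"
proof -
  have lift: "Z i \<subseteq> Z j" if "i \<le> j" for i j
    using Z that by (rule lift_Suc_mono_le)
  obtain X' where X': "shortest_routing k p T X'" using X by (rule shortest_routing_exists)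
  then have R': "routing k p T X'" by (simp add: shortest_routing_def)
  show ?thesis
  proof (cases "T \<le> 1")
    case True
    have "visited k X' \<subseteq> Z m"
      using shortest_routing_degree_1[OF p X' True] Z0 lift[of 0 m] by blast
    with R' show ?thesis by blast
  next
    case False
    \<comment> \<open>The invariant pays for new vertices: each chain of \<open>2 * k + 1\<close>
      vertices is charged to the commodity that its rerouting has brought into \<open>Z m\<close>.
      There are at most \<open>k\<close> charges, so \<open>visit_bound k\<close> is respected in
      every round.\<close>
    have main: "\<exists>Y. routing k p T Y \<and> visited k Y \<subseteq> Z m"
      if "routing k p T X"
        "card (visited k X) \<le> 2 ^ k + 2 * k + (2 * k + 1) * card {i. i < k \<and> X i \<subseteq> Z m}" for X
      using that
    proof (induction "card {i. i < k \<and> \<not> X i \<subseteq> Z m}" arbitrary: X rule: less_induct)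
      case (less X)
      note R = less.prems(1)
      show ?case
      proof (cases "visited k X \<subseteq> Z m")
        case True
        with R show ?thesis by blast
      next
        case not_all: False
        then obtain i where i: "i < k" "\<not> X i \<subseteq> Z m" by (auto simp: visited_def)
        have "card {i. i < k \<and> X i \<subseteq> Z m} \<le> card {..<k}" by (rule card_mono) auto
        then have "(2 * k + 1) * card {i. i < k \<and> X i \<subseteq> Z m} \<le> (2 * k + 1) * k"
          by (intro mult_le_mono2) simp
        then have vis: "card (visited k X) \<le> visit_bound k"
          using less.prems(2) unfolding visit_bound_def by (simp add: mult.commute)
        have Xi: "distinct (p i)" "X i \<subseteq> set (p i)" "hd (p i) \<in> X i" "hd (p i) \<in> Z 0"
          "X i \<subseteq> visited k X" "last (p i) \<in> Z m"
          using R p i(1) Z0 lift[of 0 m]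
          by (auto simp: routing_def paths_def sources_and_sinks_def visited_def)
        have "card (X i) \<le> m"
          using card_mono[OF finite_visited[OF R] Xi(5)] vis m by linarith
        then obtain j u v where juv: "j < m" "u \<in> Z j" "v \<notin> Z (Suc j)" "next_in (p i) (X i) u v"
          "{x \<in> X i. position (p i) x \<le> position (p i) u} \<subseteq> Z m"
          using first_exit_from_layers[OF Xi(1-4) Z _ i(2)] by blast
        have "v \<in> (\<Union>i<k. set (p i))"
          using juv(4) Xi(2) i(1) by (auto simp: next_in_def)
        with sample[OF juv(2) _ juv(3)] obtain C where C: "finite C" "C \<subseteq> Z (Suc j)"
          "sample_size k \<le> card C" "\<And>w. w \<in> C \<Longrightarrow> common_after k p u w = common_after k p u v" by blast
        from monotone_chain_exists[OF p R vis C(1,3,4)] obtain cs where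
          cs: "distinct cs" "length cs = 2 * k + 1" "set cs \<subseteq> C - visited k X"
          "\<And>i. i < k \<Longrightarrow> i \<in> common_after k p u v \<Longrightarrow>
             increasing (p i) cs \<or>
             decreasing (p i) cs" by blast
        have g: "i \<in> common_after k p u v" if "i < k" "next_in (p i) (X i) u v" for i
          using R that by (auto simp: common_after_def next_in_def routing_def)
        have after: "c \<in> set (p i) \<and> position (p i) u < position (p i) c"
          if "i < k" "next_in (p i) (X i) u v" "c \<in> set cs" for i c
          using g[OF that(1,2)] C(4)[of c] cs(3) that(3) by (auto simp: common_after_def)
        from reroute_along_chain[OF p R _ i(1) juv(4) cs(1,2) _ after cs(4)[OF _ g]] cs(3) False
        obtain Y where Y: "routing k p T Y" "\<And>i. i < k \<Longrightarrow> Y i \<subseteq> X i \<union> set cs"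
          "Y i \<subseteq> {x \<in> X i. position (p i) x \<le> position (p i) u} \<union> set cs \<union> {last (p i)}"
          by (smt (verit) Diff_disjoint Diff_iff disjoint_iff subset_iff)
        \<comment> \<open>All three pieces of the rerouted path lie in \<open>Z m\<close>: the
          visits up to \<open>u\<close> by the choice of the arc, the chain as a part of layer
          \<open>Suc j\<close>, and the sink as a part of layer 0.\<close>
        have "set cs \<subseteq> Z m" using cs(3) C(2) lift[of "Suc j" m] juv(1) by fastforce
        with Y(3) juv(5) Xi(6) have Yi: "Y i \<subseteq> Z m" by blast
        have keep: "Y i' \<subseteq> Z m" if "i' < k" "X i' \<subseteq> Z m" for i'
          using Y(2)[OF that(1)] that(2) \<open>set cs \<subseteq> Z m\<close> by blast
        have "card (visited k Y) \<le> card (visited k X \<union> set cs)"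
          using Y(2) finite_visited[OF R] by (intro card_mono) (auto simp: visited_def)
        also have "\<dots> \<le> card (visited k X) + (2 * k + 1)"
          using card_Un_le[of "visited k X" "set cs"] cs(2) card_length[of cs] by linarith
        finally have "card (visited k Y) \<le> card (visited k X) + (2 * k + 1)" .
        moreover have "Suc (card {i. i < k \<and> X i \<subseteq> Z m}) \<le> card {i. i < k \<and> Y i \<subseteq> Z m}"
        proof -
          have "card (insert i {i. i < k \<and> X i \<subseteq> Z m}) \<le> card {i. i < k \<and> Y i \<subseteq> Z m}"
            using keep Yi i(1) by (intro card_mono) auto
          then show ?thesis using i(2) by simp
        qed
        then have "(2 * k + 1) * Suc (card {i. i < k \<and> X i \<subseteq> Z m})
            \<le> (2 * k + 1) * card {i. i < k \<and> Y i \<subseteq> Z m}"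
          by (rule mult_le_mono2)
        ultimately have "card (visited k Y) \<le> 2 ^ k + 2 * k + (2 * k + 1) * card {i. i < k \<and> Y i \<subseteq> Z m}"
          using less.prems(2) unfolding mult_Suc_right by linarith
        moreover have "card {i. i < k \<and> \<not> Y i \<subseteq> Z m} < card {i. i < k \<and> \<not> X i \<subseteq> Z m}"
          using keep Yi i by (intro psubset_card_mono) auto
        ultimately show ?thesis using less.hyps Y(1) by blast
      qed
    qed
    have "card (visited k X') \<le> 2 ^ k + 2 * k + (2 * k + 1) * card {i. i < k \<and> X' i \<subseteq> Z m}"
      using shortest_routing_card_visited[OF p X'] by linarith
    with R' show ?thesis by (rule main)
  qed
qed

section \<open>Solutions of the problem as routings\<close>

lemma pawalk_verts_eq: "pcas s P t \<Longrightarrow> pawalk_verts s P = s # map snd P"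
  by (induction P arbitrary: s) auto

lemma pcas_last: "pcas s P t \<Longrightarrow> last (s # map snd P) = t"
  by (induction P arbitrary: s) auto

lemma pcas_zip: "pcas s P t \<Longrightarrow> P = zip (s # map snd P) (map snd P)"
proof (induction P arbitrary: s)
  case (Cons e P)
  then have "pcas (snd e) P t" "fst e = s" by auto
  with Cons.IH[of "snd e"] show ?case by (cases e) auto
qed simp

lemma pcas_zip_tl:
  "q \<noteq> [] \<Longrightarrow> pcas (hd q) (zip q (tl q)) (last q) \<and> pawalk_verts (hd q) (zip q (tl q)) = q"
proof (induction q)
  case (Cons a q)
  then show ?case by (cases q) auto
qed simp

lemma in_set_zip_tl: "(a, b) \<in> set (zip q (tl q)) \<longleftrightarrow> (\<exists>i. Suc i < length q \<and> a = q ! i \<and> b = q ! Suc i)"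
proof -
  have "length (tl q) = length q - 1" by simp
  then show ?thesis
    unfolding in_set_zip by (auto simp: nth_tl less_diff_conv)
qed

lemma nth_in_zip_tl: "Suc i < length q \<Longrightarrow> (q ! i, q ! Suc i) \<in> set (zip q (tl q))"
  by (rule iffD2[OF in_set_zip_tl], rule exI[of _ i]) simp

text \<open>On a path without repeated vertices the closure is the linear order of the positions,
  which turns closures into comparisons of indices.\<close>

lemma trancl_zip_tl:
  assumes "distinct q"
  shows "(a, b) \<in> (set (zip q (tl q)))\<^sup>+ \<longleftrightarrow> a \<in> set q \<and> b \<in> set q \<and> position q a < position q b"
proof
  assume "(a, b) \<in> (set (zip q (tl q)))\<^sup>+"
  then show "a \<in> set q \<and> b \<in> set q \<and> position q a < position q b"
  proof (induction rule: trancl_induct)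
    case (base y)
    then obtain i where "Suc i < length q" "a = q ! i" "y = q ! Suc i" by (auto simp: in_set_zip_tl)
    with assms show ?case by (simp add: position_nth)
  next
    case (step y z)
    from step.hyps(2) obtain i where "Suc i < length q" "y = q ! i" "z = q ! Suc i"
      by (auto simp: in_set_zip_tl)
    with step.IH assms show ?case by (simp add: position_nth)
  qed
next
  have nth: "(q ! i, q ! (i + Suc m)) \<in> (set (zip q (tl q)))\<^sup>+" if "i + Suc m < length q" for i m
    using that
  proof (induction m)
    case 0
    have "i + Suc 0 = Suc i" by simp
    with 0 show ?case by (metis nth_in_zip_tl r_into_trancl)
  next
    case (Suc m)
    then have step: "(q ! (i + Suc m), q ! Suc (i + Suc m)) \<in> set (zip q (tl q))"
      by (intro nth_in_zip_tl) simp
    have eq: "i + Suc (Suc m) = Suc (i + Suc m)" by simp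
    have "(q ! i, q ! (i + Suc m)) \<in> (set (zip q (tl q)))\<^sup>+"
      by (rule Suc.IH) (use Suc.prems in simp)
    then show ?case unfolding eq using step by (rule trancl_into_trancl)
  qed
  assume ab: "a \<in> set q \<and> b \<in> set q \<and> position q a < position q b"
  define m where "m = position q b - Suc (position q a)"
  have m: "position q b = position q a + Suc m" using ab unfolding m_def by linarith
  have "position q b < length q" using ab position_less_length[of b q] by simp
  with m have "(q ! position q a, q ! position q b) \<in> (set (zip q (tl q)))\<^sup>+"
    using nth[of "position q a" m] by metis
  moreover have "q ! position q a = a" "q ! position q b = b" using ab by (simp_all add: nth_position)
  ultimately show "(a, b) \<in> (set (zip q (tl q)))\<^sup>+" by metis
qed

text \<open>This justifies storing only the set of visited vertices: the arcs of a shortcut can be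
  recovered from it.\<close>

lemma zip_tl_next_in:
  assumes "increasing p q"
  shows "(a, b) \<in> set (zip q (tl q)) \<longleftrightarrow> next_in p (set q) a b"
proof
  have mono: "position p (q ! i) < position p (q ! j)" if "i < j" "j < length q" for i j
    using assms that by (simp add: sorted_wrt_iff_nth_less)
  have mono_iff: "position p (q ! i) < position p (q ! j) \<longleftrightarrow> i < j" if "i < length q" "j < length q" for i j
    using mono[of i j] mono[of j i] that by (cases i j rule: linorder_cases) auto
  {
    assume "(a, b) \<in> set (zip q (tl q))"
    then obtain i where i: "Suc i < length q" "a = q ! i" "b = q ! Suc i" by (auto simp: in_set_zip_tl)
    have "\<not> (position p a < position p w \<and> position p w < position p b)" if w: "w \<in> set q" for w
    proof -
      obtain j where "j < length q" "w = q ! j" using w by (auto simp: in_set_conv_nth)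
      then show ?thesis using i by (simp add: mono_iff)
    qed
    with i show "next_in p (set q) a b"
      unfolding next_in_def by (simp add: mono_iff)
  }
  {
    assume nx: "next_in p (set q) a b"
    then obtain i j where ij: "i < length q" "j < length q" "a = q ! i" "b = q ! j"
      by (auto simp: next_in_def in_set_conv_nth)
    then have "i < j" using nx mono_iff by (auto simp: next_in_def)
    moreover have "\<not> Suc i < j"
      using nx ij mono_iff[of i "Suc i"] mono_iff[of "Suc i" j] nth_mem[of "Suc i" q]
      by (auto simp: next_in_def)
    ultimately have "j = Suc i" by simp
    with ij show "(a, b) \<in> set (zip q (tl q))" by (auto simp: in_set_zip_tl)
  }
qed

lemma sorted_wrt_position: "distinct p \<Longrightarrow> increasing p p"
  by (simp add: sorted_wrt_iff_nth_less position_nth)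

lemma apath_with_proj:
  "pre_digraph.apath (with_proj G) s Q t \<longleftrightarrow>
     s \<in> pverts G \<and> set Q \<subseteq> parcs G \<and> pcas s Q t \<and> distinct (pawalk_verts s Q)"
  by (simp add: pre_digraph.apath_def pre_digraph.awalk_def cas_with_proj_eq awalk_verts_with_proj_eq)

definition vertex_list :: "'a \<times> 'a \<times> ('a \<times> 'a) awalk \<Rightarrow> 'a list" where
  "vertex_list = (\<lambda>(s, t, P). s # map snd P)"

lemma commodity_facts:
  assumes I: "md_spp_instance I" and c: "(s, t, P) \<in> commodities I"
  shows "pcas s P t" "pawalk_verts s P = vertex_list (s, t, P)" "distinct (vertex_list (s, t, P))"
    "last (vertex_list (s, t, P)) = t" "set (vertex_list (s, t, P)) \<subseteq> pverts (digraph_of I)"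
    "set P = set (zip (vertex_list (s, t, P)) (tl (vertex_list (s, t, P))))"
    "set P \<subseteq> parcs (digraph_of I)"
proof -
  interpret pair_fin_digraph "digraph_of I" using I by (simp add: md_spp_instance_def)
  from I c have ap: "pre_digraph.apath (with_proj (digraph_of I)) s P t"
    by (auto simp: md_spp_instance_def)
  then have *: "s \<in> pverts (digraph_of I)" "set P \<subseteq> parcs (digraph_of I)" "pcas s P t"
    "distinct (pawalk_verts s P)"
    by (auto simp: apath_with_proj)
  show "pcas s P t" "set P \<subseteq> parcs (digraph_of I)" by fact+
  show eq: "pawalk_verts s P = vertex_list (s, t, P)"
    using pawalk_verts_eq[OF *(3)] by (simp add: vertex_list_def)
  show "distinct (vertex_list (s, t, P))" using *(4) eq by simp
  show "last (vertex_list (s, t, P)) = t" using pcas_last[OF *(3)] by (simp add: vertex_list_def)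
  show "set (vertex_list (s, t, P)) \<subseteq> pverts (digraph_of I)"
    using *(1,2) in_arcsD2 by (auto simp: vertex_list_def)
  show "set P = set (zip (vertex_list (s, t, P)) (tl (vertex_list (s, t, P))))"
    using pcas_zip[OF *(3)] by (simp add: vertex_list_def)
qed

lemma out_degree_le_max_outdegree:
  "finite (pverts H) \<Longrightarrow> u \<in> pverts H \<Longrightarrow> out_degree (with_proj H) u \<le> max_outdegree (with_proj H)"
  unfolding max_outdegree_def by (intro Max_ge) auto

lemma out_degree_with_proj: "out_degree (with_proj H) u = card {v. (u, v) \<in> parcs H}"
proof -
  have "out_arcs (with_proj H) u = Pair u ` {v. (u, v) \<in> parcs H}"
    by (auto simp: out_arcs_def)
  then show ?thesis
    by (simp add: out_degree_def card_image inj_on_def)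
qed

text \<open>Arcs in the closure of a path only move forward on it, so the vertices of a solution
  path appear in increasing order and their set determines its arcs. All arcs of the routing
  therefore belong to \<open>H\<close>.\<close>

lemma routing_of_solution:
  assumes I: "md_spp_instance I" and ks: "set ks = commodities I" and yes: "md_spp_yes I"
  shows "\<exists>X. routing (length ks) (\<lambda>i. vertex_list (ks ! i)) (degree_bound I) X"
proof -
  interpret pair_fin_digraph "digraph_of I" using I by (simp add: md_spp_instance_def)
  from yes obtain H where H: "subgraph (with_proj H) (with_proj (transitive_closure (digraph_of I)))"
    "int (max_outdegree (with_proj H)) \<le> degree_bound I"
    "\<And>s t P. (s, t, P) \<in> commodities I \<Longrightarrow> \<exists>Q. pre_digraph.apath
       (with_proj (digraph_inter H (transitive_closure (path_digraph s P)))) s Q t"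
    unfolding md_spp_yes_def by blast
  have "\<exists>q. set q \<subseteq> set (vertex_list c) \<and> hd (vertex_list c) \<in> set q \<and> last (vertex_list c) \<in> set q \<and>
      (\<forall>u v. next_in (vertex_list c) (set q) u v \<longrightarrow> (u, v) \<in> parcs H)" if "c \<in> set ks" for c
  proof -
    obtain s t P where c: "c = (s, t, P)" by (cases c)
    with that ks have cK: "(s, t, P) \<in> commodities I" by simp
    note facts = commodity_facts[OF I cK]
    let ?p = "vertex_list (s, t, P)"
    from H(3)[OF cK] obtain Q where Q: "set Q \<subseteq> parcs H" "set Q \<subseteq> (set P)\<^sup>+" "pcas s Q t"
      "distinct (pawalk_verts s Q)"
      by (auto simp: apath_with_proj digraph_inter_def transitive_closure_def path_digraph_def)
    define q where "q = s # map snd Q"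
    have Q_zip: "Q = zip q (tl q)" using pcas_zip[OF Q(3)] by (simp add: q_def)
    have incr: "a \<in> set ?p \<and> b \<in> set ?p \<and> position ?p a < position ?p b" if "(a, b) \<in> set Q" for a b
      by (rule iffD1[OF trancl_zip_tl[OF facts(3)]])
        (use subsetD[OF Q(2) that] in \<open>simp only: facts(6)[symmetric]\<close>)
    have "transp (\<lambda>a b. position ?p a < position ?p b)" by (auto simp: transp_def)
    moreover have "position ?p (q ! i) < position ?p (q ! Suc i)" if "Suc i < length q" for i
      using incr[of "q ! i" "q ! Suc i"] that Q_zip in_set_zip_tl[of _ _ q] by metis
    ultimately have sorted: "increasing ?p q"
      by (simp add: sorted_wrt_iff_nth_Suc_transp)
    have "set q \<subseteq> set ?p"
      using incr by (fastforce simp: q_def vertex_list_def)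
    moreover have "hd ?p \<in> set q" by (simp add: q_def vertex_list_def)
    moreover have "last ?p \<in> set q"
      using pcas_last[OF Q(3)] facts(4) last_in_set[of q] by (simp add: q_def)
    moreover have "(u, v) \<in> parcs H" if "next_in ?p (set q) u v" for u v
      using that zip_tl_next_in[OF sorted] Q_zip Q(1) by auto
    ultimately show ?thesis using c by blast
  qed
  then obtain f where f: "\<And>c. c \<in> set ks \<Longrightarrow> set (f c) \<subseteq> set (vertex_list c) \<and>
      hd (vertex_list c) \<in> set (f c) \<and> last (vertex_list c) \<in> set (f c) \<and>
      (\<forall>u v. next_in (vertex_list c) (set (f c)) u v \<longrightarrow> (u, v) \<in> parcs H)"
    by metis
  have "pverts H \<subseteq> pverts (digraph_of I)"
    using H(1) by (simp add: subgraph_def transitive_closure_def)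
  then have fin: "finite (pverts H)"
    by (rule finite_subset) (rule pair_finite_verts)
  have wf: "pair_wf_digraph H" using H(1) by (simp add: subgraph_def wf_digraph_wp_iff)
  have deg: "int (card {v. (u, v) \<in> parcs H}) \<le> degree_bound I" for u
  proof (cases "u \<in> pverts H")
    case True
    then show ?thesis
      using out_degree_le_max_outdegree[OF fin True] H(2) by (simp add: out_degree_with_proj)
  next
    case False
    then have "{v. (u, v) \<in> parcs H} = {}" using pair_wf_digraph.in_arcsD1[OF wf] by blast
    then show ?thesis using H(2) by (simp only: card.empty)
  qed
  have finH: "finite {v. (u, v) \<in> parcs H}" for u
    using finite_subset[OF _ fin] pair_wf_digraph.in_arcsD2[OF wf] by (metis mem_Collect_eq subsetI)
  let ?p = "\<lambda>i. vertex_list (ks ! i)" and ?T = "degree_bound I"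
  let ?X = "\<lambda>i. set (f (ks ! i))"
  have "routing (length ks) ?p (?T) ?X"
    unfolding routing_def
  proof (intro conjI allI impI)
    fix u
    have "out_set (length ks) ?p ?X u \<subseteq> {v. (u, v) \<in> parcs H}"
    proof
      fix v assume "v \<in> out_set (length ks) ?p ?X u"
      then obtain i where i: "i < length ks" "next_in (vertex_list (ks ! i)) (set (f (ks ! i))) u v"
        unfolding out_set_def by blast
      with f[OF nth_mem[OF i(1)]] show "v \<in> {v. (u, v) \<in> parcs H}" by simp
    qed
    from card_mono[OF finH this] deg[of u]
    show "int (card (out_set (length ks) ?p ?X u))
        \<le> ?T" by linarith
  next
    fix i assume "i < length ks"
    from f[OF nth_mem[OF this]]
    show "set (f (ks ! i)) \<subseteq> set (vertex_list (ks ! i))" "hd (vertex_list (ks ! i)) \<in> set (f (ks ! i))"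
      "last (vertex_list (ks ! i)) \<in> set (f (ks ! i))" by simp_all
  qed
  then show ?thesis by blast
qed

text \<open>\<open>H\<close> receives precisely the arcs that the routing uses, so its outdegrees
  are the cardinalities of the sets \<open>out_set\<close>.\<close>

lemma solution_of_routing:
  assumes I: "md_spp_instance I" and ks: "set ks = commodities I"
    and R: "routing (length ks) (\<lambda>i. vertex_list (ks ! i)) (degree_bound I) X"
  shows "md_spp_yes I"
proof -
  interpret pair_fin_digraph "digraph_of I" using I by (simp add: md_spp_instance_def)
  let ?k = "length ks" and ?p = "\<lambda>i. vertex_list (ks ! i)"
  define H where "H = \<lparr>pverts = pverts (digraph_of I), parcs = {(u, v). v \<in> out_set ?k ?p X u}\<rparr>"
  have path: "(u, v) \<in> (set P)\<^sup>+" if "(s, t, P) \<in> commodities I" "ks ! i = (s, t, P)" "i < ?k"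
    "next_in (?p i) (X i) u v" for s t P i u v
  proof -
    have "X i \<subseteq> set (?p i)" using R that(3) by (auto simp: routing_def)
    then have "u \<in> set (?p i) \<and> v \<in> set (?p i) \<and> position (?p i) u < position (?p i) v"
      using that(4) by (auto simp: next_in_def)
    then show ?thesis
      unfolding commodity_facts(6)[OF I that(1)] that(2)
      by (rule iffD2[OF trancl_zip_tl[OF commodity_facts(3)[OF I that(1)]]])
  qed
  have arcs: "parcs H \<subseteq> (parcs (digraph_of I))\<^sup>+"
  proof
    fix e assume "e \<in> parcs H"
    then obtain u v i where e: "e = (u, v)" "i < ?k" "next_in (?p i) (X i) u v"
      by (auto simp: H_def out_set_def)
    obtain s t P where c: "ks ! i = (s, t, P)" by (cases "ks ! i")
    with e(2) ks have "(s, t, P) \<in> commodities I" by (metis nth_mem)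
    note cK = this
    show "e \<in> (parcs (digraph_of I))\<^sup>+"
      unfolding e(1) using path[OF cK c e(2,3)] commodity_facts(7)[OF I cK] by (rule trancl_mono)
  qed
  have dom: "fst e \<in> pverts (digraph_of I) \<and> snd e \<in> pverts (digraph_of I)"
    if "e \<in> (parcs (digraph_of I))\<^sup>+" for e
  proof -
    obtain u v where e: "e = (u, v)" by (cases e)
    have "(u, v) \<in> (parcs (digraph_of I))\<^sup>+" using that e by (rule back_subst)
    then have "u \<in> pverts (digraph_of I) \<and> v \<in> pverts (digraph_of I)"
    proof (rule tranclE)
      assume "(u, v) \<in> parcs (digraph_of I)"
      then show ?thesis using in_arcsD1 in_arcsD2 by simp
    next
      fix w
      assume w: "(u, w) \<in> (parcs (digraph_of I))\<^sup>+" "(w, v) \<in> parcs (digraph_of I)"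
      from w(1) obtain x where "(u, x) \<in> parcs (digraph_of I)" by (rule converse_tranclE)
      with w(2) show ?thesis using in_arcsD1 in_arcsD2 by simp
    qed
    then show ?thesis by (simp add: e)
  qed
  have sub: "subgraph (with_proj H) (with_proj (transitive_closure (digraph_of I)))"
    unfolding subgraph_def wf_digraph_wp_iff
  proof (intro conjI)
    show "pair_wf_digraph (transitive_closure (digraph_of I))"
      using dom by unfold_locales (auto simp: transitive_closure_def)
    show "pair_wf_digraph H"
      using dom arcs by unfold_locales (auto simp: H_def)
  qed (use arcs in \<open>auto simp: transitive_closure_def compatible_def H_def\<close>)
  have deg: "int (max_outdegree (with_proj H)) \<le> degree_bound I"
  proof -
    have deg: "int (out_degree (with_proj H) u) \<le> degree_bound I" for u
      using R by (auto simp: out_degree_with_proj H_def routing_def)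
    then have "0 \<le> degree_bound I" by (metis of_nat_0_le_iff order_trans)
    moreover have "max_outdegree (with_proj H) \<in> insert 0 (out_degree (with_proj H) ` verts (with_proj H))"
      unfolding max_outdegree_def using pair_finite_verts by (intro Max_in) (auto simp: H_def)
    ultimately show ?thesis using deg by auto
  qed
  have sol: "\<exists>Q. pre_digraph.apath
      (with_proj (digraph_inter H (transitive_closure (path_digraph s P)))) s Q t"
    if cK: "(s, t, P) \<in> commodities I" for s t P
  proof -
    from cK ks obtain i where i: "i < ?k" "ks ! i = (s, t, P)" by (metis in_set_conv_nth)
    note facts = commodity_facts[OF I cK]
    from R i have X: "X i \<subseteq> set (?p i)" "hd (?p i) \<in> X i" "last (?p i) \<in> X i"
      unfolding routing_def by blast+
    \<comment> \<open>Deleting the other vertices from the path leaves the shortcut in the right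
      order, with the same ends because these are visited.\<close>
    define q where "q = filter (\<lambda>v. v \<in> X i) (?p i)"
    have "set q = set (?p i) \<inter> X i" by (simp only: q_def set_filter Int_def)
    then have set_q: "set q = X i" using X(1) by (simp only: Int_absorb1)
    have p: "?p i = s # map snd P" using i(2) by (simp add: vertex_list_def)
    then have "s \<in> X i" using X(2) by simp
    then have q_hd: "q \<noteq> []" "hd q = s" unfolding q_def p by simp_all
    have q_last: "last q = t"
    proof -
      have "filter (\<lambda>v. v \<in> X i) (butlast (?p i) @ [last (?p i)])
          = filter (\<lambda>v. v \<in> X i) (butlast (?p i)) @ [last (?p i)]"
        using X(3) by simp
      moreover have "butlast (?p i) @ [last (?p i)] = ?p i"
        by (rule append_butlast_last_id) (simp only: p list.simps not_False_eq_True)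
      ultimately have "last q = last (?p i)" unfolding q_def by (simp only: last_snoc)
      then show ?thesis using facts(4) i(2) by simp
    qed
    have dist: "distinct q" using facts(3) i(2) by (simp add: q_def)
    have sorted: "increasing (?p i) q"
      unfolding q_def using sorted_wrt_position[OF facts(3)] i(2) by (intro sorted_wrt_filter) simp
    define Q where "Q = zip q (tl q)"
    have Q: "pcas s Q t" "pawalk_verts s Q = q"
      using pcas_zip_tl[OF q_hd(1)] unfolding Q_def q_hd(2) q_last by simp_all
    have "set Q \<subseteq> parcs H \<inter> (set P)\<^sup>+"
    proof
      fix e assume "e \<in> set Q"
      moreover obtain u v where uv: "e = (u, v)" by (cases e)
      ultimately have "(u, v) \<in> set (zip q (tl q))" unfolding Q_def by simp
      with uv have e: "e = (u, v)" "next_in (?p i) (X i) u v"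
        using iffD1[OF zip_tl_next_in[OF sorted]] set_q by simp_all
      then have "e \<in> parcs H" using i(1) by (auto simp: H_def out_set_def)
      moreover have "e \<in> (set P)\<^sup>+" unfolding e(1) by (rule path[OF cK i(2,1) e(2)])
      ultimately show "e \<in> parcs H \<inter> (set P)\<^sup>+" by (rule IntI)
    qed
    then have Q_sub: "set Q \<subseteq> parcs H \<inter> (set P)\<^sup>+" .
    have s: "s \<in> set (pawalk_verts s P)" "s \<in> pverts H"
      using facts(2,5) by (auto simp: vertex_list_def H_def)
    have inter: "parcs (digraph_inter H (transitive_closure (path_digraph s P))) = parcs H \<inter> (set P)\<^sup>+"
      "pverts (digraph_inter H (transitive_closure (path_digraph s P))) = pverts H \<inter> set (pawalk_verts s P)"
      by (simp_all add: digraph_inter_def transitive_closure_def path_digraph_def)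
    have "distinct (pawalk_verts s Q)" using Q(2) dist by simp
    with Q_sub Q(1) s have "pre_digraph.apath
        (with_proj (digraph_inter H (transitive_closure (path_digraph s P)))) s Q t"
      unfolding apath_with_proj inter by (intro conjI IntI)
    then show ?thesis by (rule exI)
  qed
  show ?thesis
    unfolding md_spp_yes_def
  proof (rule exI[of _ H], intro conjI sub deg, rule ballI)
    fix c assume cK: "c \<in> commodities I"
    obtain s t P where c: "c = (s, t, P)" by (cases c)
    show "case c of (s, t, P) \<Rightarrow> \<exists>Q. pre_digraph.apath
        (with_proj (digraph_inter H (transitive_closure (path_digraph s P)))) s Q t"
      unfolding c prod.case by (rule sol) (use cK c in simp)
  qed
qed

section \<open>Transport of routings along injective renamings of the vertices\<close>

lemma position_map: "inj f \<Longrightarrow> position (map f p) (f v) = position p v"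
  unfolding position_def by (induction p) (auto simp: inj_eq)

lemma next_in_map: "inj f \<Longrightarrow> next_in (map f p) (f ` X) (f u) (f v) \<longleftrightarrow> next_in p X u v"
  unfolding next_in_def by (auto simp: position_map inj_image_mem_iff)

lemma out_set_map:
  assumes "inj f"
  shows "out_set k (\<lambda>i. map f (p i)) (\<lambda>i. f ` X i) (f u) = f ` out_set k p X u"
proof -
  have "next_in (map f (p i)) (f ` X i) (f u) y \<longleftrightarrow> (\<exists>v. y = f v \<and> next_in (p i) (X i) u v)" for i y
  proof
    assume nx: "next_in (map f (p i)) (f ` X i) (f u) y"
    then have "y \<in> f ` X i" by (simp add: next_in_def)
    with nx next_in_map[OF assms] show "\<exists>v. y = f v \<and> next_in (p i) (X i) u v" by blast
  qed (use next_in_map[OF assms] in blast)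
  then show ?thesis by (auto simp: out_set_def)
qed

text \<open>The algorithm handles vertices as trees, so the paths it sees are images under
  \<open>enc_nat\<close> of those of the instance.\<close>

lemma routing_map:
  assumes f: "inj f" and ne: "\<And>i. i < k \<Longrightarrow> p i \<noteq> []"
  shows "(\<exists>X. routing k (\<lambda>i. map f (p i)) T X) \<longleftrightarrow> (\<exists>X. routing k p T X)"
proof
  assume "\<exists>X. routing k p T X"
  then obtain X where X: "routing k p T X" by blast
  then have deg: "int (card (out_set k p X u)) \<le> T" for u by (auto simp: routing_def)
  have "routing k (\<lambda>i. map f (p i)) T (\<lambda>i. f ` X i)"
    unfolding routing_def
  proof (intro conjI allI impI)
    fix i assume i: "i < k"
    with X ne[OF i] show "f ` X i \<subseteq> set (map f (p i))" "hd (map f (p i)) \<in> f ` X i"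
      "last (map f (p i)) \<in> f ` X i"
      by (auto simp: routing_def hd_map last_map)
  next
    fix w
    show "int (card (out_set k (\<lambda>i. map f (p i)) (\<lambda>i. f ` X i) w)) \<le> T"
    proof (cases "w \<in> range f")
      case True
      then obtain u where "w = f u" by blast
      moreover have "card (f ` out_set k p X u) = card (out_set k p X u)"
        by (rule card_image) (rule inj_on_subset[OF f subset_UNIV])
      ultimately show ?thesis using deg[of u] by (simp add: out_set_map[OF f])
    next
      case False
      then have "out_set k (\<lambda>i. map f (p i)) (\<lambda>i. f ` X i) w = {}"
        by (auto simp: out_set_def next_in_def)
      moreover have "0 \<le> T" using deg[of undefined] by linarith
      ultimately show ?thesis by simp
    qed
  qed
  then show "\<exists>X. routing k (\<lambda>i. map f (p i)) T X" by blast
next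
  assume "\<exists>X. routing k (\<lambda>i. map f (p i)) T X"
  then obtain X where X: "routing k (\<lambda>i. map f (p i)) T X" by blast
  define Y where "Y i = f -` X i" for i
  have fY: "f ` Y i = X i" if "i < k" for i
    using X that unfolding routing_def Y_def by fastforce
  have "routing k p T Y"
    unfolding routing_def
  proof (intro conjI allI impI)
    fix i assume i: "i < k"
    with X have "X i \<subseteq> f ` set (p i)" by (auto simp: routing_def)
    then show "Y i \<subseteq> set (p i)"
      using inj_image_mem_iff[OF f] by (fastforce simp: Y_def)
    show "hd (p i) \<in> Y i" "last (p i) \<in> Y i"
      using X i ne[OF i] by (auto simp: routing_def Y_def hd_map last_map)
  next
    fix u
    have "out_set k (\<lambda>i. map f (p i)) X (f u) = out_set k (\<lambda>i. map f (p i)) (\<lambda>i. f ` Y i) (f u)"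
      unfolding out_set_def using fY by auto
    also have "\<dots> = f ` out_set k p Y u" by (rule out_set_map[OF f])
    finally have "card (out_set k p Y u) = card (out_set k (\<lambda>i. map f (p i)) X (f u))"
      using card_image[OF inj_on_subset[OF f subset_UNIV]] by metis
    with X show "int (card (out_set k p Y u)) \<le> T" by (simp add: routing_def)
  qed
  then show "\<exists>X. routing k p T X" by blast
qed

section \<open>The algorithm\<close>

text \<open>A commodity is encoded by source, sink and arcs; the source followed by the heads of the
  arcs is the list of vertices.\<close>

definition d_path :: "data \<Rightarrow> data" where
  "d_path c = Node (left c) (d_map right (right (right c)))"

definition d_signature :: "data \<Rightarrow> data \<Rightarrow> data \<Rightarrow> data" where
  "d_signature ks u v = d_map (\<lambda>c. d_mem v (d_after u (d_path c))) ks"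

definition d_start :: "data \<Rightarrow> data \<Rightarrow> data" where
  "d_start ks vs = d_filter (\<lambda>v. d_ex (\<lambda>c. d_or (enc_bool (v = left c)) (enc_bool (v = left (right c)))) ks) vs"

text \<open>
  A vertex \<open>v\<close> joins \<open>Z\<close> if for some \<open>u \<in> Z\<close> fewer than \<open>N\<close> (in unary) of the vertices after \<open>v\<close> in
  \<open>vs\<close> come after \<open>u\<close> on the same paths as \<open>v\<close>.
\<close>

definition d_grow :: "data \<Rightarrow> data \<Rightarrow> data \<Rightarrow> data \<Rightarrow> data" where
  "d_grow ks N vs Z = d_filter_tails (\<lambda>l. d_or (d_mem (left l) Z) (d_ex (\<lambda>u.
     d_drop (d_filter (\<lambda>w. enc_bool (d_signature ks u w = d_signature ks u (left l))) (right l)) N) Z)) vs"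

text \<open>\<open>N\<close> serves twice, as the sample size and as the number of rounds.\<close>

definition d_layers :: "data \<Rightarrow> data \<Rightarrow> data \<Rightarrow> data" where
  "d_layers ks N vs = spine_rec (\<lambda>_ Z. d_grow ks N vs Z) (d_start ks vs) N"

text \<open>
  A cell \<open>Node bit (Node c v)\<close> says whether the routing of the commodity \<open>c\<close> visits \<open>v\<close>. The bits of
  a list of cells form a binary counter that runs through all candidates.
\<close>

definition d_cells :: "data \<Rightarrow> data \<Rightarrow> data" where
  "d_cells ks Z =
     d_concat_map (\<lambda>c. d_map (\<lambda>v. Node Leaf (Node c v)) (d_filter (\<lambda>v. d_mem v Z) (d_path c))) ks"

text \<open>The least significant bit comes first; \<open>r\<close> is the tail after a carry,
  \<open>right l\<close> the tail without one. A carry out of the last cell is lost, so the counter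
  keeps its length and wraps around.\<close>

definition d_inc :: "data \<Rightarrow> data" where
  "d_inc = spine_rec (\<lambda>l r. if left (left l) = Leaf then Node (Node True_data (right (left l))) (right l)
     else Node (Node Leaf (right (left l))) r) Leaf"

definition d_select :: "data \<Rightarrow> data \<Rightarrow> data" where
  "d_select cells c =
     d_map (\<lambda>e. right (right e)) (d_filter (\<lambda>e. d_and (left e) (enc_bool (left (right e) = c))) cells)"

definition d_ends :: "data \<Rightarrow> data \<Rightarrow> data" where
  "d_ends ks cells =
     d_all (\<lambda>c. d_and (d_mem (left c) (d_select cells c)) (d_mem (left (right c)) (d_select cells c))) ks"

text \<open>Cells list the vertices of a path in path order, so the first selected vertex after
  \<open>u\<close> is the next visit.\<close>

definition d_outs :: "data \<Rightarrow> data \<Rightarrow> data \<Rightarrow> data \<Rightarrow> data" where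
  "d_outs ks Z cells u = d_filter (\<lambda>v. d_ex (\<lambda>c. d_and (d_after u (d_select cells c))
     (enc_bool (left (d_after u (d_select cells c)) = v))) ks) Z"

definition d_bin_inc :: "data \<Rightarrow> data" where
  "d_bin_inc = spine_rec (\<lambda>l r. if left l = Leaf then Node True_data (right l) else Node Leaf r)
     (Node True_data Leaf)"

text \<open>The threshold \<open>n\<close> is binary and may be exponential in its size, so the
  elements of \<open>l\<close> are counted in binary as well. The flag is set when the counter has
  reached \<open>n\<close> and a further element arrives.\<close>

definition d_at_most :: "data \<Rightarrow> data \<Rightarrow> data" where
  "d_at_most l n = d_not (right (spine_rec
     (\<lambda>_ r. Node (d_bin_inc (left r)) (d_or (enc_bool (left r = n)) (right r))) (Node Leaf Leaf) l))"

definition d_check :: "data \<Rightarrow> data \<Rightarrow> data \<Rightarrow> data \<Rightarrow> data" where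
  "d_check ks Z T cells = d_and (d_ends ks cells) (d_all (\<lambda>u. d_at_most (d_outs ks Z cells u) T) Z)"

text \<open>The state consists of the counter and a flag for success so far. The unary
  \<open>M\<close> only prescribes how many candidates are tried.\<close>

definition d_search :: "data \<Rightarrow> data \<Rightarrow> data \<Rightarrow> data \<Rightarrow> data" where
  "d_search ks Z T M = right (spine_rec
     (\<lambda>_ r. Node (d_inc (left r)) (d_or (d_check ks Z T (left r)) (right r))) (Node (d_cells ks Z) Leaf) M)"

definition d_decide :: "data \<Rightarrow> data \<Rightarrow> data \<Rightarrow> data \<Rightarrow> data \<Rightarrow> data" where
  "d_decide vs T ks N M = d_and (d_not (left T)) (d_search ks (d_layers ks N vs) (right T) M)"

subsection \<open>Running time\<close>

lemma poly_time_element: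
  assumes "\<And>x. x \<in> D \<Longrightarrow> data_size x \<le> b x"
  shows "poly_time_arg D b (\<lambda>z. right z)"
  by (rule poly_time_step_args(4)) (rule assms)

lemmas poly_time_rules = poly_time_with_arg poly_time_element
  poly_time_if poly_time_Node poly_time_left poly_time_right poly_time_eq
  poly_time_and poly_time_or poly_time_not poly_time_ex poly_time_all poly_time_mem poly_time_filter
  poly_time_filter_tails poly_time_after poly_time_drop poly_time_append poly_time_map
  poly_time_concat_map poly_time_Leaf

lemma poly_time_path:
  assumes "poly_time D b C"
  shows "poly_time D b (\<lambda>x. d_path (C x))"
  unfolding d_path_def
  by (rule assms poly_time_rules with_arg_size_le poly_time_size_le[OF assms] | assumption)+

lemma poly_time_signature:
  assumes "poly_time D b K" "poly_time D b U" "poly_time D b V"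
  shows "poly_time D b (\<lambda>x. d_signature (K x) (U x) (V x))"
  unfolding d_signature_def
  by (rule assms poly_time_rules poly_time_path with_arg_size_le poly_time_size_le[OF assms(1)] | assumption)+

lemma poly_time_start:
  assumes "poly_time D b K" "poly_time D b V"
  shows "poly_time D b (\<lambda>x. d_start (K x) (V x))"
  unfolding d_start_def
  by (rule assms poly_time_rules with_arg_size_le poly_time_size_le[OF assms(1)] | assumption)+

lemma poly_time_grow:
  assumes "poly_time D b K" "poly_time D b N" "poly_time D b V" "poly_time D b Z"
  shows "poly_time D b (\<lambda>x. d_grow (K x) (N x) (V x) (Z x))"
  unfolding d_grow_def
  by (rule assms poly_time_rules poly_time_signature with_arg_size_le poly_time_size_le[OF assms(1)] | assumption)+

lemma data_size_grow: "data_size (d_grow ks N vs Z) \<le> data_size vs"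
  unfolding d_grow_def by (rule data_size_filter_tails)

lemma data_size_start: "data_size (d_start ks vs) \<le> data_size vs"
  unfolding d_start_def d_filter_eq_tails by (rule data_size_filter_tails)

lemma poly_time_layers:
  assumes K: "poly_time D b K" and N: "poly_time D b N" and V: "poly_time D b V"
  shows "poly_time D b (\<lambda>x. d_layers (K x) (N x) (V x))"
  unfolding d_layers_def
proof (rule poly_time_spine_rec_bounded[OF N poly_time_start[OF K V] _ V])
  show "poly_time_arg D b
    (\<lambda>z. d_grow (K (left z)) (N (left z)) (V (left z)) (right (right z)))"
    by (intro poly_time_grow poly_time_with_arg K N V poly_time_step_args[OF poly_time_size_le[OF V]])
  fix x l
  \<comment> \<open>All iterates are sublists of \<open>vs\<close>, which bounds them independently
    of the number of rounds.\<close>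
  have "data_size (spine_rec (\<lambda>_ Z. d_grow (K x) (N x) (V x) Z) (d_start (K x) (V x)) l) \<le> data_size (V x)"
    by (cases l) (auto intro: data_size_grow data_size_start)
  then show "data_size (spine_rec (\<lambda>_ Z. d_grow (K x) (N x) (V x) Z) (d_start (K x) (V x)) l)
      \<le> 6 * data_size (V x) + 4" by linarith
qed

lemma poly_time_cells:
  assumes "poly_time D b K" "poly_time D b Z"
  shows "poly_time D b (\<lambda>x. d_cells (K x) (Z x))"
  unfolding d_cells_def
  by (rule assms poly_time_rules poly_time_path with_arg_size_le poly_time_size_le[OF assms(1)] | assumption)+

text \<open>An upper bound for the size of a list of cells that does not grow under \<^const>\<open>d_inc\<close>.\<close>

primrec cells_bound :: "data \<Rightarrow> nat" where
  "cells_bound Leaf = 1"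
| "cells_bound (Node a l) = 2 + max 3 (data_size (left a)) + data_size (right a) + cells_bound l"

lemma data_size_le_cells_bound: "data_size l \<le> cells_bound l"
proof (induction l)
  case (Node a l)
  then show ?case by (cases a) auto
qed simp

lemma cells_bound_le: "cells_bound l \<le> 6 * data_size l"
proof (induction l)
  case (Node a l)
  then show ?case by (cases a) auto
qed simp

lemma cells_bound_inc: "cells_bound (d_inc l) \<le> cells_bound l"
  by (induction l) (auto simp: d_inc_def)

lemma poly_time_inc:
  assumes L: "poly_time D b L"
  shows "poly_time D b (\<lambda>x. d_inc (L x))"
  unfolding d_inc_def
proof (rule poly_time_spine_rec_bounded[OF L _ _ L])
  note size = poly_time_size_le[OF L]
  show "poly_time D b (\<lambda>x. Leaf)" using size by (rule poly_time_Leaf)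
  show "poly_time_arg D b (\<lambda>z. if left (left (left (right z))) = Leaf
     then Node (Node True_data (right (left (left (right z))))) (right (left (right z)))
     else Node (Node Leaf (right (left (left (right z))))) (right (right z)))"
    by (intro poly_time_if poly_time_Node poly_time_left[OF poly_time_step_args(1)[OF size]]
        poly_time_right[OF poly_time_step_args(1)[OF size]]
        poly_time_right[OF poly_time_step_args(2)[OF size]] poly_time_step_args[OF size])
  fix x l assume "data_size l \<le> data_size (L x)"
  then have "data_size (d_inc l) \<le> 6 * data_size (L x) + 4"
    using data_size_le_cells_bound[of "d_inc l"] cells_bound_inc[of l] cells_bound_le[of l] by linarith
  then show "data_size (spine_rec (\<lambda>l r. if left (left l) = Leaf
    then Node (Node True_data (right (left l))) (right l) else Node (Node Leaf (right (left l))) r) Leaf l)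
    \<le> 6 * data_size (L x) + 4" by (simp add: d_inc_def)
qed

lemma poly_time_select:
  assumes "poly_time D b L" "poly_time D b C"
  shows "poly_time D b (\<lambda>x. d_select (L x) (C x))"
  unfolding d_select_def
  by (rule assms poly_time_rules with_arg_size_le poly_time_size_le[OF assms(1)] | assumption)+

lemma poly_time_ends:
  assumes "poly_time D b K" "poly_time D b L"
  shows "poly_time D b (\<lambda>x. d_ends (K x) (L x))"
  unfolding d_ends_def
  by (rule assms poly_time_rules poly_time_select with_arg_size_le poly_time_size_le[OF assms(1)] | assumption)+

lemma poly_time_outs:
  assumes "poly_time D b K" "poly_time D b Z" "poly_time D b L" "poly_time D b U"
  shows "poly_time D b (\<lambda>x. d_outs (K x) (Z x) (L x) (U x))"
  unfolding d_outs_def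
  by (rule assms poly_time_rules poly_time_select with_arg_size_le poly_time_size_le[OF assms(1)] | assumption)+

lemma data_size_bin_inc: "data_size (d_bin_inc l) \<le> data_size l + 4"
proof (induction l)
  case (Node a l)
  then show ?case using data_size_ge_1[of a] by (auto simp: d_bin_inc_def)
qed (simp add: d_bin_inc_def)

lemma poly_time_bin_inc:
  assumes L: "poly_time D b L"
  shows "poly_time D b (\<lambda>x. d_bin_inc (L x))"
  unfolding d_bin_inc_def
proof (rule poly_time_spine_rec_bounded[OF L _ _ L])
  note size = poly_time_size_le[OF L]
  show "poly_time D b (\<lambda>x. Node True_data Leaf)"
    by (intro poly_time_Node poly_time_Leaf size)
  show "poly_time_arg D b (\<lambda>z. if left (left (right z)) = Leaf
     then Node True_data (right (left (right z))) else Node Leaf (right (right z)))"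
    by (intro poly_time_if poly_time_Node poly_time_right[OF poly_time_step_args(2)[OF size]]
        poly_time_step_args[OF size])
  fix x l assume "data_size l \<le> data_size (L x)"
  then show "data_size (spine_rec (\<lambda>l r. if left l = Leaf then Node True_data (right l) else Node Leaf r)
    (Node True_data Leaf) l) \<le> 6 * data_size (L x) + 4"
    using data_size_bin_inc[of l] unfolding d_bin_inc_def by linarith
qed

lemma poly_time_at_most:
  assumes L: "poly_time D b L" and N: "poly_time D b N"
  shows "poly_time D b (\<lambda>x. d_at_most (L x) (N x))"
  unfolding d_at_most_def
proof (intro poly_time_not poly_time_right, rule poly_time_spine_rec_add[OF L, where a = 3])
  note size = poly_time_size_le[OF L]
  show "poly_time D b (\<lambda>x. Node Leaf Leaf)"
    by (intro poly_time_Node poly_time_Leaf size)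
  show "poly_time_arg D b
    (\<lambda>z. Node (d_bin_inc (left (right (right z))))
       (d_or (enc_bool (left (right (right z)) = N (left z))) (right (right (right z)))))"
    by (intro poly_time_Node poly_time_bin_inc poly_time_or poly_time_eq poly_time_with_arg[OF N]
        poly_time_left[OF poly_time_step_args(3)[OF size]] poly_time_right[OF poly_time_step_args(3)[OF size]])
  fix x l r
  \<comment> \<open>A step adds at most 8 to the size: 4 for the counter, 2 for the flag, 1 for the
    new node, and 1 because a state \<open>Leaf\<close> would count as a pair of leaves.\<close>
  have "(2::nat) ^ 3 \<le> (b x + 2) ^ 3" by (rule power_mono) auto
  then have "8 \<le> (b x + 2) ^ 3" by simp
  moreover have "data_size (d_bin_inc (left r)) \<le> data_size (left r) + 4" by (rule data_size_bin_inc)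
  moreover have "data_size (d_or (enc_bool (left r = N x)) (right r)) \<le> data_size (right r) + 2"
    using data_size_ge_1[of "right r"] by (auto simp: d_or_def)
  moreover have "data_size (left r) + data_size (right r) \<le> data_size r + 1" by (cases r) auto
  ultimately show "data_size (Node (d_bin_inc (left r)) (d_or (enc_bool (left r = N x)) (right r)))
      \<le> data_size r + (b x + 2) ^ 3"
    unfolding data_size.simps by linarith
qed

lemma poly_time_check:
  assumes "poly_time D b K" "poly_time D b Z" "poly_time D b T" "poly_time D b L"
  shows "poly_time D b (\<lambda>x. d_check (K x) (Z x) (T x) (L x))"
  unfolding d_check_def
  by (rule assms poly_time_rules poly_time_ends poly_time_at_most poly_time_outs with_arg_size_le
      poly_time_size_le[OF assms(1)] | assumption)+

lemma poly_time_search: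
  assumes K: "poly_time D b K" and Z: "poly_time D b Z" and T: "poly_time D b T" and M: "poly_time D b M"
  shows "poly_time D b (\<lambda>x. d_search (K x) (Z x) (T x) (M x))"
  unfolding d_search_def
proof (rule poly_time_right, rule poly_time_spine_rec_bounded[OF M _ _ poly_time_cells[OF K Z]])
  note size = poly_time_size_le[OF K]
  show "poly_time D b (\<lambda>x. Node (d_cells (K x) (Z x)) Leaf)"
    by (intro poly_time_Node poly_time_cells K Z poly_time_Leaf size)
  show "poly_time_arg D b
    (\<lambda>z. Node (d_inc (left (right (right z))))
      (d_or (d_check (K (left z)) (Z (left z)) (T (left z)) (left (right (right z))))
         (right (right (right z)))))"
    by (intro poly_time_Node poly_time_inc poly_time_or poly_time_check poly_time_with_arg K Z T
        poly_time_left[OF poly_time_step_args(3)[OF size]] poly_time_right[OF poly_time_step_args(3)[OF size]])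
  fix x l
  let ?rec = "spine_rec (\<lambda>_ r. Node (d_inc (left r)) (d_or (d_check (K x) (Z x) (T x) (left r)) (right r)))
    (Node (d_cells (K x) (Z x)) Leaf)"
  \<comment> \<open>The plain size can grow when bits are set, whereas \<open>cells_bound\<close>
    charges every bit in advance and so never exceeds its initial value.\<close>
  have "cells_bound (left (?rec l)) \<le> cells_bound (d_cells (K x) (Z x)) \<and> data_size (right (?rec l)) \<le> 3
    \<and> ?rec l \<noteq> Leaf"
    by (induction l) (auto simp: d_or_def intro: le_trans[OF cells_bound_inc])
  moreover have "data_size (Node a r) = Suc (data_size a + data_size r)" for a r by simp
  ultimately show "data_size (?rec l) \<le> 6 * data_size (d_cells (K x) (Z x)) + 4"
    using data_size_le_cells_bound[of "left (?rec l)"] cells_bound_le[of "d_cells (K x) (Z x)"]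
    by (cases "?rec l") auto
qed

lemma poly_time_decide:
  assumes "poly_time D b V" "poly_time D b T" "poly_time D b K" "poly_time D b N" "poly_time D b M"
  shows "poly_time D b (\<lambda>x. d_decide (V x) (T x) (K x) (N x) (M x))"
  unfolding d_decide_def
  by (intro poly_time_and poly_time_not poly_time_left poly_time_right poly_time_search poly_time_layers assms)

subsection \<open>Correctness\<close>

definition after :: "'a \<Rightarrow> 'a list \<Rightarrow> 'a list" where
  "after u p = tl (dropWhile (\<lambda>w. w \<noteq> u) p)"

lemma d_after_enc_list [simp]: "d_after u (enc_list p) = enc_list (after u p)"
  by (induction p) (auto simp: d_after_def after_def)

lemma set_after:
  "distinct p \<Longrightarrow> v \<in> set (after u p) \<longleftrightarrow> u \<in> set p \<and> v \<in> set p \<and> position p u < position p v"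
  by (induction p) (auto simp: after_def position_def)

lemma hd_after:
  "distinct q \<Longrightarrow> after u q \<noteq> [] \<and> hd (after u q) = v \<longleftrightarrow> (u, v) \<in> set (zip q (tl q))"
proof (induction q)
  case (Cons a q)
  show ?case
  proof (cases "a = u")
    case True
    then have "u \<notin> set q" using Cons.prems by simp
    then have "(u, v) \<notin> set (zip q (tl q))" by (meson set_zip_leftD)
    with True show ?thesis by (cases q) (auto simp: after_def)
  next
    case False
    then show ?thesis using Cons by (cases q) (auto simp: after_def)
  qed
qed (simp add: after_def)

lemma d_mem_enc_list_eq: "d_mem a (enc_list xs) = enc_bool (a \<in> set xs)"
  by (induction xs) (auto simp: d_mem_def d_ex_def)

primrec keep :: "('a \<Rightarrow> 'a list \<Rightarrow> bool) \<Rightarrow> 'a list \<Rightarrow> 'a list" where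
  "keep P [] = []"
| "keep P (a # l) = (if P a l then a # keep P l else keep P l)"

lemma d_filter_tails_enc_list:
  "d_filter_tails q (enc_list xs) = enc_list (keep (\<lambda>a l. q (Node a (enc_list l)) \<noteq> Leaf) xs)"
  by (induction xs) (auto simp: d_filter_tails_def)

lemma set_keep_subset: "set (keep P l) \<subseteq> set l"
  by (induction l) auto

lemma distinct_keep: "distinct l \<Longrightarrow> distinct (keep P l)"
  using set_keep_subset by (induction l) fastforce+

text \<open>An element with fewer than \<open>n\<close> members of its class behind it is kept, so
  the last \<open>n\<close> members of the class survive, or all if there are fewer.\<close>

lemma length_filter_keep:
  assumes "\<And>a l. cls a \<Longrightarrow> length (filter cls l) < n \<Longrightarrow> P a l"
  shows "min n (length (filter cls l)) \<le> length (filter cls (keep P l))"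
  using assms by (induction l) (auto simp: min_def split: if_splits)

lemma not_kept:
  assumes "\<And>a l. cls a \<Longrightarrow> length (filter cls l) < n \<Longrightarrow> P a l"
    and "v \<in> set l" "cls v" "v \<notin> set (keep P l)"
  shows "n \<le> length (filter cls l)"
  using assms(2-4)
proof (induction l)
  case (Cons a l)
  show ?case
  proof (cases "v \<in> set l \<and> v \<notin> set (keep P l)")
    case True
    then show ?thesis using Cons.IH Cons.prems by (auto split: if_splits)
  next
    case False
    then have "a = v" "\<not> P v l" using Cons.prems by (auto split: if_splits)
    then have "n \<le> length (filter cls l)" using assms(1)[of v l] Cons.prems by (meson not_less)
    then show ?thesis by simp
  qed
qed simp

lemma length_keep_class: "length (keep (\<lambda>a l. cls a \<and> length (filter cls l) < n) l) \<le> min n (length (filter cls l))"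
  by (induction l) auto

lemma set_keep_iff_ex:
  "a \<in> set (keep P l) \<longleftrightarrow> (\<exists>l1 l2. l = l1 @ a # l2 \<and> P a l2)"
proof (induction l)
  case (Cons b l)
  have "(\<exists>l1 l2. b # l = l1 @ a # l2 \<and> P a l2) \<longleftrightarrow> b = a \<and> P b l \<or> (\<exists>l1 l2. l = l1 @ a # l2 \<and> P a l2)"
    by (auto simp: Cons_eq_append_conv)
  with Cons show ?case by auto
qed simp

lemma spine_rec_const_enc_list: "spine_rec (\<lambda>_. G) s (enc_list xs) = (G ^^ length xs) s"
  by (induction xs) auto

lemma d_bin_inc_enc_nat: "d_bin_inc (enc_nat n) = enc_nat (Suc n)"
proof (induction n rule: less_induct)
  case (less n)
  show ?case
  proof (cases "n = 0")
    case True
    then show ?thesis by (simp add: d_bin_inc_def enc_nat.simps)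
  next
    case False
    then have n: "enc_nat n = Node (enc_bool (odd n)) (enc_nat (n div 2))"
      by (subst enc_nat.simps) simp
    have Suc_n: "enc_nat (Suc n) = Node (enc_bool (even n)) (enc_nat (Suc n div 2))"
      by (subst enc_nat.simps) simp
    show ?thesis
    proof (cases "even n")
      case True
      then show ?thesis by (simp add: n Suc_n d_bin_inc_def)
    next
      case False
      then have "d_bin_inc (enc_nat (n div 2)) = enc_nat (Suc n div 2)"
        using less[of "n div 2"] \<open>n \<noteq> 0\<close> by (simp add: odd_Suc_div_two)
      with False show ?thesis by (simp add: n Suc_n d_bin_inc_def)
    qed
  qed
qed

lemma d_at_most_enc_list: "d_at_most (enc_list xs) (enc_nat t) = Leaf \<longleftrightarrow> t < length xs"
proof -
  define st where "st xs = spine_rec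
     (\<lambda>_ r. Node (d_bin_inc (left r)) (d_or (enc_bool (left r = enc_nat t)) (right r)))
     (Node Leaf Leaf) (enc_list xs)" for xs :: "data list"
  have "left (st xs) = enc_nat (length xs) \<and> (right (st xs) = Leaf \<longleftrightarrow> length xs \<le> t)"
  proof (induction xs)
    case Nil
    show ?case by (simp add: st_def enc_nat.simps)
  next
    case (Cons x xs)
    have "st (x # xs) = Node (d_bin_inc (left (st xs))) (d_or (enc_bool (left (st xs) = enc_nat t)) (right (st xs)))"
      by (simp add: st_def)
    with Cons show ?case
      by (auto simp: d_bin_inc_enc_nat enc_nat_inject)
  qed
  then show ?thesis by (auto simp: d_at_most_def st_def)
qed

section \<open>The binary counter that enumerates the candidates\<close>

fun bits_inc :: "bool list \<Rightarrow> bool list" where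
  "bits_inc [] = []"
| "bits_inc (False # r) = True # r"
| "bits_inc (True # r) = False # bits_inc r"

lemma length_bits_inc [simp]: "length (bits_inc r) = length r"
  by (induction r rule: bits_inc.induct) auto

lemma length_bits_inc_funpow [simp]: "length ((bits_inc ^^ j) r) = length r"
  by (induction j) auto

lemma bits_inc_funpow_even: "(bits_inc ^^ (2 * j)) (False # r) = False # (bits_inc ^^ j) r"
  by (induction j) auto

text \<open>The number of increments is the binary value of \<open>r\<close>: two increments of a
  list that starts with \<open>False\<close> amount to one of its tail.\<close>

lemma bits_inc_reaches: "\<exists>j < 2 ^ length r. (bits_inc ^^ j) (replicate (length r) False) = r"
proof (induction r)
  case (Cons b r)
  then obtain j where j: "j < 2 ^ length r" "(bits_inc ^^ j) (replicate (length r) False) = r" by blast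
  have even: "(bits_inc ^^ (2 * j)) (replicate (length (b # r)) False) = False # r"
    using j(2) bits_inc_funpow_even by simp
  show ?case
  proof (cases b)
    case True
    have "(bits_inc ^^ (Suc (2 * j))) (replicate (length (b # r)) False) = b # r"
      using even True by simp
    moreover have "Suc (2 * j) < 2 ^ length (b # r)" using j(1) by simp
    ultimately show ?thesis by blast
  next
    case False
    with even j(1) show ?thesis by (intro exI[of _ "2 * j"]) simp
  qed
qed simp

definition enc_cells :: "bool list \<Rightarrow> (data \<times> data) list \<Rightarrow> data" where
  "enc_cells bits items =
     enc_list (map (\<lambda>(b, c, v). Node (enc_bool b) (Node c v)) (zip bits items))"

lemma d_inc_enc_cells:
  "length bits = length items \<Longrightarrow> d_inc (enc_cells bits items) = enc_cells (bits_inc bits) items"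
proof (induction bits items rule: list_induct2)
  case (Cons b bits i items)
  then show ?case by (cases b; cases i) (auto simp: enc_cells_def d_inc_def)
qed (simp add: enc_cells_def d_inc_def)

definition selected :: "bool list \<Rightarrow> (data \<times> data) list \<Rightarrow> data \<Rightarrow> data list" where
  "selected bits items c = map (snd \<circ> snd) (filter (\<lambda>(b, c', v). b \<and> c' = c) (zip bits items))"

lemma d_select_enc_cells: "d_select (enc_cells bits items) c = enc_list (selected bits items c)"
proof -
  have "filter ((\<lambda>a. d_and (left a) (enc_bool (left (right a) = c)) \<noteq> Leaf) \<circ>
      (\<lambda>(b, c, v). Node (enc_bool b) (Node c v))) z = filter (\<lambda>(b, c', v). b \<and> c' = c) z"
    for z :: "(bool \<times> data \<times> data) list"
    by (rule filter_cong) auto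
  then show ?thesis
    by (auto simp: d_select_def enc_cells_def selected_def filter_map comp_def
        intro!: arg_cong[of _ _ enc_list] map_cong)
qed

lemma map_snd_filter_zip:
  "length bits = length items \<Longrightarrow> map snd (filter (\<lambda>x. P (snd x)) (zip bits items)) = filter P items"
  by (induction bits items rule: list_induct2) auto

text \<open>Isolates what the algorithm needs to know about an encoded instance: commodities
  \<open>c\<close> are trees from which the ends and the vertex list \<open>pth c\<close> can be
  read off. The paths are numbered by the order of \<open>cs\<close>, as routings are indexed by
  numbers.\<close>

locale encoded_paths =
  fixes vs cs :: "data list" and pth :: "data \<Rightarrow> data list" and k :: nat and p :: "nat \<Rightarrow> data list"
  assumes vs: "distinct vs" and cs: "distinct cs"
    and d_path: "c \<in> set cs \<Longrightarrow> d_path c = enc_list (pth c)"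
    and hd_path: "c \<in> set cs \<Longrightarrow> left c = hd (pth c)"
    and last_path: "c \<in> set cs \<Longrightarrow> left (right c) = last (pth c)"
    and path: "c \<in> set cs \<Longrightarrow> distinct (pth c) \<and> pth c \<noteq> [] \<and> set (pth c) \<subseteq> set vs"
    and k_def: "k = length cs" and p_def: "p = (\<lambda>i. pth (cs ! i))"
begin

lemma paths: "paths k p"
  using path by (simp add: paths_def k_def p_def)

lemma signature_eq:
  "d_signature (enc_list cs) u v = d_signature (enc_list cs) u w \<longleftrightarrow> common_after k p u v = common_after k p u w"
proof -
  have sig: "d_signature (enc_list cs) u v = enc_list (map (\<lambda>c. enc_bool (v \<in> set (after u (pth c)))) cs)" for v
    by (simp add: d_signature_def d_mem_enc_list_eq d_path cong: map_cong)
  have "common_after k p u v = {i. i < length cs \<and> v \<in> set (after u (pth (cs ! i)))}" for v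
    using path by (auto simp: common_after_def set_after k_def p_def)
  then have "common_after k p u v = common_after k p u w \<longleftrightarrow>
      (\<forall>i<length cs. v \<in> set (after u (pth (cs ! i))) \<longleftrightarrow> w \<in> set (after u (pth (cs ! i))))"
    by auto
  then show ?thesis
    by (simp add: sig enc_list_inject enc_bool_inject all_set_conv_all_nth)
qed

definition grow :: "nat \<Rightarrow> data list \<Rightarrow> data list" where
  "grow n Z = keep (\<lambda>a l. a \<in> set Z \<or> (\<exists>u\<in>set Z.
     length (filter (\<lambda>w. common_after k p u w = common_after k p u a) l) < n)) vs"

lemma d_grow_enc_list:
  "d_grow (enc_list cs) (enc_list ns) (enc_list vs) (enc_list Z) = enc_list (grow (length ns) Z)"
  by (simp add: d_grow_def d_filter_tails_enc_list grow_def signature_eq not_le)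

lemma distinct_grow: "distinct (grow n Z)"
  unfolding grow_def using vs by (rule distinct_keep)

lemma subset_grow:
  assumes "set Z \<subseteq> set vs"
  shows "set Z \<subseteq> set (grow n Z)"
proof
  fix z assume z: "z \<in> set Z"
  then obtain l1 l2 where "vs = l1 @ z # l2" using assms by (meson split_list subsetD)
  with z show "z \<in> set (grow n Z)" unfolding grow_def set_keep_iff_ex by blast
qed

text \<open>Since \<open>u\<close> was available, the rejection of \<open>v\<close> means that at
  least \<open>n\<close> vertices of its class follow it in \<open>vs\<close>; the last
  \<open>n\<close> of the class have then been added.\<close>

lemma grow_samples:
  assumes "u \<in> set Z" "v \<in> set vs" "v \<notin> set (grow n Z)"
  shows "\<exists>C. finite C \<and> C \<subseteq> set (grow n Z) \<and> n \<le> card C \<and>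
    (\<forall>w\<in>C. common_after k p u w = common_after k p u v)"
proof -
  define cls where "cls w \<longleftrightarrow> common_after k p u w = common_after k p u v" for w
  let ?P = "\<lambda>a l. a \<in> set Z \<or> (\<exists>u\<in>set Z.
     length (filter (\<lambda>w. common_after k p u w = common_after k p u a) l) < n)"
  have P: "?P a l" if "cls a" "length (filter cls l) < n" for a l
  proof -
    have "length (filter (\<lambda>w. common_after k p u w = common_after k p u a) l) < n"
      using that by (simp add: cls_def[abs_def])
    with assms(1) show ?thesis by blast
  qed
  have "n \<le> length (filter cls vs)"
    by (rule not_kept[of cls n ?P, OF P assms(2)]) (use assms(3) in \<open>auto simp: cls_def grow_def\<close>)
  with length_filter_keep[of cls n ?P vs, OF P] have "n \<le> length (filter cls (grow n Z))"
    by (simp add: grow_def)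
  then have "n \<le> card (set (filter cls (grow n Z)))"
    by (subst distinct_card) (auto intro: distinct_filter distinct_grow)
  then show ?thesis by (intro exI[of _ "set (filter cls (grow n Z))"]) (auto simp: cls_def)
qed

text \<open>A new vertex is charged to some \<open>u\<close> in \<open>Z\<close> and its signature
  as seen from \<open>u\<close>. There are at most \<open>2 ^ k\<close> signatures, and each pair is
  charged at most \<open>n\<close> times because only the last \<open>n\<close> members of a class
  qualify.\<close>

lemma card_grow: "card (set (grow n Z)) \<le> card (set Z) * (1 + 2 ^ k * n)"
proof -
  define B where "B u \<sigma> = set (keep (\<lambda>a l. common_after k p u a = \<sigma> \<and>
    length (filter (\<lambda>a. common_after k p u a = \<sigma>) l) < n) vs)" for u \<sigma>
  have "card (B u \<sigma>) \<le> n" for u \<sigma>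
    using length_keep_class[of "\<lambda>a. common_after k p u a = \<sigma>" n vs] card_length le_trans
    unfolding B_def by fastforce
  then have "(\<Sum>\<sigma>\<in>Pow {..<k}. card (B u \<sigma>)) \<le> (\<Sum>\<sigma>\<in>Pow {..<k}. n)" for u
    by (intro sum_mono)
  then have B: "card (\<Union>\<sigma>\<in>Pow {..<k}. B u \<sigma>) \<le> 2 ^ k * n" for u
    using card_UN_le[of "Pow {..<k}" "B u"] by (simp add: card_Pow) (meson le_trans)
  have "set (grow n Z) \<subseteq> set Z \<union> (\<Union>u\<in>set Z. \<Union>\<sigma>\<in>Pow {..<k}. B u \<sigma>)"
  proof
    fix a assume "a \<in> set (grow n Z)"
    then obtain l1 l2 where l: "vs = l1 @ a # l2" "a \<in> set Z \<or> (\<exists>u\<in>set Z.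
        length (filter (\<lambda>w. common_after k p u w = common_after k p u a) l2) < n)"
      unfolding grow_def set_keep_iff_ex by blast
    show "a \<in> set Z \<union> (\<Union>u\<in>set Z. \<Union>\<sigma>\<in>Pow {..<k}. B u \<sigma>)"
    proof (cases "a \<in> set Z")
      case False
      with l(2) obtain u where u: "u \<in> set Z"
        "length (filter (\<lambda>w. common_after k p u w = common_after k p u a) l2) < n" by blast
      then have "a \<in> B u (common_after k p u a)" unfolding B_def set_keep_iff_ex using l(1) by blast
      moreover have "common_after k p u a \<in> Pow {..<k}" by (auto simp: common_after_def)
      ultimately show ?thesis using u(1) by blast
    qed simp
  qed
  then have "card (set (grow n Z)) \<le> card (set Z \<union> (\<Union>u\<in>set Z. \<Union>\<sigma>\<in>Pow {..<k}. B u \<sigma>))"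
    by (intro card_mono) (auto simp: B_def)
  also have "\<dots> \<le> card (set Z) + card (\<Union>u\<in>set Z. \<Union>\<sigma>\<in>Pow {..<k}. B u \<sigma>)" by (rule card_Un_le)
  also have "card (\<Union>u\<in>set Z. \<Union>\<sigma>\<in>Pow {..<k}. B u \<sigma>) \<le> (\<Sum>u\<in>set Z. card (\<Union>\<sigma>\<in>Pow {..<k}. B u \<sigma>))"
    by (rule card_UN_le) simp
  also have "\<dots> \<le> (\<Sum>u\<in>set Z. 2 ^ k * n)" using B by (intro sum_mono)
  finally show ?thesis by (simp add: algebra_simps)
qed

definition start :: "data list" where
  "start = filter (\<lambda>v. \<exists>c\<in>set cs. v = left c \<or> v = left (right c)) vs"

lemma d_start_enc_list: "d_start (enc_list cs) (enc_list vs) = enc_list start"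
  by (auto simp: d_start_def start_def intro!: arg_cong[of _ _ enc_list] filter_cong)

lemma set_start: "set start = sources_and_sinks k p"
proof -
  have "left c \<in> set vs" "left (right c) \<in> set vs" if "c \<in> set cs" for c
    using path[OF that] hd_path[OF that] last_path[OF that] by auto
  then have "set start = (\<Union>c\<in>set cs. {left c, left (right c)})" by (auto simp: start_def)
  also have "\<dots> = (\<Union>c\<in>set cs. {hd (pth c), last (pth c)})"
    using hd_path last_path by auto
  also have "\<dots> = sources_and_sinks k p"
    by (auto simp: sources_and_sinks_def k_def p_def set_conv_nth)
  finally show ?thesis .
qed

definition layer :: "nat \<Rightarrow> nat \<Rightarrow> data list" where
  "layer n j = (grow n ^^ j) start"

lemma d_layers_enc_list:
  "d_layers (enc_list cs) (enc_list ns) (enc_list vs) = enc_list (layer (length ns) (length ns))"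
proof -
  have "((\<lambda>Z. d_grow (enc_list cs) (enc_list ns) (enc_list vs) Z) ^^ j) (enc_list start)
      = enc_list (layer (length ns) j)" for j
    by (induction j) (auto simp: layer_def d_grow_enc_list)
  then show ?thesis
    by (simp add: d_layers_def spine_rec_const_enc_list d_start_enc_list)
qed

lemma layer_subset: "set (layer n j) \<subseteq> set vs"
proof (cases j)
  case 0
  then show ?thesis by (auto simp: layer_def start_def)
next
  case (Suc i)
  then show ?thesis by (simp add: layer_def grow_def set_keep_subset)
qed

lemma distinct_layer: "distinct (layer n j)"
  using vs by (cases j) (auto simp: layer_def start_def distinct_grow)

lemma card_layer: "card (set (layer n j)) \<le> 2 * k * (1 + 2 ^ k * n) ^ j"
proof (induction j)
  case 0
  then show ?case using card_sources_and_sinks[of k p] by (simp add: layer_def set_start)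
next
  case (Suc j)
  have "card (set (layer n (Suc j))) \<le> card (set (layer n j)) * (1 + 2 ^ k * n)"
    using card_grow by (simp add: layer_def)
  also have "\<dots> \<le> 2 * k * (1 + 2 ^ k * n) ^ j * (1 + 2 ^ k * n)"
    using Suc by (rule mult_le_mono1)
  finally show ?case by (simp add: algebra_simps)
qed

lemma routing_within_layer:
  assumes "routing k p T X" "visit_bound k \<le> n" "sample_size k \<le> n"
  shows "\<exists>Y. routing k p T Y \<and> visited k Y \<subseteq> set (layer n n)"
proof (rule routing_within_layers[OF paths assms(1), where Z = "\<lambda>j. set (layer n j)"])
  show "sources_and_sinks k p \<subseteq> set (layer n 0)" by (simp add: layer_def set_start)
  show "set (layer n j) \<subseteq> set (layer n (Suc j))" for j
    using subset_grow[OF layer_subset] by (simp add: layer_def)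
  fix j u v
  assume u: "u \<in> set (layer n j)" and v: "v \<in> (\<Union>i<k. set (p i))" "v \<notin> set (layer n (Suc j))"
  from v(1) obtain i where "i < length cs" "v \<in> set (pth (cs ! i))" by (auto simp: k_def p_def)
  with path[OF nth_mem] have "v \<in> set vs" by blast
  with grow_samples[OF u this] v(2) assms(3) show "\<exists>C. finite C \<and> C \<subseteq> set (layer n (Suc j)) \<and>
      sample_size k \<le> card C \<and> (\<forall>w\<in>C. common_after k p u w = common_after k p u v)"
    by (simp add: layer_def) (meson le_trans)
qed (use assms in auto)

definition items :: "data list \<Rightarrow> (data \<times> data) list" where
  "items Z = concat (map (\<lambda>c. map (Pair c) (filter (\<lambda>v. v \<in> set Z) (pth c))) cs)"

lemma d_cells_enc_list:
  "d_cells (enc_list cs) (enc_list Z) = enc_cells (replicate (length (items Z)) False) (items Z)"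
proof -
  have "d_cells (enc_list cs) (enc_list Z)
      = enc_list (concat (map (\<lambda>c. map (\<lambda>v. Node Leaf (Node c v)) (filter (\<lambda>v. v \<in> set Z) (pth c))) cs))"
    unfolding d_cells_def by (rule d_concat_map_enc_list) (simp add: d_path)
  moreover have "map (\<lambda>(b, c, v). Node (enc_bool b) (Node c v)) (zip (replicate (length xs) False) xs)
      = map (\<lambda>(c, v). Node Leaf (Node c v)) xs" for xs :: "(data \<times> data) list"
    by (induction xs) auto
  ultimately show ?thesis
    by (simp add: enc_cells_def items_def map_concat comp_def)
qed

lemma length_items: "distinct Z \<Longrightarrow> length (items Z) \<le> k * card (set Z)"
proof -
  have "length (filter (\<lambda>v. v \<in> set Z) (pth c)) \<le> card (set Z)" if "c \<in> set cs" for c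
  proof -
    have "length (filter (\<lambda>v. v \<in> set Z) (pth c)) = card (set (filter (\<lambda>v. v \<in> set Z) (pth c)))"
      by (rule distinct_card[symmetric]) (use path[OF that] in simp)
    also have "\<dots> \<le> card (set Z)" by (rule card_mono) auto
    finally show ?thesis .
  qed
  then have "sum_list (map (\<lambda>c. length (filter (\<lambda>v. v \<in> set Z) (pth c))) cs) \<le> sum_list (map (\<lambda>c. card (set Z)) cs)"
    by (rule sum_list_mono)
  then show ?thesis
    by (simp add: items_def length_concat comp_def sum_list_triv k_def)
qed

lemma filter_items:
  assumes "c \<in> set cs"
  shows "filter (\<lambda>x. fst x = c) (items Z) = map (Pair c) (filter (\<lambda>v. v \<in> set Z) (pth c))"
proof -
  have "filter (\<lambda>x. fst x = c) (concat (map (\<lambda>c. map (Pair c) (g c)) ds))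
      = (if c \<in> set ds then map (Pair c) (g c) else [])"
    if "distinct ds" for ds and g :: "data \<Rightarrow> data list"
    using that by (induction ds) (auto simp: filter_map comp_def filter_empty_conv)
  with assms cs show ?thesis by (simp add: items_def)
qed

lemma selected_sorted:
  assumes "c \<in> set cs" "length bits = length (items Z)"
  shows "increasing (pth c) (selected bits (items Z) c)"
    and "set (selected bits (items Z) c) \<subseteq> set (pth c) \<inter> set Z"
proof -
  let ?zs = "filter (\<lambda>x. fst (snd x) = c) (zip bits (items Z))"
  have "map snd ?zs = map (Pair c) (filter (\<lambda>v. v \<in> set Z) (pth c))"
    using map_snd_filter_zip[OF assms(2), of "\<lambda>x. fst x = c"] filter_items[OF assms(1)] by simp
  then have zs: "map (snd \<circ> snd) ?zs = filter (\<lambda>v. v \<in> set Z) (pth c)"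
    by (metis (no_types, lifting) comp_apply map_idI map_map snd_conv)
  have sel: "selected bits (items Z) c = map (snd \<circ> snd) (filter fst ?zs)"
    by (auto simp: selected_def intro!: arg_cong[of _ _ "map (snd \<circ> snd)"] filter_cong)
  have "increasing (pth c) (map (snd \<circ> snd) ?zs)"
    unfolding zs using path[OF assms(1)] by (intro sorted_wrt_filter sorted_wrt_position) simp
  then show "increasing (pth c) (selected bits (items Z) c)"
    unfolding sel sorted_wrt_map by (rule sorted_wrt_filter)
  have "set (selected bits (items Z) c) \<subseteq> set (map (snd \<circ> snd) ?zs)"
    unfolding sel by auto
  then show "set (selected bits (items Z) c) \<subseteq> set (pth c) \<inter> set Z"
    unfolding zs by auto
qed

lemma check_iff_routing:
  assumes Z: "distinct Z" and bits: "length bits = length (items Z)"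
  shows "d_check (enc_list cs) (enc_list Z) (enc_nat t) (enc_cells bits (items Z)) \<noteq> Leaf \<longleftrightarrow>
    routing k p (int t) (\<lambda>i. set (selected bits (items Z) (cs ! i)))"
proof -
  let ?Q = "selected bits (items Z)"
  let ?X = "\<lambda>i. set (?Q (cs ! i))"
  have nx: "after u (?Q c) \<noteq> [] \<and> hd (after u (?Q c)) = v \<longleftrightarrow> next_in (pth c) (set (?Q c)) u v"
    if "c \<in> set cs" for c u v
  proof -
    note sorted = selected_sorted(1)[OF that bits]
    have "distinct (?Q c)"
      using sorted by (auto simp: distinct_conv_nth sorted_wrt_iff_nth_less) (metis less_irrefl linorder_neqE_nat)
    then show ?thesis using hd_after zip_tl_next_in[OF sorted] by metis
  qed
  have left_enc: "left (enc_list xs) = hd xs" if "xs \<noteq> []" for xs using that by (cases xs) auto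
  have out: "(\<exists>c\<in>set cs. after u (?Q c) \<noteq> [] \<and> hd (after u (?Q c)) = v) \<longleftrightarrow> v \<in> out_set k p ?X u" for u v
  proof -
    have "(\<exists>c\<in>set cs. P c) \<longleftrightarrow> (\<exists>i<length cs. P (cs ! i))" for P
      by (metis in_set_conv_nth)
    then have "(\<exists>c\<in>set cs. next_in (pth c) (set (?Q c)) u v) \<longleftrightarrow> v \<in> out_set k p ?X u"
      by (simp add: out_set_def k_def p_def)
    then show ?thesis using nx by simp
  qed
  have "d_outs (enc_list cs) (enc_list Z) (enc_cells bits (items Z)) u
      = enc_list (filter (\<lambda>v. v \<in> out_set k p ?X u) Z)" for u
    unfolding out[symmetric] using left_enc
    by (auto simp: d_outs_def d_select_enc_cells intro!: arg_cong[of _ _ enc_list] filter_cong)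
  moreover have XZ: "?X i \<subseteq> set (p i) \<inter> set Z" if "i < k" for i
    using selected_sorted(2)[OF _ bits] that by (simp add: k_def p_def)
  then have out_Z: "out_set k p ?X u \<subseteq> set Z" for u
    by (fastforce simp: out_set_def next_in_def)
  have "length (filter (\<lambda>v. v \<in> out_set k p ?X u) Z) = card (out_set k p ?X u)" for u
  proof -
    have "set (filter (\<lambda>v. v \<in> out_set k p ?X u) Z) = out_set k p ?X u" using out_Z by auto
    then show ?thesis using distinct_card[OF distinct_filter[OF Z]] by metis
  qed
  ultimately have "d_check (enc_list cs) (enc_list Z) (enc_nat t) (enc_cells bits (items Z)) \<noteq> Leaf \<longleftrightarrow>
      (\<forall>c\<in>set cs. left c \<in> set (?Q c) \<and> left (right c) \<in> set (?Q c)) \<and>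
      (\<forall>u\<in>set Z. card (out_set k p ?X u) \<le> t)"
    by (auto simp: d_check_def d_ends_def d_select_enc_cells d_at_most_enc_list not_less)
  \<comment> \<open>Vertices outside \<open>Z\<close> are never selected and have no arcs, so
    testing the degrees within \<open>Z\<close> is enough.\<close>
  also have "(\<forall>u\<in>set Z. card (out_set k p ?X u) \<le> t) \<longleftrightarrow> (\<forall>u. card (out_set k p ?X u) \<le> t)"
  proof -
    have "out_set k p ?X u = {}" if "u \<notin> set Z" for u
      using XZ that by (fastforce simp: out_set_def next_in_def)
    then show ?thesis by (metis card.empty le0)
  qed
  also have "(\<forall>c\<in>set cs. left c \<in> set (?Q c) \<and> left (right c) \<in> set (?Q c)) \<longleftrightarrow>
      (\<forall>i<k. ?X i \<subseteq> set (p i) \<and> hd (p i) \<in> ?X i \<and> last (p i) \<in> ?X i)"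
    using XZ hd_path last_path by (auto simp: all_set_conv_all_nth k_def p_def)
  finally show ?thesis by (simp add: routing_def)
qed

lemma selected_of_routing:
  assumes R: "routing k p T Y" and Z: "visited k Y \<subseteq> set Z"
  shows "\<exists>bits. length bits = length (items Z) \<and> (\<forall>i<k. set (selected bits (items Z) (cs ! i)) = Y i)"
proof -
  define bits where "bits = map (\<lambda>(c, v). v \<in> Y (position cs c)) (items Z)"
  have zip: "zip bits (items Z) = map (\<lambda>x. (snd x \<in> Y (position cs (fst x)), x)) (items Z)"
    by (simp add: bits_def zip_map1 zip_same_conv_map case_prod_beta)
  have "set (selected bits (items Z) (cs ! i)) = Y i" if i: "i < k" for i
  proof -
    have "set (items Z) = {(c, v). c \<in> set cs \<and> v \<in> set (pth c) \<and> v \<in> set Z}"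
      by (auto simp: items_def)
    moreover have "position cs (cs ! i) = i" using cs i by (simp add: position_nth k_def)
    ultimately have "set (selected bits (items Z) (cs ! i)) = {v. v \<in> set (pth (cs ! i)) \<and> v \<in> set Z \<and> v \<in> Y i}"
      using i by (force simp: selected_def zip k_def)
    also have "\<dots> = Y i" using R Z i by (auto simp: routing_def visited_def p_def)
    finally show ?thesis .
  qed
  then show ?thesis by (intro exI[of _ bits]) (simp add: bits_def)
qed

lemma d_search_iff:
  assumes "2 ^ length (items Z) \<le> length ms"
  shows "d_search (enc_list cs) (enc_list Z) T (enc_list ms) \<noteq> Leaf \<longleftrightarrow>
    (\<exists>bits. length bits = length (items Z) \<and> d_check (enc_list cs) (enc_list Z) T (enc_cells bits (items Z)) \<noteq> Leaf)"
proof -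
  define step where "step r = Node (d_inc (left r)) (d_or (d_check (enc_list cs) (enc_list Z) T (left r)) (right r))" for r
  let ?zero = "replicate (length (items Z)) False"
  let ?check = "\<lambda>bits. d_check (enc_list cs) (enc_list Z) T (enc_cells bits (items Z)) \<noteq> Leaf"
  have st: "left ((step ^^ j) (Node (enc_cells ?zero (items Z)) Leaf)) = enc_cells ((bits_inc ^^ j) ?zero) (items Z) \<and>
      (right ((step ^^ j) (Node (enc_cells ?zero (items Z)) Leaf)) \<noteq> Leaf \<longleftrightarrow> (\<exists>i<j. ?check ((bits_inc ^^ i) ?zero)))" for j
  proof (induction j)
    case (Suc j)
    then show ?case by (auto simp: step_def d_inc_enc_cells less_Suc_eq)
  qed simp
  have "d_search (enc_list cs) (enc_list Z) T (enc_list ms)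
      = right ((step ^^ length ms) (Node (enc_cells ?zero (items Z)) Leaf))"
    by (simp add: d_search_def d_cells_enc_list spine_rec_const_enc_list step_def[abs_def])
  then have "d_search (enc_list cs) (enc_list Z) T (enc_list ms) \<noteq> Leaf \<longleftrightarrow>
      (\<exists>i<length ms. ?check ((bits_inc ^^ i) ?zero))"
    using st by simp
  also have "\<dots> \<longleftrightarrow> (\<exists>bits. length bits = length (items Z) \<and> ?check bits)"
  proof
    assume "\<exists>bits. length bits = length (items Z) \<and> ?check bits"
    then obtain bits where b: "length bits = length (items Z)" "?check bits" by blast
    from bits_inc_reaches[of bits] obtain i where "i < 2 ^ length bits" "(bits_inc ^^ i) ?zero = bits"
      using b(1) by auto
    with b assms show "\<exists>i<length ms. ?check ((bits_inc ^^ i) ?zero)" by (intro exI[of _ i]) auto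
  next
    assume "\<exists>i<length ms. ?check ((bits_inc ^^ i) ?zero)"
    then show "\<exists>bits. length bits = length (items Z) \<and> ?check bits"
      by (metis length_bits_inc_funpow length_replicate)
  qed
  finally show ?thesis .
qed

text \<open>The exponent in the last assumption bounds the number of cells: up to \<open>k\<close>
  for each vertex of the final layer, whose size starts at no more than \<open>2 * k\<close> and is
  multiplied by at most \<open>1 + 2 ^ k * length ns\<close> in each of the \<open>length ns\<close>
  rounds. Every cell doubles the number of candidates.\<close>

lemma d_decide_iff:
  assumes ns: "visit_bound k \<le> length ns" "sample_size k \<le> length ns"
    and ms: "2 ^ (k * (2 * k * (1 + 2 ^ k * length ns) ^ length ns)) \<le> length ms"
  shows "d_decide (enc_list vs) (enc_int T) (enc_list cs) (enc_list ns) (enc_list ms) \<noteq> Leaf \<longleftrightarrow>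
    (\<exists>X. routing k p T X)"
proof (cases "T < 0")
  case True
  have "\<not> routing k p T X" for X
  proof
    assume "routing k p T X"
    \<comment> \<open>Any tree would do as the vertex; its outdegree is nonnegative, whether or not
      it lies on a path.\<close>
    then have "int (card (out_set k p X Leaf)) \<le> T" by (simp add: routing_def)
    with True show False by linarith
  qed
  with True show ?thesis by (simp add: d_decide_def enc_int_def)
next
  case False
  define t where "t = nat T"
  define Z where "Z = layer (length ns) (length ns)"
  have T: "enc_int T = Node Leaf (enc_nat t)" "T = int t" using False by (auto simp: enc_int_def t_def)
  have Z: "distinct Z" by (simp add: Z_def distinct_layer)
  have "length (items Z) \<le> k * (2 * k * (1 + 2 ^ k * length ns) ^ length ns)"
    using length_items[OF Z] card_layer[of "length ns" "length ns"]
    unfolding Z_def by (meson le_trans mult_le_mono2)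
  then have "(2::nat) ^ length (items Z) \<le> 2 ^ (k * (2 * k * (1 + 2 ^ k * length ns) ^ length ns))"
    by (rule power_increasing) simp
  with ms have len: "2 ^ length (items Z) \<le> length ms" by (rule le_trans[rotated])
  have "d_decide (enc_list vs) (enc_int T) (enc_list cs) (enc_list ns) (enc_list ms) \<noteq> Leaf \<longleftrightarrow>
      d_search (enc_list cs) (enc_list Z) (enc_nat t) (enc_list ms) \<noteq> Leaf"
    by (simp add: d_decide_def T(1) d_layers_enc_list Z_def)
  also have "\<dots> \<longleftrightarrow> (\<exists>bits. length bits = length (items Z) \<and>
      d_check (enc_list cs) (enc_list Z) (enc_nat t) (enc_cells bits (items Z)) \<noteq> Leaf)"
    by (rule d_search_iff[OF len])
  also have "\<dots> \<longleftrightarrow> (\<exists>bits. length bits = length (items Z) \<and>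
      routing k p T (\<lambda>i. set (selected bits (items Z) (cs ! i))))"
    unfolding T(2) by (intro ex_cong1 conj_cong refl) (rule check_iff_routing[OF Z])
  also have "\<dots> \<longleftrightarrow> (\<exists>X. routing k p T X)"
  proof
    assume "\<exists>X. routing k p T X"
    then obtain X where "routing k p T X" by blast
    from routing_within_layer[OF this ns] obtain Y where
      Y: "routing k p T Y" "visited k Y \<subseteq> set Z" unfolding Z_def by blast
    from selected_of_routing[OF this] obtain bits where bits: "length bits = length (items Z)"
      "\<And>i. i < k \<Longrightarrow> set (selected bits (items Z) (cs ! i)) = Y i" by blast
    have "out_set k p (\<lambda>i. set (selected bits (items Z) (cs ! i))) u = out_set k p Y u" for u
      using bits(2) by (auto simp: out_set_def)
    with Y(1) bits(2) have "routing k p T (\<lambda>i. set (selected bits (items Z) (cs ! i)))"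
      by (simp add: routing_def)
    with bits(1) show "\<exists>bits. length bits = length (items Z) \<and>
      routing k p T (\<lambda>i. set (selected bits (items Z) (cs ! i)))" by blast
  qed blast
  finally show ?thesis .
qed

end

section \<open>Computable bounds\<close>

abbreviation unary :: "nat \<Rightarrow> data" where
  "unary n \<equiv> enc_list (replicate n Leaf)"

text \<open>Iterated exponentiation. All functions of the parameter are rounded up to this shape, so
  that doubling unary lists is the only arithmetic needed for them.\<close>

definition power_tower :: "nat \<Rightarrow> nat \<Rightarrow> nat" where
  "power_tower j = (\<lambda>n. 2 ^ n) ^^ j"

definition d_exp :: "data \<Rightarrow> data" where
  "d_exp = spine_rec (\<lambda>_ r. d_append r r) (Node Leaf Leaf)"

lemma power_tower_0 [simp]: "power_tower 0 n = n"
  and power_tower_Suc [simp]: "power_tower (Suc j) n = 2 ^ power_tower j n"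
  by (simp_all add: power_tower_def)

lemma le_power_tower: "n \<le> power_tower j n"
proof (induction j)
  case (Suc j)
  have "power_tower j n \<le> 2 ^ power_tower j n" by (rule less_imp_le) simp
  from le_trans[OF Suc this] show ?case by simp
qed simp

lemma power_tower_add: "power_tower (i + j) n = power_tower i (power_tower j n)"
  by (induction i) simp_all

lemma d_exp_unary: "d_exp (unary n) = unary (2 ^ n)"
proof (induction n)
  case (Suc n)
  then have "d_exp (unary (Suc n)) = d_append (unary (2 ^ n)) (unary (2 ^ n))"
    by (simp add: d_exp_def)
  then show ?case by (simp add: replicate_add[symmetric] mult_2)
qed (simp add: d_exp_def)

lemma d_exp_funpow_unary: "(d_exp ^^ j) (unary n) = unary (power_tower j n)"
  by (induction j) (simp_all add: d_exp_unary)

lemma data_size_unary: "data_size (unary n) = 2 * n + 1"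
  by (induction n) auto

lemma spine_length_unary [simp]: "spine_length (unary n) = n"
  by (induction n) auto

lemma spine_length_size: "2 * spine_length l + 1 \<le> data_size l"
proof (induction l)
  case (Node a l)
  then show ?case using data_size_ge_1[of a] by simp
qed simp

lemma data_size_exp: "data_size (d_exp l) \<le> 3 * 2 ^ spine_length l"
proof (induction l)
  case (Node a l)
  have "data_size (d_exp (Node a l)) \<le> data_size (d_exp l) + data_size (d_exp l)"
    unfolding d_exp_def spine_rec.simps by (rule data_size_append)
  with Node(2) show ?case by simp
qed (simp add: d_exp_def)

text \<open>Exponentiation is not polynomial in its input, but it is polynomial in a bound
  \<open>b\<close> that already dominates its result.\<close>

lemma poly_time_exp:
  assumes L: "poly_time D b L" and h: "\<And>x. x \<in> D \<Longrightarrow> L x = unary (h x)"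
    and b: "\<And>x. x \<in> D \<Longrightarrow> 2 ^ h x \<le> b x"
  shows "poly_time D b (\<lambda>x. d_exp (L x))"
  unfolding d_exp_def
proof (rule poly_time_spine_rec[OF L, where a = 2])
  note size = poly_time_size_le[OF L]
  show "poly_time D b (\<lambda>x. Node Leaf Leaf)"
    by (intro poly_time_Node poly_time_Leaf size)
  show "poly_time_arg D b (\<lambda>z. d_append (right (right z)) (right (right z)))"
    by (intro poly_time_append poly_time_step_args[OF size])
  fix x l assume x: "x \<in> D" and l: "data_size l \<le> data_size (L x)"
  have "spine_length l \<le> h x"
    using spine_length_size[of l] l h[OF x] data_size_unary[of "h x"] by simp
  then have "(2::nat) ^ spine_length l \<le> 2 ^ h x" by (rule power_increasing) simp
  then have "data_size (d_exp l) \<le> 3 * b x"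
    using data_size_exp[of l] b[OF x] by linarith
  also have "\<dots> \<le> (b x + 2) ^ 2" by (simp add: power2_eq_square algebra_simps)
  finally show "data_size (spine_rec (\<lambda>_ r. d_append r r) (Node Leaf Leaf) l) \<le> (b x + 2) ^ 2"
    by (simp add: d_exp_def)
qed

lemma poly_time_exp_funpow:
  assumes L: "poly_time D b L" and h: "\<And>x. x \<in> D \<Longrightarrow> L x = unary (h x)"
    and b: "\<And>x. x \<in> D \<Longrightarrow> power_tower j (h x) \<le> b x"
  shows "poly_time D b (\<lambda>x. (d_exp ^^ j) (L x))"
  using b
proof (induction j)
  case 0
  then show ?case using L by simp
next
  case (Suc j)
  have "power_tower j (h x) \<le> b x" if "x \<in> D" for x
    using Suc.prems[OF that] by (simp add: less_imp_le[OF less_le_trans[OF less_exp]])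
  then have "poly_time D b (\<lambda>x. (d_exp ^^ j) (L x))" by (rule Suc.IH)
  then have "poly_time D b (\<lambda>x. d_exp ((d_exp ^^ j) (L x)))"
    by (rule poly_time_exp[where h = "\<lambda>x. power_tower j (h x)"])
      (use h d_exp_funpow_unary Suc.prems in auto)
  then show ?case by simp
qed

text \<open>\<open>runs\<close> starts function 0, so the expression becomes function 0 and
  everything else is shifted by one.\<close>

lemma poly_time_runs:
  assumes "poly_time D b F"
  shows "\<exists>p c. \<forall>x\<in>D. \<exists>n \<le> (b x + 2) ^ c. runs p x (F x) n"
proof -
  from assms obtain q e c where q: "computes_within q e D b F c"
    unfolding poly_time_def by blast
  let ?p = "[shift_calls 1 e] @ map (shift_calls 1) q"
  have "\<exists>n \<le> (b x + 2) ^ (c + 5). runs ?p x (F x) n" if "x \<in> D" for x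
  proof -
    from q that obtain n where n: "n \<le> (b x + 2) ^ c" "evaluates q [x] e (F x) n"
      unfolding computes_within_def by meson
    have "evaluates ?p [x] (shift_calls 1 e) (F x) n"
      using evaluates_shift_calls(1)[OF n(2), of "[shift_calls 1 e]"] by simp
    moreover have "evaluates_list ?p [x] [Arg 0] [x] 1"
      using ev_Arg[of 0 "[x]" ?p] by (intro evaluates_list_single) simp
    ultimately have "runs ?p x (F x) (Suc (1 + n))"
      unfolding runs_def by (intro ev_Call) auto
    moreover have "Suc (1 + n) \<le> (b x + 2) ^ (c + 5)"
      using n(1) power_add_two_room[of "b x" c] one_le_power_add_two[of "b x" c] by linarith
    ultimately show ?thesis by blast
  qed
  then show ?thesis by blast
qed

text \<open>The inner \<open>+ 2\<close> matches the padding in \<open>d_pad\<close>; the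
  \<open>+ 3\<close> arises when the final running time is split into a function of \<open>k\<close>
  and a power of the size.\<close>

lemma computable_power_tower: "computable (\<lambda>k. power_tower i (power_tower j (k + 2) + 3))"
proof -
  let ?f = "\<lambda>k. power_tower i (power_tower j (k + 2) + 3)"
  define D where "D = range unary"
  \<comment> \<open>Computability sets no time limit, so the bound may simply contain both towers
    that are built.\<close>
  define b where "b x = data_size x + power_tower j (spine_length x + 2) + ?f (spine_length x)" for x
  have id: "poly_time D b (\<lambda>x. x)" by (rule poly_time_id) (simp add: b_def)
  then have Leaf: "poly_time D b (\<lambda>x. Leaf)" by (auto intro: poly_time_Leaf simp: b_def)
  have inner: "poly_time D b (\<lambda>x. (d_exp ^^ j) (Node Leaf (Node Leaf x)))"
  proof (rule poly_time_exp_funpow[where h = "\<lambda>x. spine_length x + 2"])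
    show "poly_time D b (\<lambda>x. Node Leaf (Node Leaf x))" by (intro poly_time_Node Leaf id)
    show "Node Leaf (Node Leaf x) = unary (spine_length x + 2)" if "x \<in> D" for x
      using that by (auto simp: D_def)
  qed (simp add: b_def)
  have "poly_time D b (\<lambda>x. (d_exp ^^ i) (Node Leaf (Node Leaf (Node Leaf
      ((d_exp ^^ j) (Node Leaf (Node Leaf x)))))))"
  proof (rule poly_time_exp_funpow[where h = "\<lambda>x. power_tower j (spine_length x + 2) + 3"])
    show "poly_time D b (\<lambda>x. Node Leaf (Node Leaf (Node Leaf ((d_exp ^^ j) (Node Leaf (Node Leaf x))))))"
      by (intro poly_time_Node Leaf inner)
    fix x assume "x \<in> D"
    then obtain k where "x = unary k" by (auto simp: D_def)
    with d_exp_funpow_unary[of j "k + 2"]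
    show "Node Leaf (Node Leaf (Node Leaf ((d_exp ^^ j) (Node Leaf (Node Leaf x)))))
        = unary (power_tower j (spine_length x + 2) + 3)"
      by (simp add: numeral_3_eq_3)
  qed (simp add: b_def)
  from poly_time_runs[OF this] obtain p c where p: "\<And>x. x \<in> D \<Longrightarrow> \<exists>n \<le> (b x + 2) ^ c.
    runs p x ((d_exp ^^ i) (Node Leaf (Node Leaf (Node Leaf ((d_exp ^^ j) (Node Leaf (Node Leaf x))))))) n"
    by blast
  have "\<exists>n. runs p (unary k) (unary (?f k)) n" for k
  proof -
    have "Node Leaf (Node Leaf (unary m)) = unary (m + 2)" "Node Leaf (Node Leaf (Node Leaf (unary m))) = unary (m + 3)" for m
      by (simp_all add: numeral_3_eq_3)
    with p[of "unary k"] show ?thesis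
      by (auto simp: D_def d_exp_funpow_unary simp del: enc_list.simps replicate.simps)
  qed
  then show ?thesis unfolding computable_def by blast
qed

section \<open>Numerical estimates by iterated exponentials\<close>

lemma square_le_power_two: "4 \<le> n \<Longrightarrow> n * n \<le> (2::nat) ^ n"
proof (induction n rule: nat_induct_at_least)
  case (Suc n)
  have "Suc n * Suc n \<le> 2 * (n * n)"
  proof -
    have "4 * n \<le> n * n" using Suc.hyps by (rule mult_le_mono1)
    moreover have "Suc n * Suc n = n * n + 2 * n + 1" by simp
    ultimately show ?thesis using Suc.hyps by linarith
  qed
  with Suc.IH show ?case by simp
qed simp

text \<open>A further factor \<open>y\<close> costs no more than squaring the current tower, and
  squaring is dominated by one more exponentiation from 4 on. This replaces a power in the running
  time by a function known to be computable.\<close>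

lemma power_le_power_tower:
  assumes "4 \<le> y"
  shows "y ^ c \<le> power_tower c y"
proof (induction c)
  case 0
  then show ?case using assms by simp
next
  case (Suc c)
  have "y ^ Suc c = y * y ^ c" by simp
  also have "\<dots> \<le> power_tower c y * power_tower c y"
    using Suc le_power_tower[of y c] by (intro mult_le_mono)
  also have "\<dots> \<le> 2 ^ power_tower c y"
    using assms le_power_tower[of y c] by (intro square_le_power_two) linarith
  finally show ?case by simp
qed

lemma sample_size_le: "sample_size k \<le> power_tower 4 (k + 2)"
proof -
  \<comment> \<open>\<open>s\<close> is the first level of the tower and dominates \<open>4\<close>,
    \<open>2 ^ k + 1\<close> and \<open>2 * k + 1\<close>. Both summands of
    \<open>sample_size k\<close> are then at most \<open>2 ^ (s * (s * s))\<close>, and three more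
    levels suffice.\<close>
  define s :: nat where "s = 2 ^ (k + 2)"
  have k: "k < 2 ^ k" by simp
  have s: "s = 4 * 2 ^ k" by (simp add: s_def)
  have "4 \<le> s" using k by (simp add: s)
  have "s \<le> s * s" "4 * (s * s) \<le> s * (s * s)" using \<open>4 \<le> s\<close> by simp_all
  have "k * k \<le> 2 ^ k * 2 ^ k" using k by (intro mult_le_mono) auto
  then have "16 * (k * k) \<le> s * s" by (simp add: s)
  moreover have "2 ^ k \<le> s" "3 * k \<le> s" using k unfolding s by linarith+
  moreover have "visit_bound k = 2 ^ k + 3 * k + 2 * (k * k)"
    by (simp add: visit_bound_def algebra_simps)
  ultimately have "visit_bound k \<le> s * (s * s)"
    using \<open>s \<le> s * s\<close> \<open>4 * (s * s) \<le> s * (s * s)\<close> by linarith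
  also have "\<dots> \<le> 2 ^ (s * (s * s))" by (rule less_imp_le) simp
  finally have "visit_bound k \<le> 2 ^ (s * (s * s))" .
  moreover have "((2::nat) ^ k + 1) ^ (2 ^ k * (2 * k + 1)) \<le> 2 ^ (s * (s * s))"
  proof -
    have "(2::nat) ^ k + 1 \<le> s" using k by (simp add: s)
    also have "s \<le> 2 ^ s" by (rule less_imp_le) simp
    finally have "((2::nat) ^ k + 1) ^ (2 ^ k * (2 * k + 1)) \<le> (2 ^ s) ^ (2 ^ k * (2 * k + 1))"
      by (rule power_mono) simp
    also have "\<dots> \<le> (2 ^ s) ^ (s * s)"
    proof (rule power_increasing)
      have "2 ^ k \<le> s" "2 * k + 1 \<le> s" using k unfolding s by linarith+
      then show "2 ^ k * (2 * k + 1) \<le> s * s" by (rule mult_le_mono)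
    qed simp
    finally show ?thesis by (simp only: power_mult)
  qed
  ultimately have "sample_size k \<le> 2 ^ (s * (s * s) + 1)" by (simp add: sample_size_def)
  also have "\<dots> \<le> 2 ^ (2 ^ 2 ^ s)"
  proof (rule power_increasing)
    have "s * s \<le> 2 ^ s" using \<open>4 \<le> s\<close> by (rule square_le_power_two)
    moreover have "s < 2 ^ s" by simp
    ultimately have "s * (s * s) + 1 \<le> 2 ^ s * 2 ^ s"
    proof -
      have "s * (s * s) \<le> s * 2 ^ s" using \<open>s * s \<le> 2 ^ s\<close> by (rule mult_le_mono2)
      moreover have "s * 2 ^ s + 2 ^ s \<le> 2 ^ s * 2 ^ s"
        using mult_le_mono1[OF Suc_leI[OF \<open>s < 2 ^ s\<close>], of "2 ^ s"] by (simp only: mult_Suc add.commute)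
      moreover have "(1::nat) \<le> 2 ^ s" by simp
      ultimately show ?thesis by linarith
    qed
    also have "\<dots> = 2 ^ (2 * s)" by (simp add: power_add mult_2)
    also have "\<dots> \<le> 2 ^ 2 ^ s"
    proof (rule power_increasing)
      have "2 * s \<le> s * s" using \<open>4 \<le> s\<close> by simp
      then show "2 * s \<le> 2 ^ s" using \<open>s * s \<le> 2 ^ s\<close> by linarith
    qed simp
    finally show "s * (s * s) + 1 \<le> 2 ^ 2 ^ s" .
  qed simp
  also have "\<dots> = power_tower 4 (k + 2)" by (simp add: s_def eval_nat_numeral)
  finally show ?thesis .
qed

text \<open>The number of cells is at most \<open>2 ^ (n * n + 2 * n + 1)\<close>, which lies below
  three exponentiations of \<open>n\<close>; the fourth counts the candidates. With \<open>n\<close>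
  itself a tower of height 4, this leads to height 8 for the length of the search.\<close>

lemma search_space_le:
  assumes n: "4 \<le> n" "2 ^ k \<le> n"
  shows "2 ^ (k * (2 * k * (1 + 2 ^ k * n) ^ n)) \<le> power_tower 4 n"
proof -
  have nn: "n * n \<le> 2 ^ n" using n(1) by (rule square_le_power_two)
  have "k \<le> n" using n(2) less_exp[of k] by linarith
  have "1 + 2 ^ k * n \<le> 1 + n * n" using n(2) by simp
  also have "\<dots> \<le> 2 ^ (n + 1)"
  proof -
    have "(1::nat) \<le> 2 ^ n" by simp
    moreover have "(2::nat) ^ (n + 1) = 2 * 2 ^ n" by simp
    ultimately show ?thesis using nn by linarith
  qed
  finally have "(1 + 2 ^ k * n) ^ n \<le> (2 ^ (n + 1)) ^ n" by (rule power_mono) simp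
  also have "\<dots> = 2 ^ ((n + 1) * n)" by (simp only: power_mult)
  also have "(n + 1) * n = n * n + n" by simp
  finally have "2 * (1 + 2 ^ k * n) ^ n \<le> 2 ^ (n * n + n + 1)" by simp
  moreover have "k * k \<le> 2 ^ n"
    using mult_le_mono[OF \<open>k \<le> n\<close> \<open>k \<le> n\<close>] nn by linarith
  ultimately have "(k * k) * (2 * (1 + 2 ^ k * n) ^ n) \<le> 2 ^ n * 2 ^ (n * n + n + 1)"
    by (rule mult_le_mono[rotated])
  also have "\<dots> = 2 ^ (n + (n * n + n + 1))" by (simp only: power_add)
  also have "n + (n * n + n + 1) = n * n + 2 * n + 1" by simp
  also have "(2::nat) ^ (n * n + 2 * n + 1) \<le> 2 ^ 2 ^ (2 ^ n)"
  proof (rule power_increasing)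
    have "2 * n + 1 \<le> n * n" using mult_le_mono1[OF n(1), of n] n(1) by linarith
    then have "n * n + 2 * n + 1 \<le> 2 * 2 ^ n" using nn by linarith
    also have "\<dots> = 2 ^ (n + 1)" by simp
    also have "\<dots> \<le> 2 ^ 2 ^ n"
      by (rule power_increasing) (use less_exp[of n] in \<open>simp_all add: Suc_le_eq\<close>)
    finally show "n * n + 2 * n + 1 \<le> 2 ^ 2 ^ n" .
  qed simp
  finally have "k * (2 * k * (1 + 2 ^ k * n) ^ n) \<le> 2 ^ 2 ^ 2 ^ n" by (simp add: ac_simps)
  then have "(2::nat) ^ (k * (2 * k * (1 + 2 ^ k * n) ^ n)) \<le> 2 ^ (2 ^ 2 ^ 2 ^ n)"
    by (rule power_increasing) simp
  then show ?thesis by (simp add: eval_nat_numeral)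
qed

section \<open>Fixed-parameter tractability\<close>

definition d_degree_bound :: "data \<Rightarrow> data" where
  "d_degree_bound x = left (right (right x))"

definition d_commodities :: "data \<Rightarrow> data" where
  "d_commodities x = left (right (right (right x)))"

text \<open>Replacing every commodity by \<open>Leaf\<close> yields \<open>k\<close> in unary. The
  two extra elements make the first exponential \<open>4 * 2 ^ k\<close>, which gives the estimates
  their slack.\<close>

definition d_pad :: "nat \<Rightarrow> data \<Rightarrow> data" where
  "d_pad j x = (d_exp ^^ j) (Node Leaf (Node Leaf (d_map (\<lambda>_. Leaf) (d_commodities x))))"

definition d_md_spp :: "data \<Rightarrow> data" where
  "d_md_spp x = d_decide (left x) (d_degree_bound x) (d_commodities x) (d_pad 4 x) (d_pad 8 x)"

lemma routing_cong:
  "(\<And>i. i < k \<Longrightarrow> p i = q i) \<Longrightarrow> routing k p T X \<longleftrightarrow> routing k q T X"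
  by (simp add: routing_def out_set_def cong: conj_cong)

lemma d_md_spp_correct:
  assumes I: "md_spp_instance I" and x: "md_spp_encoding I x"
  shows "d_md_spp x \<noteq> Leaf \<longleftrightarrow> md_spp_yes I"
    and "d_map (\<lambda>_. Leaf) (d_commodities x) = unary (card (commodities I))"
proof -
  from x obtain vs as ks where
    vs: "distinct vs" "set vs = pverts (digraph_of I)" and
    ks: "distinct ks" "set ks = commodities I" and
    x_eq: "x = enc_list [enc_list (map enc_nat vs), enc_list (map enc_arc as),
                      enc_int (degree_bound I), enc_list (map enc_commodity ks)]"
    unfolding md_spp_encoding_def by blast
  define k where k_len: "k = length ks"
  define cs where "cs = map enc_commodity ks"
  define pth where "pth c = map enc_nat (vertex_list (inv enc_commodity c))" for c
  have k: "k = card (commodities I)" using ks distinct_card by (fastforce simp: k_len)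
  have parts: "left x = enc_list (map enc_nat vs)" "d_degree_bound x = enc_int (degree_bound I)"
    "d_commodities x = enc_list cs"
    by (simp_all add: x_eq d_degree_bound_def d_commodities_def cs_def)
  show unary_k: "d_map (\<lambda>_. Leaf) (d_commodities x) = unary (card (commodities I))"
    by (simp add: parts k[symmetric] k_len cs_def map_replicate_const)
  have pad: "d_pad j x = unary (power_tower j (k + 2))" for j
    unfolding d_pad_def unary_k k[symmetric] using d_exp_funpow_unary[of j "k + 2"] by simp
  have pth: "pth (enc_commodity c) = map enc_nat (vertex_list c)" for c
    by (simp add: pth_def inv_f_f[OF inj_enc_commodity])
  interpret encoded_paths "map enc_nat vs" cs pth k "\<lambda>i. pth (cs ! i)"
  proof
    show "distinct (map enc_nat vs)"
      using vs(1) by (simp add: distinct_map inj_on_subset[OF inj_enc_nat])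
    show "distinct cs"
      using ks(1) by (simp add: cs_def distinct_map inj_on_subset[OF inj_enc_commodity])
    show "k = length cs" by (simp add: k_len cs_def)
    fix c assume "c \<in> set cs"
    then obtain s t P where c: "c = enc_commodity (s, t, P)" "(s, t, P) \<in> commodities I"
      using ks(2) by (auto simp: cs_def)
    note facts = commodity_facts[OF I c(2)]
    have "right \<circ> enc_arc = enc_nat \<circ> snd" by (auto simp: enc_arc_def)
    then show "d_path c = enc_list (pth c)"
      unfolding c(1) pth by (simp add: d_path_def enc_commodity_def vertex_list_def)
    show "left c = hd (pth c)"
      unfolding c(1) pth by (simp add: enc_commodity_def vertex_list_def)
    show "left (right c) = last (pth c)"
      unfolding c(1) pth using facts(4) by (subst last_map) (auto simp: enc_commodity_def vertex_list_def)
    show "distinct (pth c) \<and> pth c \<noteq> [] \<and> set (pth c) \<subseteq> set (map enc_nat vs)"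
      unfolding c(1) pth
    proof (intro conjI)
      show "distinct (map enc_nat (vertex_list (s, t, P)))"
        using facts(3) inj_on_subset[OF inj_enc_nat subset_UNIV] by (intro iffD2[OF distinct_map] conjI)
      show "map enc_nat (vertex_list (s, t, P)) \<noteq> []" by (simp add: vertex_list_def)
      show "set (map enc_nat (vertex_list (s, t, P))) \<subseteq> set (map enc_nat vs)"
        unfolding set_map using facts(5) vs(2) by (intro image_mono) simp
    qed
  qed simp
  let ?n = "power_tower 4 (k + 2)"
  have sample: "sample_size k \<le> ?n" by (rule sample_size_le)
  have "2 ^ (k + 2) \<le> ?n"
    using le_power_tower[of "power_tower 1 (k + 2)" 3] power_tower_add[of 3 1 "k + 2"] by simp
  then have n: "2 ^ k \<le> ?n" "4 \<le> ?n"
  proof -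
    have "(1::nat) \<le> 2 ^ k" "(2::nat) ^ (k + 2) = 4 * 2 ^ k" by simp_all
    with \<open>2 ^ (k + 2) \<le> ?n\<close> show "2 ^ k \<le> ?n" "4 \<le> ?n" by linarith+
  qed
  have "d_md_spp x \<noteq> Leaf \<longleftrightarrow> (\<exists>X. routing k (\<lambda>i. pth (cs ! i)) (degree_bound I) X)"
    unfolding d_md_spp_def parts pad
  proof (rule d_decide_iff)
    show "sample_size k \<le> length (replicate ?n Leaf)" using sample by simp
    then show "visit_bound k \<le> length (replicate ?n Leaf)" by (simp add: sample_size_def)
    have "power_tower 8 (k + 2) = power_tower 4 ?n" using power_tower_add[of 4 4] by simp
    then show "2 ^ (k * (2 * k * (1 + 2 ^ k * length (replicate ?n Leaf)) ^ length (replicate ?n Leaf)))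
        \<le> length (replicate (power_tower 8 (k + 2)) Leaf)"
      using search_space_le[OF n(2,1)] by simp
  qed
  also have "\<dots> \<longleftrightarrow> (\<exists>X. routing k (\<lambda>i. map enc_nat (vertex_list (ks ! i))) (degree_bound I) X)"
    by (intro ex_cong1 routing_cong) (simp add: cs_def k_len pth)
  also have "\<dots> \<longleftrightarrow> (\<exists>X. routing k (\<lambda>i. vertex_list (ks ! i)) (degree_bound I) X)"
    by (rule routing_map[OF inj_enc_nat]) (simp add: vertex_list_def split: prod.split)
  also have "\<dots> \<longleftrightarrow> md_spp_yes I"
    unfolding k_len using routing_of_solution[OF I ks(2)] solution_of_routing[OF I ks(2)] by blast
  finally show "d_md_spp x \<noteq> Leaf \<longleftrightarrow> md_spp_yes I" .
qed

theorem theorem10: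
  shows "fixed_parameter_tractable {I. md_spp_instance I} md_spp_encoding
           (\<lambda>I. card (commodities I)) {I. md_spp_yes I}"
proof -
  define D where "D = {x. \<exists>I. md_spp_instance I \<and> md_spp_encoding I x}"
  \<comment> \<open>The bound must be a function of the input tree, so the parameter is read off
    from it.\<close>
  define kx where "kx x = spine_length (d_map (\<lambda>_. Leaf) (d_commodities x))" for x
  \<comment> \<open>The unary list that controls the search has length
    \<open>power_tower 8 (kx x + 2)\<close>; with it in the bound, the whole algorithm is
    polynomial.\<close>
  define b where "b x = data_size x + power_tower 8 (kx x + 2)" for x
  have kx: "d_map (\<lambda>_. Leaf) (d_commodities x) = unary (kx x)" if "x \<in> D" for x
    using that d_md_spp_correct(2) by (auto simp: D_def kx_def)
  have tower_4_le: "power_tower 4 m \<le> power_tower 8 m" for m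
    using power_tower_add[of 4 4 m] le_power_tower[of "power_tower 4 m" 4] by simp
  have id: "poly_time D b (\<lambda>x. x)" by (rule poly_time_id) (simp add: b_def)
  have comm: "poly_time D b d_commodities" "poly_time D b d_degree_bound"
    unfolding d_commodities_def[abs_def] d_degree_bound_def[abs_def]
    by (intro poly_time_left poly_time_right id)+
  have pad: "poly_time D b (d_pad j)" if "j = 4 \<or> j = 8" for j
    unfolding d_pad_def[abs_def]
  proof (rule poly_time_exp_funpow[where h = "\<lambda>x. kx x + 2"])
    note size = poly_time_size_le[OF id]
    have arg: "poly_time_arg D b (\<lambda>z. Leaf)"
      by (rule poly_time_step_args(5)) (rule size)
    show "poly_time D b (\<lambda>x. Node Leaf (Node Leaf (d_map (\<lambda>_. Leaf) (d_commodities x))))"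
      by (intro poly_time_Node poly_time_Leaf[OF size] poly_time_map comm arg)
    show "Node Leaf (Node Leaf (d_map (\<lambda>_. Leaf) (d_commodities x))) = unary (kx x + 2)" if "x \<in> D" for x
      by (simp add: kx[OF that])
    show "power_tower j (kx x + 2) \<le> b x" for x
      using that tower_4_le[of "kx x + 2"] by (auto simp: b_def)
  qed
  have "poly_time D b d_md_spp"
    unfolding d_md_spp_def[abs_def]
    by (intro poly_time_decide poly_time_left id comm pad) simp_all
  from poly_time_runs[OF this] obtain p c where
    p: "\<And>x. x \<in> D \<Longrightarrow> \<exists>n \<le> (b x + 2) ^ c. runs p x (d_md_spp x) n" by blast
  define f where "f k = power_tower c (power_tower 8 (k + 2) + 3)" for k
  have "computable f" unfolding f_def[abs_def] by (rule computable_power_tower)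
  moreover have "\<exists>v n. runs p x v n \<and> n \<le> f (card (commodities I)) * data_size x ^ c \<and>
      (v \<noteq> Leaf \<longleftrightarrow> md_spp_yes I)"
    if I: "md_spp_instance I" and x: "md_spp_encoding I x" for I x
  proof -
    have "x \<in> D" using I x by (auto simp: D_def)
    from p[OF this] obtain n where n: "n \<le> (b x + 2) ^ c" "runs p x (d_md_spp x) n" by blast
    have k: "kx x = card (commodities I)"
      using d_md_spp_correct(2)[OF I x] by (simp add: kx_def)
    let ?E = "power_tower 8 (card (commodities I) + 2)"
    \<comment> \<open>The sum is turned into a product by means of
      \<open>1 \<le> data_size x\<close>, which separates the parameter from the size.\<close>
    have "b x + 2 = data_size x + (?E + 2) * 1" by (simp add: b_def k)
    also have "\<dots> \<le> data_size x + (?E + 2) * data_size x"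
      using data_size_ge_1[of x] by (intro add_left_mono mult_le_mono2)
    also have "\<dots> = (?E + 3) * data_size x" by (simp add: algebra_simps)
    finally have "(b x + 2) ^ c \<le> ((?E + 3) * data_size x) ^ c" by (rule power_mono) simp
    also have "\<dots> = (?E + 3) ^ c * data_size x ^ c" by (rule power_mult_distrib)
    also have "\<dots> \<le> f (card (commodities I)) * data_size x ^ c"
    proof (rule mult_le_mono1)
      have "4 \<le> ?E + 3" using le_power_tower[of "card (commodities I) + 2" 8] by linarith
      then show "(?E + 3) ^ c \<le> f (card (commodities I))"
        unfolding f_def by (rule power_le_power_tower)
    qed
    finally show ?thesis
      using n d_md_spp_correct(1)[OF I x] by (meson le_trans)
  qed
  ultimately show ?thesis
    unfolding fixed_parameter_tractable_def by (intro exI[of _ p] exI[of _ f] exI[of _ c]) auto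
qed

end
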